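(* Let $N\ge1$, $1<p<\infty$, $0<s<1$, and let $\Omega\subset\mathbb{R}^N$ be a bounded open set with Lipschitz boundary. Define the first eigenvalue $$\lambda^{s+\log}_{1,p}:=\inf\left\{\mathcal{J}_{s+\log,p}(u,u):\ u\in W^{s+\log,p}_0(\Omega),\ \|u\|_{L^p(\Omega)}=1\right\}.$$ This infimum is attained, and an associated extremal function $\phi^{s+\log}_{1,p}$ (a function attaining it) is an eigenfunction corresponding to the eigenvalue $\lambda^{s+\log}_{1,p}$. Moreover, if $\mathrm{diam}(\Omega)<e^{-\frac1{sp}}$ and $B(N,s,p)\ge0$, then: (1) $\lambda^{s+\log}_{1,p}$ is strictly positive, and the corresponding eigenfunction $\phi^{s+\log}_{1,p}$ can be chosen to be nonnegative in $\Omega$. (2) $\lambda^{s+\log}_{1,p}$ is simple, in the sense that if $v\in W^{s+\log,p}_0(\Omega)$ is another eigenfunction associated with $\lambda^{s+\log}_{1,p}$, then there exists a constant $c\ne0$ such that $\phi^{s+\log}_{1,p}=c\,v$. (3) If $u\in W^{s+\log,p}_0(\Omega)$ is an eigenfunction associated with an eigenvalue $\lambda$ such that $u>0$ in $\Omega$, then $\lambda=\lambda^{s+\log}_{1,p}$.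
   Context: A nonzero function $u\in W^{s+\log,p}_0(\Omega)$ is an eigenfunction associated with the eigenvalue $\lambda\in\mathbb{R}$ (of the problem $(-\Delta)^{s+\log}_pu=\lambda|u|^{p-2}u$ in $\Omega$, $u=0$ in $\mathbb{R}^N\setminus\Omega$) if $$\mathcal{J}_{s+\log,p}(u,\varphi)=\lambda\int_\Omega|u|^{p-2}u\,\varphi\,dx\qquad\text{for all }\varphi\in W^{s+\log,p}_0(\Omega).$$ Notation: $\mathrm{diam}(\Omega)=\sup\{|x-y|:x,y\in\Omega\}$; $(a)_\pm=\max\{0,\pm a\}$; $\psi=\Gamma'/\Gamma$; $$C(N,s,p)=\begin{cases}\dfrac{s\,p\,2^{2(s-1)}\,\Gamma\left(\frac{N+sp}{2}\right)}{\pi^{\frac{N-1}{2}}\,\Gamma(1-s)\,\Gamma\left(\frac{p+1}{2}\right)}, & s>\tfrac12,\\[8pt]\dfrac{s\,p\,2^{2s-1}\,\Gamma\left(\frac{N+sp}{2}\right)}{\pi^{\frac N2}\,\Gamma(1-s)}, & s\le\tfrac12,\end{cases}\qquad B(N,s,p)=2\ln2+\frac1s+\frac p2\psi\Big(\frac{N+sp}{2}\Big)+\psi(1-s).$$ Kernels: $\mathbf{k}^{s+\log,\pm}_p(z):=\dfrac{C(N,s,p)(-\ln|z|)_\pm}{|z|^{N+sp}}$, $z\in\mathbb{R}^N\setminus\{0\}$. $W^{s+\log,p}_0(\Omega)$ is the space of real-valued $u\in L^p(\mathbb{R}^N)$ with $u=0$ a.e. in $\mathbb{R}^N\setminus\Omega$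 and $\iint_{\mathbb{R}^{2N}}|u(x)-u(y)|^p\mathbf{k}^{s+\log,+}_p(x-y)\,dx\,dy<\infty$. Energy forms: $$\mathcal{J}_\pm(u,v)=\iint_{\mathbb{R}^{2N}}|u(x)-u(y)|^{p-2}(u(x)-u(y))(v(x)-v(y))\,\mathbf{k}^{s+\log,\pm}_p(x-y)\,dx\,dy,$$ $$\mathcal{J}_s(u,v)=\iint_{\mathbb{R}^{2N}}\frac{|u(x)-u(y)|^{p-2}(u(x)-u(y))(v(x)-v(y))}{|x-y|^{N+sp}}\,dx\,dy,$$ $$\mathcal{J}_{s+\log,p}(u,v)=\frac p2\big(\mathcal{J}_+(u,v)-\mathcal{J}_-(u,v)\big)+\frac{B(N,s,p)C(N,s,p)}{2}\mathcal{J}_s(u,v).$$ *)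

theory Defs
  imports "HOL-Analysis.Analysis"
begin

text \<open>
  Euclidean space \<open>\<real>\<^sup>N\<close> is a type \<open>'a :: euclidean_space\<close> with \<open>N = DIM('a) \<ge> 1\<close>.
  Elements of \<open>L\<^sup>p\<close> and of the Sobolev-type space are represented by Borel functions (every
  a.e.-class contains one), and all pointwise statements about them are meant almost everywhere.
\<close>

text \<open>
  Near every boundary point, and up to a rigid motion, \<open>\<Omega>\<close> is the strict epigraph of a Lipschitz
  function: \<open>e\<close> is the vertical direction and \<open>y - (y \<bullet> e) *\<^sub>R e\<close> is the horizontal part of \<open>y\<close>.
\<close>

definition lipschitz_boundary :: "'a::euclidean_space set \<Rightarrow> bool" where
  "lipschitz_boundary \<Omega> \<longleftrightarrow>
     (\<forall>x\<in>frontier \<Omega>. \<exists>r>0. \<exists>e g L. norm e = 1 \<and> L-lipschitz_on {y. y \<bullet> e = 0} g \<and>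
        \<Omega> \<inter> ball x r = {y \<in> ball x r. g (y - (y \<bullet> e) *\<^sub>R e) < y \<bullet> e})"

definition C_const :: "nat \<Rightarrow> real \<Rightarrow> real \<Rightarrow> real" where
  "C_const N s p =
     (if s > 1/2
      then (s * p * 2 powr (2 * (s - 1)) * Gamma ((real N + s * p) / 2)) /
           (pi powr ((real N - 1) / 2) * Gamma (1 - s) * Gamma ((p + 1) / 2))
      else (s * p * 2 powr (2 * s - 1) * Gamma ((real N + s * p) / 2)) /
           (pi powr (real N / 2) * Gamma (1 - s)))"

definition B_const :: "nat \<Rightarrow> real \<Rightarrow> real \<Rightarrow> real" where
  "B_const N s p =
     2 * ln 2 + 1 / s + p / 2 * Digamma ((real N + s * p) / 2) + Digamma (1 - s)"

definition kernel_plus :: "real \<Rightarrow> real \<Rightarrow> 'a::euclidean_space \<Rightarrow> real" where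
  "kernel_plus s p z =
     C_const DIM('a) s p * max 0 (- ln (norm z)) / norm z powr (real DIM('a) + s * p)"

definition kernel_minus :: "real \<Rightarrow> real \<Rightarrow> 'a::euclidean_space \<Rightarrow> real" where
  "kernel_minus s p z =
     C_const DIM('a) s p * max 0 (ln (norm z)) / norm z powr (real DIM('a) + s * p)"

text \<open>
  The map \<open>t \<mapsto> |t|\<^bsup>p-2\<^esup>t\<close>, with value \<open>0\<close> at \<open>t = 0\<close> also when \<open>p < 2\<close>.
\<close>

definition spow :: "real \<Rightarrow> real \<Rightarrow> real" where
  "spow p t = \<bar>t\<bar> powr (p - 2) * t"

definition W0 :: "real \<Rightarrow> real \<Rightarrow> 'a::euclidean_space set \<Rightarrow> ('a \<Rightarrow> real) set" where
  "W0 s p \<Omega> =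
     {u. u \<in> borel_measurable lborel \<and>
         integrable lborel (\<lambda>x. \<bar>u x\<bar> powr p) \<and>
         (AE x in lborel. x \<notin> \<Omega> \<longrightarrow> u x = 0) \<and>
         (\<integral>\<^sup>+ (x, y). ennreal (\<bar>u x - u y\<bar> powr p * kernel_plus s p (x - y))
            \<partial>(lborel \<Otimes>\<^sub>M lborel)) < \<infinity>}"

text \<open>
  For \<open>u, v \<in> W0 s p \<Omega>\<close> with \<open>\<Omega>\<close> bounded the three integrands below are integrable, so
  that the default value of the Bochner integral plays no role.
\<close>

definition J_plus :: "real \<Rightarrow> real \<Rightarrow> ('a::euclidean_space \<Rightarrow> real) \<Rightarrow> ('a \<Rightarrow> real) \<Rightarrow> real" where
  "J_plus s p u v =
     (\<integral>(x, y). spow p (u x - u y) * (v x - v y) * kernel_plus s p (x - y) \<partial>(lborel \<Otimes>\<^sub>M lborel))"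

definition J_minus :: "real \<Rightarrow> real \<Rightarrow> ('a::euclidean_space \<Rightarrow> real) \<Rightarrow> ('a \<Rightarrow> real) \<Rightarrow> real" where
  "J_minus s p u v =
     (\<integral>(x, y). spow p (u x - u y) * (v x - v y) * kernel_minus s p (x - y) \<partial>(lborel \<Otimes>\<^sub>M lborel))"

definition J_frac :: "real \<Rightarrow> real \<Rightarrow> ('a::euclidean_space \<Rightarrow> real) \<Rightarrow> ('a \<Rightarrow> real) \<Rightarrow> real" where
  "J_frac s p u v =
     (\<integral>(x, y). spow p (u x - u y) * (v x - v y) / norm (x - y) powr (real DIM('a) + s * p)
        \<partial>(lborel \<Otimes>\<^sub>M lborel))"

definition J_log :: "real \<Rightarrow> real \<Rightarrow> ('a::euclidean_space \<Rightarrow> real) \<Rightarrow> ('a \<Rightarrow> real) \<Rightarrow> real" where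
  "J_log s p u v =
     p / 2 * (J_plus s p u v - J_minus s p u v) +
     B_const DIM('a) s p * C_const DIM('a) s p / 2 * J_frac s p u v"

definition eigenfunction ::
    "real \<Rightarrow> real \<Rightarrow> 'a::euclidean_space set \<Rightarrow> real \<Rightarrow> ('a \<Rightarrow> real) \<Rightarrow> bool" where
  "eigenfunction s p \<Omega> \<mu> u \<longleftrightarrow>
     u \<in> W0 s p \<Omega> \<and> \<not> (AE x in lborel. u x = 0) \<and>
     (\<forall>\<phi>\<in>W0 s p \<Omega>. J_log s p u \<phi> = \<mu> * (LINT x:\<Omega>|lborel. spow p (u x) * \<phi> x))"

definition Lp_norm :: "real \<Rightarrow> 'a::euclidean_space set \<Rightarrow> ('a \<Rightarrow> real) \<Rightarrow> real" where
  "Lp_norm p \<Omega> u = (LINT x:\<Omega>|lborel. \<bar>u x\<bar> powr p) powr (1 / p)"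

definition normalized_W0 :: "real \<Rightarrow> real \<Rightarrow> 'a::euclidean_space set \<Rightarrow> ('a \<Rightarrow> real) set" where
  "normalized_W0 s p \<Omega> = {u \<in> W0 s p \<Omega>. Lp_norm p \<Omega> u = 1}"

definition lambda1 :: "real \<Rightarrow> real \<Rightarrow> 'a::euclidean_space set \<Rightarrow> real" where
  "lambda1 s p \<Omega> = (INF u\<in>normalized_W0 s p \<Omega>. J_log s p u u)"

definition extremal :: "real \<Rightarrow> real \<Rightarrow> 'a::euclidean_space set \<Rightarrow> ('a \<Rightarrow> real) \<Rightarrow> bool" where
  "extremal s p \<Omega> \<phi> \<longleftrightarrow> \<phi> \<in> normalized_W0 s p \<Omega> \<and> J_log s p \<phi> \<phi> = lambda1 s p \<Omega>"

end

theory Submission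
  imports Defs "HOL-Complex_Analysis.Great_Picard"
begin

text \<open>
  The three energy forms combine into one double integral with the radial kernel
  \<open>K(z) = C/2 (B - p ln |z|) / |z|\<^sup>N\<^sup>+\<^sup>s\<^sup>p\<close>, which is positive for small \<open>|z|\<close> and negative for large \<open>|z|\<close>.

  Existence. Near the origin \<open>K\<close> dominates the kernel of the fractional \<open>p\<close>-Laplacian, and away from it
  \<open>K\<close> is integrable. So the energy controls a fractional seminorm up to a multiple of the \<open>L\<^sup>p\<close> norm, and
  it is bounded below on the unit sphere. A minimising sequence has a subsequence that converges in
  \<open>L\<^sup>p\<close> (\<open>Lp_compactness\<close>, by averages over fine grids), and Fatou's lemma, applied to the integrand
  plus a multiple of the absolute values of the integrable part, shows that the limit is extremal
  (\<open>extremal_exists\<close>). Differentiating the Rayleigh quotient gives the eigenvalue equation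
  (\<open>extremal_imp_eigenfunction\<close>).

  Small domains. If the diameter is below \<open>e\<^sup>-\<^sup>1\<^sup>/\<^sup>s\<^sup>p\<close> and \<open>B \<ge> 0\<close>, then \<open>K\<close> is positive at differences of points
  of \<open>\<Omega>\<close>. It is not positive everywhere, but for functions that vanish outside \<open>\<Omega>\<close> the remaining part
  of the double integral only involves the integral of \<open>K(x - y)\<close> over \<open>y \<notin> \<Omega>\<close>, and that integral is
  bounded below by the integral of \<open>K\<close> over a region \<open>|z| \<ge> d\<close>, whose sign is computed by scaling
  (\<open>log_tail_integral_pos\<close>). Consequently, inequalities between integrands carry over to the energies,
  with equality only if they are equalities almost everywhere on \<open>\<Omega> \<times> \<Omega>\<close> (\<open>positivity\<close>). Four
  pointwise inequalities then yield the claims. \<open>|u(x) - u(y)|\<^sup>p \<ge> 0\<close> gives a positive first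
  eigenvalue. \<open>||u(x)| - |u(y)|| \<le> |u(x) - u(y)|\<close> shows that extremal functions have a constant sign. Convexity of
  \<open>|w(x) - w(y)|\<^sup>p\<close> along the curves of \<open>p\<close>-means \<open>w = ((1 - t) u\<^sup>p + t v\<^sup>p)\<^sup>1\<^sup>/\<^sup>p\<close> (\<open>hidden_convexity\<close>)
  has the equality case \<open>u(x) v(y) = v(x) u(y)\<close>, which makes two nonnegative extremal functions proportional.
  Finally, the tangent inequality for \<open>|t|\<^sup>p\<close> together with the same curves excludes positive
  eigenfunctions for higher eigenvalues.
\<close>

section \<open>Powers, tangent inequalities and p-means\<close>

lemma powr_left_injective:
  fixes p x y :: real
  assumes "0 < p" "0 \<le> x" "0 \<le> y" "x powr p = y powr p"
  shows "x = y"
  using assms powr_less_mono2[of p x y] powr_less_mono2[of p y x] by linarith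

lemma spow_eq_sgn: "spow p t = sgn t * \<bar>t\<bar> powr (p - 1)"
proof (cases "t = 0")
  case False
  then have "\<bar>t\<bar> powr (p - 1) = \<bar>t\<bar> powr (p - 2) * \<bar>t\<bar>"
    using powr_add[of "\<bar>t\<bar>" "p - 2" 1] by simp
  then show ?thesis by (simp add: spow_def sgn_if abs_if split: if_splits)
qed (simp add: spow_def)

lemma spow_0 [simp]: "spow p 0 = 0"
  by (simp add: spow_def)

lemma spow_minus: "spow p (- t) = - spow p t"
  by (simp add: spow_def)

lemma spow_times_self: "spow p t * t = \<bar>t\<bar> powr p"
proof (cases "t = 0")
  case False
  then have "\<bar>t\<bar> powr p = \<bar>t\<bar> powr (p - 2) * (\<bar>t\<bar> * \<bar>t\<bar>)"
    using powr_add[of "\<bar>t\<bar>" "p - 2" 2] by (simp add: powr_numeral power2_eq_square)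
  then show ?thesis by (simp add: spow_def)
qed simp

lemma abs_spow: "\<bar>spow p t\<bar> = \<bar>t\<bar> powr (p - 1)"
  by (cases "t = 0") (simp_all add: spow_eq_sgn abs_mult)

lemma spow_pos: "0 < t \<Longrightarrow> spow p t = t powr (p - 1)"
  by (simp add: spow_eq_sgn)

lemma spow_nonneg: "0 \<le> t \<Longrightarrow> 0 \<le> spow p t"
  by (simp add: spow_def)

lemma spow_measurable [measurable]: "spow p \<in> borel_measurable borel"
  unfolding spow_def by measurable

lemma isCont_spow:
  assumes "1 < p" shows "isCont (spow p) t"
proof -
  have eq: "spow p = (\<lambda>t. max 0 t powr (p - 1) - max 0 (- t) powr (p - 1))"
    using assms by (auto simp: spow_eq_sgn fun_eq_iff max_def sgn_if)
  have "continuous_on UNIV (spow p)"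
    unfolding eq using assms by (intro continuous_intros continuous_on_powr') auto
  then show ?thesis by (simp add: continuous_on_eq_continuous_at)
qed

lemma powr_le_sum_powr:
  fixes a b c p :: real
  assumes "0 \<le> p" "0 \<le> a" "0 \<le> b" "0 \<le> c" "c \<le> a + b"
  shows "c powr p \<le> 2 powr p * (a powr p + b powr p)"
proof -
  have "c powr p \<le> (2 * max a b) powr p"
    using assms by (intro powr_mono2) auto
  also have "\<dots> = 2 powr p * max a b powr p"
    using assms by (simp add: powr_mult)
  also have "\<dots> \<le> 2 powr p * (a powr p + b powr p)"
    by (intro mult_left_mono) (auto simp: max_def)
  finally show ?thesis .
qed

lemma abs_diff_powr_le:
  fixes a b p :: real
  assumes "0 \<le> p"
  shows "\<bar>a - b\<bar> powr p \<le> 2 powr p * (\<bar>a\<bar> powr p + \<bar>b\<bar> powr p)"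
  using assms by (intro powr_le_sum_powr) auto

lemma abs_add_powr_le:
  fixes a b p :: real
  assumes "0 \<le> p"
  shows "\<bar>a + b\<bar> powr p \<le> 2 powr p * (\<bar>a\<bar> powr p + \<bar>b\<bar> powr p)"
  using assms by (intro powr_le_sum_powr) auto

lemma abs_spow_mult_le:
  assumes "1 < p"
  shows "\<bar>spow p a * b\<bar> \<le> \<bar>a\<bar> powr p + \<bar>b\<bar> powr p"
proof -
  let ?m = "max \<bar>a\<bar> \<bar>b\<bar>"
  have "\<bar>spow p a * b\<bar> = \<bar>a\<bar> powr (p - 1) * \<bar>b\<bar>"
    by (simp add: abs_mult abs_spow)
  also have "\<dots> \<le> ?m powr (p - 1) * ?m"
    using assms by (intro mult_mono powr_mono2) auto
  also have "\<dots> = ?m powr p"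
    using powr_mult_base[of ?m "p - 1"] by (simp add: mult.commute)
  also have "\<dots> \<le> \<bar>a\<bar> powr p + \<bar>b\<bar> powr p"
    by (auto simp: max_def)
  finally show ?thesis .
qed

text \<open>
  With \<open>y = t\<^sup>p\<close> this strict form of Bernoulli's inequality says that \<open>y\<^sup>1\<^sup>/\<^sup>p\<close> is strictly below
  its tangent at \<open>y = 1\<close>, which follows from the strict concavity of the logarithm.
\<close>

lemma bernoulli_powr_strict:
  fixes t p :: real
  assumes "1 < p" "0 < t" "t \<noteq> 1"
  shows "1 + p * (t - 1) < t powr p"
proof -
  define y where "y = t powr p"
  define m where "m = y / p + (1 - 1 / p)"
  have y: "0 < y" using assms by (simp add: y_def)
  have m: "0 < m" unfolding m_def using y assms by (intro add_pos_pos) (auto simp: field_simps)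
  have lny: "ln y = p * ln t" using assms by (simp add: y_def ln_powr)
  have y1: "y \<noteq> 1" using lny assms by auto
  have m1: "m \<noteq> 1" using y1 assms by (auto simp: m_def field_simps)
  \<comment> \<open>tangent to the logarithm at the weighted mean \<open>m\<close> of \<open>y\<close> and \<open>1\<close>; the weights are \<open>1/p\<close> and \<open>1 - 1/p\<close>\<close>
  have 1: "ln (y / m) \<le> y / m - 1" using y m by (intro ln_le_minus_one) simp
  have 2: "ln (1 / m) < 1 / m - 1"
    using ln_le_minus_one[of "1/m"] ln_eq_minus_one[of "1/m"] m m1 by fastforce
  have "(1/p) * ln (y / m) + (1 - 1/p) * ln (1 / m) < (1/p) * (y / m - 1) + (1 - 1/p) * (1 / m - 1)"
    using assms 1 2 by (intro add_le_less_mono mult_left_mono mult_strict_left_mono) (auto simp: field_simps)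
  also have "\<dots> = (1 / p * y + (1 - 1 / p)) / m - 1"
    by (simp add: diff_divide_distrib add_divide_distrib algebra_simps)
  also have "\<dots> = m / m - 1" by (simp add: m_def)
  also have "\<dots> = 0" using m by simp
  finally have "(1/p) * ln y - ln m < 0"
    using y m assms by (simp add: ln_div field_simps)
  then have "ln t < ln m" using lny assms by simp
  then have "t < m" using assms m by simp
  then have "p * t < p * m" using assms by simp
  also have "p * m = y + p - 1" using assms by (simp add: m_def field_simps)
  finally show ?thesis by (simp add: y_def algebra_simps)
qed

text \<open>
  The graph of \<open>t \<mapsto> |t|\<^sup>p\<close> lies above its tangent lines. This inequality is behind Jensen's inequality on
  cells, Minkowski's inequality, the first variation, and the comparison of the energies of two
  functions; its strict form identifies the cases of equality.
\<close>

lemma powr_tangent_strict: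
  fixes a b p :: real
  assumes "1 < p" "0 \<le> a" "a \<noteq> b"
  shows "a powr p + p * spow p a * (b - a) < \<bar>b\<bar> powr p"
proof (cases "a = 0")
  case True then show ?thesis using assms by simp
next
  case False
  then have a: "0 < a" using assms by simp
  have ap: "spow p a = a powr p / a"
    using a spow_times_self[of p a] by (simp add: field_simps)
  have eq: "a powr p + p * spow p a * (b - a) = a powr p * (1 + p * (b / a - 1))"
    using a by (simp add: ap field_simps)
  show ?thesis
  proof (cases "0 < b")
    case True
    have "1 + p * (b / a - 1) < (b / a) powr p"
      using assms a True by (intro bernoulli_powr_strict) auto
    then have "a powr p * (1 + p * (b / a - 1)) < a powr p * (b / a) powr p"
      using a by (intro mult_strict_left_mono) auto
    also have "\<dots> = b powr p" using a True by (simp add: powr_divide)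
    finally show ?thesis using eq True by simp
  next
    case b: False
    have "b / a \<le> 0" using a b by (simp add: divide_nonpos_pos)
    then have "p * (b / a - 1) \<le> p * (-1)" using assms by (intro mult_left_mono) auto
    then have "1 + p * (b / a - 1) < 0" using assms by simp
    then have "a powr p * (1 + p * (b / a - 1)) < 0" using a by (simp add: mult_pos_neg)
    also have "0 \<le> \<bar>b\<bar> powr p" by simp
    finally show ?thesis using eq by simp
  qed
qed

lemma powr_tangent:
  fixes a b p :: real
  assumes "1 < p"
  shows "\<bar>a\<bar> powr p + p * spow p a * (b - a) \<le> \<bar>b\<bar> powr p"
proof (cases "a = b")
  case False
  show ?thesis
  proof (cases "0 \<le> a")
    case True
    then show ?thesis using powr_tangent_strict[OF assms True False] by simp
  next
    case a: False
    then show ?thesis using powr_tangent_strict[of p "-a" "-b"] assms False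
      by (simp add: spow_minus algebra_simps)
  qed
qed simp

text \<open>
  The weighted \<open>p\<close>-mean of \<open>|a|\<close> and \<open>|b|\<close>. For fixed \<open>t\<close> it is the norm of \<open>(a, b)\<close> in a two-point
  \<open>L\<^sup>p\<close> space, and as a function of \<open>t\<close> it joins \<open>a\<close> to \<open>b\<close> along a curve on which the \<open>p\<close>-th power is affine.
\<close>

definition pmean :: "real \<Rightarrow> real \<Rightarrow> real \<Rightarrow> real \<Rightarrow> real" where
  "pmean p t a b = ((1 - t) * \<bar>a\<bar> powr p + t * \<bar>b\<bar> powr p) powr (1 / p)"

lemma pmean_measurable [measurable]:
  assumes [measurable]: "f \<in> borel_measurable M" "g \<in> borel_measurable M"
  shows "(\<lambda>x. pmean p t (f x) (g x)) \<in> borel_measurable M"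
  unfolding pmean_def by measurable

lemma pmean_nonneg [simp]: "0 \<le> pmean p t a b"
  by (simp add: pmean_def)

lemma pmean_powr:
  assumes "0 < p" "0 \<le> t" "t \<le> 1"
  shows "pmean p t a b powr p = (1 - t) * \<bar>a\<bar> powr p + t * \<bar>b\<bar> powr p"
  using assms by (simp add: pmean_def powr_powr)

lemma pmean_le_iff:
  assumes "0 < p" "0 \<le> t" "t \<le> 1" "0 \<le> c"
  shows "pmean p t a b \<le> c \<longleftrightarrow> (1 - t) * \<bar>a\<bar> powr p + t * \<bar>b\<bar> powr p \<le> c powr p"
proof -
  have "pmean p t a b \<le> c \<longleftrightarrow> pmean p t a b powr p \<le> c powr p"
    using assms powr_mono2[of p "pmean p t a b" c] powr_less_mono2[of p c "pmean p t a b"]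
    by (force simp: not_le[symmetric])
  then show ?thesis using assms by (simp add: pmean_powr)
qed

lemma pmean_eq_0:
  assumes "0 < p" "0 < t" "t < 1" "pmean p t a b = 0"
  shows "a = 0" "b = 0"
proof -
  have "(1 - t) * \<bar>a\<bar> powr p + t * \<bar>b\<bar> powr p = 0"
    using pmean_powr[of p t a b] assms by simp
  moreover have "0 \<le> (1 - t) * \<bar>a\<bar> powr p" "0 \<le> t * \<bar>b\<bar> powr p" using assms by auto
  ultimately have "(1 - t) * \<bar>a\<bar> powr p = 0" "t * \<bar>b\<bar> powr p = 0" by linarith+
  then show "a = 0" "b = 0" using assms by auto
qed

text \<open>
  Convexity of the \<open>p\<close>-th power at the points \<open>x/A\<close> and \<open>y/B\<close> with weights proportional to \<open>A\<close> and
  \<open>B\<close>; strict convexity forces the two points to coincide in the case of equality.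
\<close>

lemma powr_convex_fraction:
  fixes x y A B p :: real
  assumes p: "1 < p" and x: "0 \<le> x" and y: "0 \<le> y" and A: "0 < A" and B: "0 < B"
  defines "S \<equiv> (x + y) / (A + B)"
  shows "(A + B) * S powr p \<le> A * (x / A) powr p + B * (y / B) powr p" (is "?l \<le> ?r")
    and "(A + B) * S powr p = A * (x / A) powr p + B * (y / B) powr p \<Longrightarrow> x * B = y * A"
proof -
  have S: "0 \<le> S" using x y A B by (simp add: S_def)
  let ?T = "\<lambda>b. S powr p + p * spow p S * (b - S)"
  have sum: "A * ?T (x/A) + B * ?T (y/B) = (A + B) * S powr p + p * spow p S * (x + y - (A + B) * S)"
    using A B by (simp add: field_simps)
  have "(A + B) * S = x + y" using A B by (simp add: S_def)
  then have sum: "A * ?T (x/A) + B * ?T (y/B) = ?l" using sum by simp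
  have t: "?T b \<le> \<bar>b\<bar> powr p" for b using powr_tangent[OF p, of S b] S by simp
  have 1: "A * ?T (x/A) \<le> A * (x/A) powr p" "B * ?T (y/B) \<le> B * (y/B) powr p"
    using t[of "x/A"] t[of "y/B"] x y A B by (auto intro!: mult_left_mono)
  show "?l \<le> ?r" using 1 sum by linarith
  assume "?l = ?r"
  then have "A * ?T (x/A) = A * (x/A) powr p" "B * ?T (y/B) = B * (y/B) powr p"
    using 1 sum by linarith+
  then have "?T (x/A) = (x/A) powr p" "?T (y/B) = (y/B) powr p" using A B by auto
  then have "S = x / A" "S = y / B"
    using powr_tangent_strict[OF p S, of "x/A"] powr_tangent_strict[OF p S, of "y/B"] x y A B
    by fastforce+
  then have "x / A = y / B" by simp
  then show "x * B = y * A" using A B by (simp add: field_simps)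
qed

lemma add_le_eqD:
  fixes a b c d :: real
  assumes "a \<le> b" "c \<le> d" "a + c = b + d"
  shows "a = b" "c = d"
  using assms by linarith+

text \<open>
  Minkowski's inequality in the two-point space. The usual normalisation by the two norms \<open>H\<close> and \<open>D\<close>
  reduces it to the previous lemma, applied in each of the two coordinates, so equality makes the two
  vectors proportional.
\<close>

lemma pmean_triangle:
  fixes p t :: real
  assumes p: "1 < p" and t: "0 \<le> t" "t \<le> 1" and nn: "0 \<le> c" "0 \<le> d" "0 \<le> x" "0 \<le> y"
  shows "pmean p t (c + x) (d + y) \<le> pmean p t c d + pmean p t x y"
    and "\<lbrakk>0 < t; t < 1; pmean p t (c + x) (d + y) = pmean p t c d + pmean p t x y\<rbrakk> \<Longrightarrow> c * y = d * x"
proof -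
  define H where "H = pmean p t c d"
  define D where "D = pmean p t x y"
  have Hp: "H powr p = (1 - t) * c powr p + t * d powr p"
    and Dp: "D powr p = (1 - t) * x powr p + t * y powr p"
    using assms by (simp_all add: H_def D_def pmean_powr)
  have HD: "0 \<le> H" "0 \<le> D" by (simp_all add: H_def D_def)
  let ?L = "(1 - t) * (c + x) powr p + t * (d + y) powr p"
  have zero: "(1 - t) * a powr p + t * b powr p = 0 \<Longrightarrow> 
    (1 - t) * (a' + a) powr p + t * (b' + b) powr p = (1 - t) * a' powr p + t * b' powr p" 
    if "0 \<le> a" "0 \<le> b" "0 \<le> a'" "0 \<le> b'" for a b a' b'
  proof -
    assume "(1 - t) * a powr p + t * b powr p = 0"
    moreover have "0 \<le> (1 - t) * a powr p" "0 \<le> t * b powr p" using t by auto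
    ultimately have "(1 - t) * a powr p = 0" "t * b powr p = 0" by linarith+
    then show ?thesis by auto
  qed
  have main: "?L \<le> (H + D) powr p \<and> (0 < t \<longrightarrow> t < 1 \<longrightarrow> ?L = (H + D) powr p \<longrightarrow> c * y = d * x)"
  proof (cases "H = 0 \<or> D = 0")
    case True
    then have "?L = (H + D) powr p"
    proof
      assume H: "H = 0"
      then have "(1 - t) * c powr p + t * d powr p = 0" using Hp p by simp
      from zero[OF nn(1,2,3,4) this] show ?thesis using H Dp by (simp add: add.commute)
    next
      assume D: "D = 0"
      then have "(1 - t) * x powr p + t * y powr p = 0" using Dp p by simp
      from zero[OF nn(3,4,1,2) this] show ?thesis using D Hp by (simp add: add.commute)
    qed
    moreover have "c * y = d * x" if "0 < t" "t < 1"
      using True pmean_eq_0[of p t c d] pmean_eq_0[of p t x y] that p by (auto simp: H_def D_def)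
    ultimately show ?thesis by simp
  next
    case False
    then have pos: "0 < H" "0 < D" using HD by auto
    let ?S1 = "(c + x) / (H + D)" and ?S2 = "(d + y) / (H + D)"
    note R1 = powr_convex_fraction[OF p nn(1,3) pos]
    note R2 = powr_convex_fraction[OF p nn(2,4) pos]
    have quot: "(c / H) powr p = c powr p / H powr p" "(d / H) powr p = d powr p / H powr p"
      "(x / D) powr p = x powr p / D powr p" "(y / D) powr p = y powr p / D powr p"
      "?S1 powr p = (c + x) powr p / (H + D) powr p" "?S2 powr p = (d + y) powr p / (H + D) powr p"
      using nn pos by (simp_all add: powr_divide)
    have dist: "(1 - t) * (h * (a / A) + h' * (b / A')) + t * (h * (a' / A) + h' * (b' / A'))
      = h * (((1 - t) * a + t * a') / A) + h' * (((1 - t) * b + t * b') / A')"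
      for h h' a b a' b' A A' :: real
      by (simp add: algebra_simps add_divide_distrib diff_divide_distrib)
    have "(1 - t) * (H * (c / H) powr p + D * (x / D) powr p)
        + t * (H * (d / H) powr p + D * (y / D) powr p)
      = H * (((1 - t) * c powr p + t * d powr p) / H powr p)
        + D * (((1 - t) * x powr p + t * y powr p) / D powr p)"
      unfolding quot by (rule dist)
    also have "\<dots> = H + D" unfolding Hp[symmetric] Dp[symmetric] using pos by simp
    finally have rhs: "(1 - t) * (H * (c / H) powr p + D * (x / D) powr p)
        + t * (H * (d / H) powr p + D * (y / D) powr p) = H + D" .
    have lhs: "(1 - t) * ((H + D) * ?S1 powr p) + t * ((H + D) * ?S2 powr p)
       = (H + D) * (?L / (H + D) powr p)"
      unfolding quot using dist[of "H + D" _ _ 0 0 0] by simp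
    have i: "(1 - t) * ((H + D) * ?S1 powr p) \<le> (1 - t) * (H * (c / H) powr p + D * (x / D) powr p)"
       "t * ((H + D) * ?S2 powr p) \<le> t * (H * (d / H) powr p + D * (y / D) powr p)"
      using R1(1) R2(1) t by (auto intro!: mult_left_mono)
    have pos3: "0 < (H + D) powr p" "0 < H + D" using pos by auto
    have "(H + D) * (?L / (H + D) powr p) \<le> (H + D) * 1" 
      unfolding mult_1_right using add_mono[OF i] unfolding lhs rhs .
    then have 1: "?L \<le> (H + D) powr p" using pos3 by (simp add: divide_le_eq)
    moreover have "c * y = d * x" if t': "0 < t" "t < 1" and e: "?L = (H + D) powr p"
    proof -
      have "(H + D) * (?L / (H + D) powr p) = H + D" using e pos3 by simp
      then have "(1 - t) * ((H + D) * ?S1 powr p) = (1 - t) * (H * (c / H) powr p + D * (x / D) powr p)"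
       "t * ((H + D) * ?S2 powr p) = t * (H * (d / H) powr p + D * (y / D) powr p)"
        using add_le_eqD[OF i] lhs rhs by simp_all
      then have "c * D = x * H" "d * D = y * H" using R1(2) R2(2) t' by auto
      then have "c * y * H = d * x * H" by algebra
      then show ?thesis using pos by simp
    qed
    ultimately show ?thesis by simp
  qed
  have eq: "pmean p t (c + x) (d + y) powr p = ?L"
    using assms by (subst pmean_powr) auto
  show "pmean p t (c + x) (d + y) \<le> pmean p t c d + pmean p t x y"
    using main nn HD p t by (subst pmean_le_iff) (auto simp: H_def D_def)
  show "c * y = d * x" if "0 < t" "t < 1" "pmean p t (c + x) (d + y) = pmean p t c d + pmean p t x y"
    using main that eq by (auto simp: H_def D_def)
qed

text \<open>
  The reverse triangle inequality for the two-point norm: the vector \<open>(a, b)\<close> is bounded by \<open>(c, d)\<close>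
  plus the vector of the distances \<open>(|a - c|, |b - d|)\<close>. If equality holds then these vectors are
  proportional and the bounds \<open>a \<le> c + |a - c|\<close>, \<open>b \<le> d + |b - d|\<close> are equalities, so that \<open>(a, b)\<close> is
  proportional to \<open>(c, d)\<close>.
\<close>

lemma hidden_convexity_aux:
  fixes p t :: real
  assumes p: "1 < p" and t: "0 \<le> t" "t \<le> 1" and nn: "0 \<le> a" "0 \<le> b" "0 \<le> c" "0 \<le> d"
    and ge: "pmean p t c d \<le> pmean p t a b"
  shows "\<bar>pmean p t a b - pmean p t c d\<bar> powr p \<le> (1 - t) * \<bar>a - c\<bar> powr p + t * \<bar>b - d\<bar> powr p"
    and "\<lbrakk>0 < t; t < 1; \<bar>pmean p t a b - pmean p t c d\<bar> powr p = (1 - t) * \<bar>a - c\<bar> powr p + t * \<bar>b - d\<bar> powr p\<rbrakk>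
      \<Longrightarrow> a * d = b * c"
proof -
  let ?x = "\<bar>a - c\<bar>" and ?y = "\<bar>b - d\<bar>"
  have Dp: "pmean p t ?x ?y powr p = (1 - t) * ?x powr p + t * ?y powr p"
    using p t by (simp add: pmean_powr)
  have tri: "pmean p t (c + ?x) (d + ?y) \<le> pmean p t c d + pmean p t ?x ?y"
    using p t nn by (intro pmean_triangle) auto
  have le: "a powr p \<le> (c + ?x) powr p" "b powr p \<le> (d + ?y) powr p"
    using p nn by (auto intro!: powr_mono2)
  then have le': "(1 - t) * a powr p \<le> (1 - t) * (c + ?x) powr p" "t * b powr p \<le> t * (d + ?y) powr p"
    using t by (auto intro!: mult_left_mono)
  have mono: "pmean p t a b \<le> pmean p t (c + ?x) (d + ?y)"
    using le' p t nn by (subst pmean_le_iff) (auto simp: pmean_powr)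
  have "\<bar>pmean p t a b - pmean p t c d\<bar> \<le> pmean p t ?x ?y" using mono tri ge by linarith
  then have "\<bar>pmean p t a b - pmean p t c d\<bar> powr p \<le> pmean p t ?x ?y powr p"
    using p by (intro powr_mono2) auto
  then show "\<bar>pmean p t a b - pmean p t c d\<bar> powr p \<le> (1 - t) * \<bar>a - c\<bar> powr p + t * \<bar>b - d\<bar> powr p"
    by (simp add: Dp)
  assume t': "0 < t" "t < 1"
    and "\<bar>pmean p t a b - pmean p t c d\<bar> powr p = (1 - t) * \<bar>a - c\<bar> powr p + t * \<bar>b - d\<bar> powr p"
  then have "\<bar>pmean p t a b - pmean p t c d\<bar> = pmean p t ?x ?y"
    using powr_left_injective[of p "\<bar>pmean p t a b - pmean p t c d\<bar>" "pmean p t ?x ?y"] Dp p by simp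
  then have e: "pmean p t a b = pmean p t c d + pmean p t ?x ?y" using ge by simp
  then have tri_eq: "pmean p t (c + ?x) (d + ?y) = pmean p t c d + pmean p t ?x ?y"
    using mono tri by linarith
  have cd: "c * ?y = d * ?x"
    using pmean_triangle(2)[OF p t nn(3,4) _ _ t' tri_eq] by simp
  have "pmean p t (c + ?x) (d + ?y) powr p = pmean p t a b powr p" using e tri_eq by simp
  then have "(1 - t) * (c + ?x) powr p + t * (d + ?y) powr p = (1 - t) * a powr p + t * b powr p"
    using p t nn by (simp add: pmean_powr)
  then have "(1 - t) * a powr p = (1 - t) * (c + ?x) powr p" "t * b powr p = t * (d + ?y) powr p"
    using le' by linarith+
  then have "a powr p = (c + ?x) powr p" "b powr p = (d + ?y) powr p" using t' by auto
  then have "a = c + ?x" "b = d + ?y" using powr_left_injective[of p a "c + ?x"] powr_left_injective[of p b "d + ?y"] p nn by auto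
  then show "a * d = b * c" using cd by (metis distrib_right mult.commute)
qed

text \<open>
  For nonnegative functions \<open>u\<close>, \<open>v\<close> this is the hidden convexity of the energy: the integrand
  \<open>|w(x) - w(y)|\<^sup>p\<close> is convex along the curve of \<open>p\<close>-means \<open>w = ((1 - t) u\<^sup>p + t v\<^sup>p)\<^sup>1\<^sup>/\<^sup>p\<close>, although that curve
  is not a segment. Equality at a pair of points means \<open>u(x) v(y) = v(x) u(y)\<close>.
\<close>

lemma hidden_convexity:
  fixes p t :: real
  assumes p: "1 < p" and t: "0 \<le> t" "t \<le> 1" and nn: "0 \<le> a" "0 \<le> b" "0 \<le> c" "0 \<le> d"
  shows "\<bar>pmean p t a b - pmean p t c d\<bar> powr p \<le> (1 - t) * \<bar>a - c\<bar> powr p + t * \<bar>b - d\<bar> powr p"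
    and "\<lbrakk>0 < t; t < 1; \<bar>pmean p t a b - pmean p t c d\<bar> powr p = (1 - t) * \<bar>a - c\<bar> powr p + t * \<bar>b - d\<bar> powr p\<rbrakk>
      \<Longrightarrow> a * d = b * c"
proof -
  show "\<bar>pmean p t a b - pmean p t c d\<bar> powr p \<le> (1 - t) * \<bar>a - c\<bar> powr p + t * \<bar>b - d\<bar> powr p"
  proof (cases "pmean p t c d \<le> pmean p t a b")
    case False
    then show ?thesis using hidden_convexity_aux(1)[OF p t nn(3,4,1,2)] by (simp add: abs_minus_commute)
  qed (rule hidden_convexity_aux(1)[OF p t nn])
  assume *: "0 < t" "t < 1" "\<bar>pmean p t a b - pmean p t c d\<bar> powr p = (1 - t) * \<bar>a - c\<bar> powr p + t * \<bar>b - d\<bar> powr p"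
  show "a * d = b * c"
  proof (cases "pmean p t c d \<le> pmean p t a b")
    case False
    then have "c * b = d * a"
      using hidden_convexity_aux(2)[OF p t nn(3,4,1,2)] * by (simp add: abs_minus_commute)
    then show ?thesis by (simp add: mult.commute)
  qed (use hidden_convexity_aux(2)[OF p t nn] * in blast)
qed

section \<open>Radial kernels\<close>

lemma nn_integral_lborel_scale:
  fixes f :: "'a::euclidean_space \<Rightarrow> ennreal"
  assumes [measurable]: "f \<in> borel_measurable borel" and "0 < c"
  shows "(\<integral>\<^sup>+z. f z \<partial>lborel) = ennreal (c ^ DIM('a)) * (\<integral>\<^sup>+z. f (c *\<^sub>R z) \<partial>lborel)"
proof -
  have "(\<integral>\<^sup>+z. f z \<partial>lborel) =
      (\<integral>\<^sup>+z. f z \<partial>density (distr lborel borel (\<lambda>x. 0 + c *\<^sub>R x)) (\<lambda>_. ennreal (\<bar>c\<bar> ^ DIM('a))))"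
    using assms by (subst lborel_affine[of c "0::'a"]) auto
  also have "\<dots> = ennreal (c ^ DIM('a)) * (\<integral>\<^sup>+z. f (c *\<^sub>R z) \<partial>lborel)"
    using assms by (simp add: nn_integral_density nn_integral_distr nn_integral_cmult)
  finally show ?thesis .
qed

lemma nn_integral_lborel_reflect:
  fixes f :: "'a::euclidean_space \<Rightarrow> ennreal"
  assumes [measurable]: "f \<in> borel_measurable borel"
  shows "(\<integral>\<^sup>+y. f (x - y) \<partial>lborel) = (\<integral>\<^sup>+z. f z \<partial>lborel)"
proof -
  have "(\<integral>\<^sup>+z. f z \<partial>lborel) =
      (\<integral>\<^sup>+z. f z \<partial>density (distr lborel borel (\<lambda>y. x + (-1) *\<^sub>R y)) (\<lambda>_. ennreal (\<bar>-1\<bar> ^ DIM('a))))"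
    by (subst lborel_affine[of "-1" x]) auto
  also have "\<dots> = (\<integral>\<^sup>+y. f (x - y) \<partial>lborel)"
    by (simp add: nn_integral_density nn_integral_distr)
  finally show ?thesis ..
qed

text \<open>
  With \<open>\<sigma> = s p\<close> this is the kernel of the fractional \<open>p\<close>-Laplacian; it takes the value \<open>0\<close> at the
  origin.
\<close>

definition rker :: "real \<Rightarrow> 'a::euclidean_space \<Rightarrow> real" where
  "rker \<sigma> z = 1 / norm z powr (real DIM('a) + \<sigma>)"

lemma rker_measurable [measurable]: "rker \<sigma> \<in> borel_measurable borel"
  unfolding rker_def by measurable

lemma rker_nonneg [simp]: "0 \<le> rker \<sigma> z"
  by (simp add: rker_def)

lemma rker_0 [simp]: "rker \<sigma> 0 = 0"
  by (simp add: rker_def)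

lemma rker_minus [simp]: "rker \<sigma> (- z) = rker \<sigma> z"
  by (simp add: rker_def)

lemma rker_pos: "z \<noteq> 0 \<Longrightarrow> 0 < rker \<sigma> z"
  by (simp add: rker_def)

lemma rker_powr: "norm z powr a * rker \<sigma> z = rker (\<sigma> - a) z"
  by (cases "z = 0") (simp_all add: rker_def powr_add powr_diff divide_simps)

lemma rker_scaleR:
  fixes z :: "'a::euclidean_space"
  assumes "0 < c"
  shows "c ^ DIM('a) * rker \<sigma> (c *\<^sub>R z) = c powr (- \<sigma>) * rker \<sigma> z"
  using assms by (simp add: rker_def powr_mult powr_add powr_minus powr_realpow field_simps)

text \<open>
  The kernel is homogeneous of degree \<open>-N - \<sigma>\<close>, so its integral over a dilated region only picks up
  the factor \<open>c\<^sup>-\<^sup>\<sigma>\<close>. Both the convergence of the integrals below and the sign of the logarithmic tail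
  are read off from this scaling law.
\<close>

lemma nn_integral_rker_scale:
  fixes S :: "real set"
  assumes [measurable]: "S \<in> sets borel" and c: "0 < c"
  shows "(\<integral>\<^sup>+z. ennreal (indicator S (norm (z::'a::euclidean_space) / c) * rker \<sigma> z) \<partial>lborel)
       = ennreal (c powr (- \<sigma>)) * (\<integral>\<^sup>+z. ennreal (indicator S (norm (z::'a)) * rker \<sigma> z) \<partial>lborel)"
proof -
  have "(\<integral>\<^sup>+z. ennreal (indicator S (norm (z::'a) / c) * rker \<sigma> z) \<partial>lborel)
     = ennreal (c ^ DIM('a)) * (\<integral>\<^sup>+z. ennreal (indicator S (norm (c *\<^sub>R (z::'a)) / c) * rker \<sigma> (c *\<^sub>R z)) \<partial>lborel)"
    using c by (intro nn_integral_lborel_scale) measurable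
  also have "\<dots> = (\<integral>\<^sup>+z. ennreal (c ^ DIM('a)) * ennreal (indicator S (norm (c *\<^sub>R (z::'a)) / c) * rker \<sigma> (c *\<^sub>R z)) \<partial>lborel)"
    by (subst nn_integral_cmult) auto
  also have "\<dots> = (\<integral>\<^sup>+z. ennreal (c powr (- \<sigma>)) * ennreal (indicator S (norm (z::'a)) * rker \<sigma> z) \<partial>lborel)"
  proof (rule nn_integral_cong)
    fix z :: 'a
    have "ennreal (c ^ DIM('a)) * ennreal (indicator S (norm (c *\<^sub>R z) / c) * rker \<sigma> (c *\<^sub>R z))
        = ennreal (indicator S (norm z) * (c ^ DIM('a) * rker \<sigma> (c *\<^sub>R z)))"
      using c by (subst ennreal_mult'[symmetric]) (simp_all add: mult_ac)
    also have "\<dots> = ennreal (indicator S (norm z) * (c powr (- \<sigma>) * rker \<sigma> z))"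
      using c by (simp only: rker_scaleR)
    also have "\<dots> = ennreal (c powr (- \<sigma>)) * ennreal (indicator S (norm z) * rker \<sigma> z)"
      using c by (subst ennreal_mult'[symmetric]) (simp_all add: mult_ac)
    finally show "ennreal (c ^ DIM('a)) * ennreal (indicator S (norm (c *\<^sub>R z) / c) * rker \<sigma> (c *\<^sub>R z))
      = ennreal (c powr (- \<sigma>)) * ennreal (indicator S (norm z) * rker \<sigma> z)" .
  qed
  also have "\<dots> = ennreal (c powr (- \<sigma>)) * (\<integral>\<^sup>+z. ennreal (indicator S (norm (z::'a)) * rker \<sigma> z) \<partial>lborel)"
    by (subst nn_integral_cmult) auto
  finally show ?thesis .
qed

lemma rker_annulus_finite:
  "(\<integral>\<^sup>+z. ennreal (indicator {1..2} (norm (z::'a::euclidean_space)) * rker \<sigma> z) \<partial>lborel) < \<infinity>"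
proof -
  define M where "M = max 1 (1 / 2 powr (real DIM('a) + \<sigma>))"
  have "rker \<sigma> z \<le> M" if "1 \<le> norm z" "norm z \<le> 2" for z :: 'a
  proof (cases "0 \<le> real DIM('a) + \<sigma>")
    case True
    then have "1 \<le> norm z powr (real DIM('a) + \<sigma>)" using that by (simp add: ge_one_powr_ge_zero)
    then show ?thesis by (simp add: rker_def M_def max_def divide_simps)
  next
    case False
    then have "2 powr (real DIM('a) + \<sigma>) \<le> norm z powr (real DIM('a) + \<sigma>)"
      using that by (intro powr_mono2') auto
    moreover have "0 < norm z powr (real DIM('a) + \<sigma>)" using that by auto
    ultimately have "rker \<sigma> z \<le> 1 / 2 powr (real DIM('a) + \<sigma>)" by (simp add: rker_def frac_le)
    then show ?thesis by (simp add: M_def)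
  qed
  then have "(\<integral>\<^sup>+z. ennreal (indicator {1..2} (norm (z::'a)) * rker \<sigma> z) \<partial>lborel)
     \<le> (\<integral>\<^sup>+z. ennreal M * indicator (cball 0 2) (z::'a) \<partial>lborel)"
    by (intro nn_integral_mono) (auto simp: indicator_def intro!: ennreal_leI)
  also have "\<dots> = ennreal M * emeasure lborel (cball (0::'a) 2)" by (intro nn_integral_cmult_indicator) simp
  also have "\<dots> < \<infinity>" using emeasure_lborel_cball_finite[of "0::'a" 2]
    by (simp add: ennreal_mult_less_top)
  finally show ?thesis .
qed

lemma dyadic_bracket:
  fixes x :: real
  assumes "1 \<le> x"
  obtains k :: nat where "2 ^ k \<le> x" "x \<le> 2 * 2 ^ k"
proof -
  define n where "n = (LEAST n. x < 2 ^ n)"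
  have "\<exists>n. x < 2 ^ n" using real_arch_pow[of 2 x] by auto
  then have 1: "x < 2 ^ n" unfolding n_def by (rule LeastI_ex)
  have "n \<noteq> 0" using 1 assms by (intro notI) simp
  then obtain k where k: "n = Suc k" using not0_implies_Suc by blast
  then have "\<not> x < 2 ^ k" using not_less_Least[of k "\<lambda>n. x < 2 ^ n"] by (simp add: n_def)
  then show ?thesis using that[of k] 1 k by simp
qed

text \<open>
  Cover the region by the annuli \<open>r k \<le> |z| \<le> 2 r k\<close>; by scaling the integrals over them are multiples
  of one number with factors \<open>(r k)\<^sup>-\<^sup>\<sigma>\<close>.
\<close>

lemma rker_dyadic_finite:
  assumes cover: "\<And>z::'a::euclidean_space. norm z \<in> S \<Longrightarrow> \<exists>k. 1 \<le> norm z / r k \<and> norm z / r k \<le> 2"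
    and r: "\<And>k::nat. 0 < r k" and sm: "summable (\<lambda>k. r k powr (- \<sigma>))"
  shows "(\<integral>\<^sup>+z. ennreal (indicator S (norm (z::'a)) * rker \<sigma> z) \<partial>lborel) < \<infinity>"
proof -
  let ?f = "\<lambda>k z. ennreal (indicator {1..2} (norm (z::'a) / r k) * rker \<sigma> z)"
  let ?A = "\<integral>\<^sup>+z. ennreal (indicator {1..2} (norm (z::'a)) * rker \<sigma> z) \<partial>lborel"
  have "(\<integral>\<^sup>+z. ennreal (indicator S (norm (z::'a)) * rker \<sigma> z) \<partial>lborel) \<le> (\<integral>\<^sup>+z. (\<Sum>k. ?f k z) \<partial>lborel)"
  proof (rule nn_integral_mono)
    fix z :: 'a
    show "ennreal (indicator S (norm z) * rker \<sigma> z) \<le> (\<Sum>k. ?f k z)"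
    proof (cases "norm z \<in> S")
      case True
      then obtain k where k: "1 \<le> norm z / r k" "norm z / r k \<le> 2" using cover by blast
      then have "norm z / r k \<in> {1..2}" by (simp only: atLeastAtMost_iff)
      then have "ennreal (indicator S (norm z) * rker \<sigma> z) = ?f k z"
        by (simp only: indicator_simps True)
      also have "\<dots> = sum (\<lambda>k. ?f k z) {k}" by (simp only: sum.insert finite.emptyI empty_iff sum.empty add_0_right not_False_eq_True)
      also have "\<dots> \<le> (\<Sum>k. ?f k z)"
        by (rule sum_le_suminf) (auto intro!: summableI)
      finally show ?thesis .
    qed simp
  qed
  also have "\<dots> = (\<Sum>k. \<integral>\<^sup>+z. ?f k z \<partial>lborel)" by (subst nn_integral_suminf) auto
  also have "\<dots> = (\<Sum>k. ennreal (r k powr (- \<sigma>)) * ?A)"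
    using r by (intro suminf_cong nn_integral_rker_scale) auto
  also have "\<dots> = (\<Sum>k. ennreal (r k powr (- \<sigma>))) * ?A" by simp
  also have "(\<Sum>k. ennreal (r k powr (- \<sigma>))) = ennreal (\<Sum>k. r k powr (- \<sigma>))"
    using sm by (intro suminf_ennreal2) auto
  also have "\<dots> * ?A < \<infinity>" using rker_annulus_finite[where 'a='a, of \<sigma>] by (simp add: ennreal_mult_less_top)
  finally show ?thesis .
qed

lemma rker_far_finite:
  assumes "0 < \<sigma>" "0 < d"
  shows "(\<integral>\<^sup>+z. ennreal (indicator {d..} (norm (z::'a::euclidean_space)) * rker \<sigma> z) \<partial>lborel) < \<infinity>"
proof (rule rker_dyadic_finite)
  fix z :: 'a assume "norm z \<in> {d..}"
  then have "1 \<le> norm z / d" using assms by simp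
  then obtain k where "2 ^ k \<le> norm z / d" "norm z / d \<le> 2 * 2 ^ k" by (rule dyadic_bracket)
  then show "\<exists>k. 1 \<le> norm z / (d * 2 ^ k) \<and> norm z / (d * 2 ^ k) \<le> 2"
    using assms by (auto simp: field_simps intro!: exI[of _ k])
next
  have "(d * 2 ^ k) powr (- \<sigma>) = d powr (- \<sigma>) * (2 powr (- \<sigma>)) ^ k" for k
  proof -
    have "(2 ^ k) powr (- \<sigma>) = (2 powr (- \<sigma>)) ^ k"
      by (simp add: powr_realpow[symmetric] powr_powr mult.commute)
    then show ?thesis using assms by (simp add: powr_mult)
  qed
  moreover have "summable (\<lambda>k. d powr (- \<sigma>) * (2 powr (- \<sigma>)) ^ k)"
    using assms by (intro summable_mult summable_geometric) (simp add: powr_less_one)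
  ultimately show "summable (\<lambda>k. (d * 2 ^ k) powr (- \<sigma>))" by simp
qed (use assms in simp)

lemma rker_near_finite:
  assumes "0 < \<sigma>"
  shows "(\<integral>\<^sup>+z. ennreal (indicator {0<..1} (norm (z::'a::euclidean_space)) * rker (- \<sigma>) z) \<partial>lborel) < \<infinity>"
proof (rule rker_dyadic_finite)
  fix z :: 'a assume z: "norm z \<in> {0<..1}"
  then have "1 \<le> 1 / norm z" by simp
  then obtain k where "2 ^ k \<le> 1 / norm z" "1 / norm z \<le> 2 * 2 ^ k" by (rule dyadic_bracket)
  then show "\<exists>k. 1 \<le> norm z / (1 / (2 * 2 ^ k)) \<and> norm z / (1 / (2 * 2 ^ k)) \<le> 2"
    using z by (auto simp: field_simps intro!: exI[of _ k])
next
  have "(1 / (2 * 2 ^ k)) powr (- (- \<sigma>)) = (2 powr (- \<sigma>)) ^ Suc k" for k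
  proof -
    have "1 / (2 * 2 ^ k) = 2 powr (- real (Suc k))"
      by (simp only: powr_minus powr_realpow) (simp add: field_simps)
    then show ?thesis by (simp only: powr_powr powr_realpow[symmetric] powr_gt_zero) (simp add: powr_powr algebra_simps)
  qed
  moreover have "summable (\<lambda>k. (2 powr (- \<sigma>)) ^ Suc k)"
    using assms by (subst summable_Suc_iff, intro summable_geometric) (simp add: powr_less_one)
  ultimately show "summable (\<lambda>k. (1 / (2 * 2 ^ k)) powr (- (- \<sigma>)))" by simp
qed simp

text \<open>
  All kernels of the problem are bounded by multiples of this one, so a single energy controls the
  integrability of the three forms.
\<close>

definition logker :: "real \<Rightarrow> 'a::euclidean_space \<Rightarrow> real" where
  "logker \<sigma> z = (1 + \<bar>ln (norm z)\<bar>) * rker \<sigma> z"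

lemma logker_measurable [measurable]: "logker \<sigma> \<in> borel_measurable borel"
  unfolding logker_def by measurable

lemma logker_nonneg [simp]: "0 \<le> logker \<sigma> z"
  by (simp add: logker_def)

lemma abs_ln_le:
  assumes "0 < r" "0 < (\<epsilon>::real)"
  shows "\<bar>ln r\<bar> \<le> (r powr \<epsilon> + r powr (- \<epsilon>)) / \<epsilon>"
proof -
  have "ln (r powr \<epsilon>) \<le> r powr \<epsilon> - 1" "ln (r powr (- \<epsilon>)) \<le> r powr (- \<epsilon>) - 1"
    using ln_le_minus_one[of "r powr \<epsilon>"] ln_le_minus_one[of "r powr (- \<epsilon>)"] assms by simp_all
  moreover have "0 < r powr \<epsilon>" "0 < r powr (- \<epsilon>)" using assms by auto
  ultimately have "\<bar>\<epsilon> * ln r\<bar> \<le> r powr \<epsilon> + r powr (- \<epsilon>)"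
    unfolding abs_le_iff using assms by (simp only: ln_powr) linarith
  then show ?thesis using assms by (simp add: abs_mult field_simps)
qed

text \<open>
  A logarithm is absorbed by an arbitrarily small power of \<open>|z|\<close>; half of the available exponent \<open>\<sigma>\<close>
  is sacrificed for it. The next lemma does the same near the origin.
\<close>

lemma logker_far_finite:
  assumes "0 < \<sigma>" "0 < d"
  shows "(\<integral>\<^sup>+z. ennreal (indicator {d..} (norm (z::'a::euclidean_space)) * logker \<sigma> z) \<partial>lborel) < \<infinity>"
proof -
  define \<epsilon> where "\<epsilon> = \<sigma> / 2"
  have e: "0 < \<epsilon>" using assms by (simp add: \<epsilon>_def)
  define M where "M = d powr (- \<epsilon>) + (1 + d powr (- (2 * \<epsilon>))) / \<epsilon>"
  have b: "1 + \<bar>ln r\<bar> \<le> M * r powr \<epsilon>" if "d \<le> r" for r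
  proof -
    have r: "0 < r" using that assms by simp
    have 1: "1 \<le> d powr (- \<epsilon>) * r powr \<epsilon>"
      using powr_mono2[of \<epsilon> d r] that assms e by (simp add: powr_minus field_simps)
    have "r powr (- (2 * \<epsilon>)) \<le> d powr (- (2 * \<epsilon>))"
      using that assms e by (intro powr_mono2') auto
    then have "r powr (- (2 * \<epsilon>)) * r powr \<epsilon> \<le> d powr (- (2 * \<epsilon>)) * r powr \<epsilon>"
      by (intro mult_right_mono) auto
    moreover have "r powr (- (2 * \<epsilon>)) * r powr \<epsilon> = r powr (- \<epsilon>)"
      using r by (simp add: powr_add[symmetric])
    ultimately have "(r powr \<epsilon> + r powr (- \<epsilon>)) / \<epsilon> \<le> (1 + d powr (- (2 * \<epsilon>))) / \<epsilon> * r powr \<epsilon>"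
      using e by (simp add: field_simps)
    then show ?thesis using abs_ln_le[OF r e] 1 by (simp add: M_def distrib_right)
  qed
  have "0 \<le> M" using e by (simp add: M_def)
  have "(\<integral>\<^sup>+z. ennreal (indicator {d..} (norm (z::'a)) * logker \<sigma> z) \<partial>lborel)
     \<le> (\<integral>\<^sup>+z. ennreal M * ennreal (indicator {d..} (norm (z::'a)) * rker (\<sigma> - \<epsilon>) z) \<partial>lborel)"
  proof (rule nn_integral_mono)
    fix z :: 'a
    have "indicator {d..} (norm z) * logker \<sigma> z \<le> indicator {d..} (norm z) * (M * norm z powr \<epsilon> * rker \<sigma> z)"
    proof (cases "d \<le> norm z")
      case True
      then have "(1 + \<bar>ln (norm z)\<bar>) * rker \<sigma> z \<le> M * norm z powr \<epsilon> * rker \<sigma> z"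
        by (intro mult_right_mono b) auto
      then show ?thesis using True by (simp add: logker_def)
    qed simp
    also have "\<dots> = M * (indicator {d..} (norm z) * rker (\<sigma> - \<epsilon>) z)"
      by (simp add: rker_powr[symmetric])
    finally show "ennreal (indicator {d..} (norm z) * logker \<sigma> z)
      \<le> ennreal M * ennreal (indicator {d..} (norm z) * rker (\<sigma> - \<epsilon>) z)"
      using \<open>0 \<le> M\<close> by (subst ennreal_mult'[symmetric]) (auto intro!: ennreal_leI)
  qed
  also have "\<dots> = ennreal M * (\<integral>\<^sup>+z. ennreal (indicator {d..} (norm (z::'a)) * rker (\<sigma> - \<epsilon>) z) \<partial>lborel)"
    by (subst nn_integral_cmult) auto
  also have "\<dots> < \<infinity>"
    using rker_far_finite[where 'a='a, of "\<sigma> - \<epsilon>" d] assms e by (simp add: \<epsilon>_def ennreal_mult_less_top)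
  finally show ?thesis .
qed

lemma logker_near_finite:
  assumes "\<sigma> < p"
  shows "(\<integral>\<^sup>+z. ennreal (indicator {0..1} (norm (z::'a::euclidean_space)) * (norm z powr p * logker \<sigma> z)) \<partial>lborel) < \<infinity>"
proof -
  define \<epsilon> where "\<epsilon> = (p - \<sigma>) / 2"
  have e: "0 < \<epsilon>" using assms by (simp add: \<epsilon>_def)
  define M where "M = 1 + 2 / \<epsilon>"
  have b: "1 + \<bar>ln r\<bar> \<le> M * r powr (- \<epsilon>)" if "0 < r" "r \<le> 1" for r
  proof -
    have 1: "1 \<le> r powr (- \<epsilon>)" using powr_mono2'[of \<epsilon> r 1] powr_mono2'[of "-\<epsilon>" r 1] that e by simp
    have "r powr \<epsilon> \<le> r powr (- \<epsilon>)" using that e by (intro powr_mono') auto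
    then have "(r powr \<epsilon> + r powr (- \<epsilon>)) / \<epsilon> \<le> 2 / \<epsilon> * r powr (- \<epsilon>)"
      using e by (simp add: field_simps)
    then show ?thesis using abs_ln_le[OF that(1) e] 1 by (simp add: M_def distrib_right)
  qed
  have "0 \<le> M" using e by (simp add: M_def)
  have "(\<integral>\<^sup>+z. ennreal (indicator {0..1} (norm (z::'a)) * (norm z powr p * logker \<sigma> z)) \<partial>lborel)
     \<le> (\<integral>\<^sup>+z. ennreal M * ennreal (indicator {0<..1} (norm (z::'a)) * rker (- \<epsilon>) z) \<partial>lborel)"
  proof (rule nn_integral_mono)
    fix z :: 'a
    have "indicator {0..1} (norm z) * (norm z powr p * logker \<sigma> z)
       \<le> indicator {0<..1} (norm z) * (norm z powr p * (M * norm z powr (- \<epsilon>) * rker \<sigma> z))"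
    proof (cases "z \<noteq> 0 \<and> norm z \<le> 1")
      case True
      then have "(1 + \<bar>ln (norm z)\<bar>) * rker \<sigma> z \<le> M * norm z powr (- \<epsilon>) * rker \<sigma> z"
        by (intro mult_right_mono b) auto
      then have "norm z powr p * ((1 + \<bar>ln (norm z)\<bar>) * rker \<sigma> z) \<le> norm z powr p * (M * norm z powr (- \<epsilon>) * rker \<sigma> z)"
        by (rule mult_left_mono) simp
      then show ?thesis using True by (simp add: logker_def)
    qed (auto simp: logker_def)
    also have "\<dots> = M * (indicator {0<..1} (norm z) * (norm z powr p * (norm z powr (- \<epsilon>) * rker \<sigma> z)))"
      by simp
    also have "\<dots> = M * (indicator {0<..1} (norm z) * rker (- \<epsilon>) z)"
    proof -
      have "\<sigma> - (- \<epsilon>) - p = - \<epsilon>" by (simp add: \<epsilon>_def field_simps)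
      then show ?thesis by (simp only: rker_powr)
    qed
    finally show "ennreal (indicator {0..1} (norm z) * (norm z powr p * logker \<sigma> z))
      \<le> ennreal M * ennreal (indicator {0<..1} (norm z) * rker (- \<epsilon>) z)"
      using \<open>0 \<le> M\<close> by (subst ennreal_mult'[symmetric]) (auto intro!: ennreal_leI)
  qed
  also have "\<dots> = ennreal M * (\<integral>\<^sup>+z. ennreal (indicator {0<..1} (norm (z::'a)) * rker (- \<epsilon>) z) \<partial>lborel)"
    by (subst nn_integral_cmult) auto
  also have "\<dots> < \<infinity>"
    using rker_near_finite[where 'a='a, of "\<epsilon>"] e by (simp add: ennreal_mult_less_top)
  finally show ?thesis .
qed


lemma rker_tail_scale:
  assumes "0 < d"
  shows "(\<integral>\<^sup>+z. ennreal (indicator {d..} (norm (z::'a::euclidean_space)) * rker \<sigma> z) \<partial>lborel)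
    = ennreal (d powr (- \<sigma>)) * (\<integral>\<^sup>+z. ennreal (indicator {1..} (norm (z::'a)) * rker \<sigma> z) \<partial>lborel)"
proof -
  have "indicator {d..} (norm z) = (indicator {1..} (norm z / d) :: real)" for z :: 'a
    using assms by (simp add: indicator_def)
  then show ?thesis using nn_integral_rker_scale[of "{1..}" d \<sigma>, where 'a='a] assms by simp
qed

text \<open>
  Layer-cake formula: \<open>ln (|z| / d)\<close> is the integral of \<open>1 / r\<close> over \<open>d \<le> r \<le> |z|\<close>. Exchanging the order
  of integration leaves the tail integrals over \<open>|z| \<ge> r\<close>, which are multiples of \<open>r\<^sup>-\<^sup>\<sigma>\<close>, and the integral of
  \<open>r\<^sup>-\<^sup>\<sigma>\<^sup>-\<^sup>1\<close> over \<open>r \<ge> d\<close> contributes the factor \<open>1 / \<sigma>\<close>.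
\<close>

lemma rker_tail_ln:
  assumes d: "0 < d" and \<sigma>: "0 < \<sigma>"
  shows "(\<integral>\<^sup>+z. ennreal (indicator {d..} (norm (z::'a::euclidean_space)) * (ln (norm z / d) * rker \<sigma> z)) \<partial>lborel)
    = ennreal (1 / \<sigma>) * (\<integral>\<^sup>+z. ennreal (indicator {d..} (norm (z::'a)) * rker \<sigma> z) \<partial>lborel)"
proof -
  define I1 where "I1 = (\<integral>\<^sup>+z. ennreal (indicator {1..} (norm (z::'a)) * rker \<sigma> z) \<partial>lborel)"
  let ?g = "\<lambda>(z::'a) r. ennreal (if d \<le> r \<and> r \<le> norm z then 1 / r * rker \<sigma> z else 0)"
  have inner1: "(\<integral>\<^sup>+r. ?g z r \<partial>lborel) = ennreal (indicator {d..} (norm z) * (ln (norm z / d) * rker \<sigma> z))" for z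
  proof (cases "d \<le> norm z")
    case True
    have "(\<integral>\<^sup>+r. ?g z r \<partial>lborel) = (\<integral>\<^sup>+r. ennreal (rker \<sigma> z) * (ennreal (1 / r) * indicator {d..norm z} r) \<partial>lborel)"
      using d by (intro nn_integral_cong) (auto simp: indicator_def ennreal_mult'[symmetric] mult.commute)
    also have "\<dots> = ennreal (rker \<sigma> z) * (\<integral>\<^sup>+r. ennreal (1 / r) * indicator {d..norm z} r \<partial>lborel)"
      by (rule nn_integral_cmult) measurable
    also have "(\<integral>\<^sup>+r. ennreal (1 / r) * indicator {d..norm z} r \<partial>lborel) = ennreal (ln (norm z) - ln d)"
      using d True by (intro nn_integral_FTC_Icc) (auto intro!: DERIV_ln_divide)
    also have "ennreal (rker \<sigma> z) * ennreal (ln (norm z) - ln d) = ennreal (ln (norm z / d) * rker \<sigma> z)"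
      using d True by (subst ennreal_mult'[symmetric]) (auto simp: ln_div mult.commute)
    finally show ?thesis using True by simp
  next
    case False
    then have "?g z r = 0" for r by auto
    then show ?thesis using False by simp
  qed
  have inner2: "(\<integral>\<^sup>+z. ?g z r \<partial>lborel) = I1 * (ennreal (r powr (- \<sigma> - 1)) * indicator {d..} r)" for r
  proof (cases "d \<le> r")
    case True
    then have r: "0 < r" using d by simp
    have "(\<integral>\<^sup>+z. ?g z r \<partial>lborel) = (\<integral>\<^sup>+z. ennreal (1 / r) * ennreal (indicator {r..} (norm (z::'a)) * rker \<sigma> z) \<partial>lborel)"
      using r True by (intro nn_integral_cong) (auto simp: indicator_def ennreal_mult'[symmetric])
    also have "\<dots> = ennreal (1 / r) * (ennreal (r powr (- \<sigma>)) * I1)"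
      unfolding I1_def using r by (subst rker_tail_scale[symmetric]) (auto intro: nn_integral_cmult)
    also have "\<dots> = ennreal (1 / r * r powr (- \<sigma>)) * I1"
      using r by (subst ennreal_mult') (simp_all add: mult.assoc)
    also have "1 / r * r powr (- \<sigma>) = r powr (- \<sigma> - 1)"
      using r by (simp add: powr_diff)
    finally show ?thesis using True by (simp add: mult.commute)
  next
    case False
    then have "?g z r = 0" for z by auto
    then show ?thesis using False by simp
  qed
  have "(\<integral>\<^sup>+z. ennreal (indicator {d..} (norm (z::'a)) * (ln (norm z / d) * rker \<sigma> z)) \<partial>lborel)
     = (\<integral>\<^sup>+z. \<integral>\<^sup>+r. ?g z r \<partial>lborel \<partial>lborel)" by (simp add: inner1)
  also have "\<dots> = (\<integral>\<^sup>+r. \<integral>\<^sup>+z. ?g z r \<partial>lborel \<partial>lborel)"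
    by (rule lborel_pair.Fubini'[symmetric]) measurable
  also have "\<dots> = (\<integral>\<^sup>+r. I1 * (ennreal (r powr (- \<sigma> - 1)) * indicator {d..} r) \<partial>lborel)"
    by (simp only: inner2)
  also have "\<dots> = I1 * (\<integral>\<^sup>+r. ennreal (r powr (- \<sigma> - 1)) * indicator {d..} r \<partial>lborel)"
    by (rule nn_integral_cmult) measurable
  also have "(\<integral>\<^sup>+r. ennreal (r powr (- \<sigma> - 1)) * indicator {d..} r \<partial>lborel) = ennreal (0 - (- (d powr (- \<sigma>) / \<sigma>)))"
  proof (rule nn_integral_FTC_atLeast)
    fix x assume "d \<le> x"
    then have "0 < x" using d by simp
    then have "((\<lambda>r. r powr (- \<sigma>)) has_real_derivative (- \<sigma>) * x powr (- \<sigma> - 1)) (at x)"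
      by (rule has_real_derivative_powr)
    from DERIV_minus[OF DERIV_cdivide[OF this, of \<sigma>]]
    show "((\<lambda>r. - (r powr (- \<sigma>) / \<sigma>)) has_real_derivative x powr (- \<sigma> - 1)) (at x)"
      using \<sigma> by simp
  next
    have "((\<lambda>r. r powr (- \<sigma>)) \<longlongrightarrow> 0) at_top"
      using \<sigma> by (intro tendsto_neg_powr filterlim_ident) auto
    then have "((\<lambda>r. - (r powr (- \<sigma>) / \<sigma>)) \<longlongrightarrow> - (0 / \<sigma>)) at_top"
      using \<sigma> by (intro tendsto_intros) auto
    then show "((\<lambda>r. - (r powr (- \<sigma>) / \<sigma>)) \<longlongrightarrow> 0) at_top" by simp
  qed auto
  also have "I1 * ennreal (0 - (- (d powr (- \<sigma>) / \<sigma>))) = ennreal (1 / \<sigma>) * (ennreal (d powr (- \<sigma>)) * I1)"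
  proof -
    have "ennreal (0 - (- (d powr (- \<sigma>) / \<sigma>))) = ennreal (1 / \<sigma>) * ennreal (d powr (- \<sigma>))"
      using \<sigma> by (subst ennreal_mult'[symmetric]) auto
    then show ?thesis by (simp only: mult_ac)
  qed
  also have "ennreal (d powr (- \<sigma>)) * I1 = (\<integral>\<^sup>+z. ennreal (indicator {d..} (norm (z::'a)) * rker \<sigma> z) \<partial>lborel)"
    unfolding I1_def by (rule rker_tail_scale[OF d, symmetric])
  finally show ?thesis .
qed

lemma rker_tail_pos:
  "(\<integral>\<^sup>+z. ennreal (indicator {d..} (norm (z::'a::euclidean_space)) * rker \<sigma> z) \<partial>lborel) \<noteq> 0"
proof
  assume "(\<integral>\<^sup>+z. ennreal (indicator {d..} (norm (z::'a)) * rker \<sigma> z) \<partial>lborel) = 0"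
  then have "AE z::'a in lborel. ennreal (indicator {d..} (norm z) * rker \<sigma> z) = 0"
    by (subst (asm) nn_integral_0_iff_AE) auto
  then have "AE z::'a in lborel. z \<in> ball 0 \<bar>d\<bar> \<union> {0}"
  proof (rule AE_mp, intro AE_I2 impI)
    fix z :: 'a assume "ennreal (indicator {d..} (norm z) * rker \<sigma> z) = 0"
    then show "z \<in> ball 0 \<bar>d\<bar> \<union> {0}" using rker_pos[of z \<sigma>]
      by (cases "d \<le> norm z"; cases "z = 0") (auto simp: ennreal_eq_0_iff)
  qed
  then have "emeasure lborel (UNIV :: 'a set) = emeasure lborel (ball (0::'a) \<bar>d\<bar> \<union> {0})"
    by (intro emeasure_eq_AE) auto
  also have "\<dots> < \<infinity>" by (rule emeasure_bounded_finite) auto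
  finally show False by simp
qed

text \<open>
  This is where the threshold \<open>e\<^sup>-\<^sup>1\<^sup>/\<^sup>\<sigma>\<close> for the diameter comes from. If \<open>I\<close> is the integral of the kernel
  over \<open>|z| \<ge> d\<close>, then by the layer-cake formula the integral of \<open>ln |z|\<close> against the kernel is
  \<open>(ln d + 1/\<sigma>) I\<close>, which is negative exactly for \<open>d < e\<^sup>-\<^sup>1\<^sup>/\<^sup>\<sigma>\<close>. The integrand itself changes
  sign, at \<open>|z| = e\<^sup>B\<^sup>/\<^sup>p\<close>; it is its integral that is positive.
\<close>

lemma log_tail_integral_pos:
  fixes B p d \<sigma> :: real
  assumes d: "0 < d" and \<sigma>: "0 < \<sigma>" and p: "0 < p" and B: "0 \<le> B" and ln: "ln d < - (1 / \<sigma>)"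
  shows "integrable lborel (\<lambda>z::'a::euclidean_space. indicator {d..} (norm z) * ((B - p * ln (norm z)) * rker \<sigma> z))"
    and "0 < (LINT z|lborel. indicator {d..} (norm (z::'a)) * ((B - p * ln (norm z)) * rker \<sigma> z))"
proof -
  let ?f = "\<lambda>z::'a. indicator {d..} (norm z) * rker \<sigma> z"
  let ?g = "\<lambda>z::'a. indicator {d..} (norm z) * (ln (norm z / d) * rker \<sigma> z)"
  define I where "I = enn2real (\<integral>\<^sup>+z. ennreal (?f z) \<partial>lborel)"
  have fin: "(\<integral>\<^sup>+z. ennreal (?f z) \<partial>lborel) < \<infinity>" by (rule rker_far_finite[OF \<sigma> d])
  have I: "(\<integral>\<^sup>+z. ennreal (?f z) \<partial>lborel) = ennreal I" using fin by (simp add: I_def)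
  have "0 < I" using rker_tail_pos[of d \<sigma>, where 'a='a] fin
    by (simp add: I_def enn2real_positive_iff zero_less_iff_neq_zero)
  have g: "(\<integral>\<^sup>+z. ennreal (?g z) \<partial>lborel) = ennreal (I / \<sigma>)"
  proof -
    have "ennreal (I / \<sigma>) = ennreal (1 / \<sigma>) * ennreal I"
      using \<sigma> by (subst ennreal_mult'[symmetric]) auto
    then show ?thesis by (simp only: rker_tail_ln[OF d \<sigma>] I)
  qed
  have f': "has_bochner_integral lborel ?f I"
    by (rule has_bochner_integral_nn_integral) (use I \<open>0 < I\<close> in auto)
  have g': "has_bochner_integral lborel ?g (I / \<sigma>)"
  proof (rule has_bochner_integral_nn_integral)
    show "AE z in lborel. 0 \<le> ?g z" using d by (intro AE_I2) (auto simp: indicator_def)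
  qed (use g \<sigma> \<open>0 < I\<close> in auto)
  have eq: "indicator {d..} (norm z) * ((B - p * ln (norm z)) * rker \<sigma> z) = (B - p * ln d) * ?f z - p * ?g z" for z :: 'a
    using d by (auto simp: indicator_def ln_div algebra_simps)
  have "has_bochner_integral lborel (\<lambda>z. (B - p * ln d) * ?f z - p * ?g z) ((B - p * ln d) * I - p * (I / \<sigma>))"
    by (intro has_bochner_integral_diff has_bochner_integral_mult_right f' g')
  then have h: "has_bochner_integral lborel (\<lambda>z::'a. indicator {d..} (norm z) * ((B - p * ln (norm z)) * rker \<sigma> z))
      ((B - p * ln d) * I - p * (I / \<sigma>))" by (simp only: eq)
  then show "integrable lborel (\<lambda>z::'a. indicator {d..} (norm z) * ((B - p * ln (norm z)) * rker \<sigma> z))"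
    by (rule integrable.intros)
  have "(B - p * ln d) * I - p * (I / \<sigma>) = (B + p * (- (1 / \<sigma>) - ln d)) * I" by (simp add: algebra_simps)
  also have "0 < \<dots>" using \<open>0 < I\<close> B p ln by (intro mult_pos_pos add_nonneg_pos) auto
  finally show "0 < (LINT z|lborel. indicator {d..} (norm (z::'a)) * ((B - p * ln (norm z)) * rker \<sigma> z))"
    using has_bochner_integral_integral_eq[OF h] by simp
qed

section \<open>The function space and its energy form\<close>

abbreviation lborel2 :: "('a::euclidean_space \<times> 'a) measure" where
  "lborel2 \<equiv> lborel \<Otimes>\<^sub>M lborel"

lemma nn_integral_lborel_translate:
  fixes f :: "'a::euclidean_space \<Rightarrow> ennreal"
  assumes [measurable]: "f \<in> borel_measurable borel"
  shows "(\<integral>\<^sup>+x. f (x - y) \<partial>lborel) = (\<integral>\<^sup>+z. f z \<partial>lborel)"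
proof -
  have "(\<integral>\<^sup>+z. f z \<partial>lborel) = (\<integral>\<^sup>+z. f z \<partial>distr lborel borel ((+) (- y)))"
    by (simp add: lborel_distr_plus)
  also have "\<dots> = (\<integral>\<^sup>+x. f (x - y) \<partial>lborel)"
    by (subst nn_integral_distr) auto
  finally show ?thesis ..
qed

lemma nn_integral_conv_fst:
  fixes f h :: "'a::euclidean_space \<Rightarrow> ennreal"
  assumes [measurable]: "f \<in> borel_measurable borel" "h \<in> borel_measurable borel"
  shows "(\<integral>\<^sup>+(x, y). f x * h (x - y) \<partial>lborel2) = (\<integral>\<^sup>+x. f x \<partial>lborel) * (\<integral>\<^sup>+z. h z \<partial>lborel)"
proof -
  have "(\<integral>\<^sup>+(x, y). f x * h (x - y) \<partial>lborel2) = (\<integral>\<^sup>+x. \<integral>\<^sup>+y. f x * h (x - y) \<partial>lborel \<partial>lborel)"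
    by (subst lborel.nn_integral_fst[symmetric]) auto
  also have "\<dots> = (\<integral>\<^sup>+x. f x * (\<integral>\<^sup>+z. h z \<partial>lborel) \<partial>lborel)"
    by (intro nn_integral_cong) (simp add: nn_integral_cmult nn_integral_lborel_reflect)
  also have "\<dots> = (\<integral>\<^sup>+x. f x \<partial>lborel) * (\<integral>\<^sup>+z. h z \<partial>lborel)"
    by (rule nn_integral_multc) simp
  finally show ?thesis .
qed

lemma nn_integral_conv_snd:
  fixes f h :: "'a::euclidean_space \<Rightarrow> ennreal"
  assumes [measurable]: "f \<in> borel_measurable borel" "h \<in> borel_measurable borel"
  shows "(\<integral>\<^sup>+(x, y). f y * h (x - y) \<partial>lborel2) = (\<integral>\<^sup>+x. f x \<partial>lborel) * (\<integral>\<^sup>+z. h z \<partial>lborel)"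
proof -
  have "(\<integral>\<^sup>+(x, y). f y * h (x - y) \<partial>lborel2) = (\<integral>\<^sup>+y. \<integral>\<^sup>+x. f y * h (x - y) \<partial>lborel \<partial>lborel)"
    by (subst lborel_pair.nn_integral_snd[symmetric]) auto
  also have "\<dots> = (\<integral>\<^sup>+y. f y * (\<integral>\<^sup>+z. h z \<partial>lborel) \<partial>lborel)"
    by (intro nn_integral_cong) (simp add: nn_integral_cmult nn_integral_lborel_translate)
  also have "\<dots> = (\<integral>\<^sup>+x. f x \<partial>lborel) * (\<integral>\<^sup>+z. h z \<partial>lborel)"
    by (rule nn_integral_multc) simp
  finally show ?thesis .
qed

lemma integral_conv_fst:
  fixes f h :: "'a::euclidean_space \<Rightarrow> real"
  assumes f: "integrable lborel f" and h: "integrable lborel h"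
  shows "integrable lborel2 (\<lambda>(x, y). f x * h (x - y))"
    and "(LINT (x, y)|lborel2. f x * h (x - y)) = (LINT x|lborel. f x) * (LINT z|lborel. h z)"
proof -
  have [measurable]: "f \<in> borel_measurable borel" "h \<in> borel_measurable borel" using f h by auto
  have "(\<integral>\<^sup>+z. norm (case z of (x, y) \<Rightarrow> f x * h (x - y)) \<partial>lborel2)
    = (\<integral>\<^sup>+(x, y). ennreal \<bar>f x\<bar> * ennreal \<bar>h (x - y)\<bar> \<partial>lborel2)"
    by (intro nn_integral_cong) (auto simp: abs_mult ennreal_mult)
  also have "\<dots> = (\<integral>\<^sup>+x. ennreal \<bar>f x\<bar> \<partial>lborel) * (\<integral>\<^sup>+x. ennreal \<bar>h x\<bar> \<partial>lborel)"
    by (rule nn_integral_conv_fst) measurable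
  also have "\<dots> < \<infinity>" using f h by (auto simp: integrable_iff_bounded ennreal_mult_less_top)
  finally show int: "integrable lborel2 (\<lambda>(x, y). f x * h (x - y))"
    by (intro integrableI_bounded) auto
  have hx: "(LINT y|lborel. h (x - y)) = (LINT z|lborel. h z)" for x
  proof -
    have "(LINT z|lborel. h z) = (LINT z|density (distr lborel borel (\<lambda>y. x + (-1) *\<^sub>R y)) (\<lambda>_. ennreal (\<bar>-1\<bar> ^ DIM('a))). h z)"
      by (subst lborel_affine[of "-1" x]) auto
    also have "\<dots> = (LINT y|lborel. h (x - y))"
      by (subst integral_density) (auto simp: integral_distr)
    finally show ?thesis ..
  qed
  have "(LINT (x, y)|lborel2. f x * h (x - y)) = (LINT x|lborel. LINT y|lborel. f x * h (x - y))"
    using lborel_pair.integral_fst'[OF int] by simp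
  then show "(LINT (x, y)|lborel2. f x * h (x - y)) = (LINT x|lborel. f x) * (LINT z|lborel. h z)"
    by (simp add: hx)
qed

lemma integral_conv_snd:
  fixes f h :: "'a::euclidean_space \<Rightarrow> real"
  assumes f: "integrable lborel f" and h: "integrable lborel h" and even: "\<And>z. h (- z) = h z"
  shows "integrable lborel2 (\<lambda>(x, y). f y * h (x - y))"
    and "(LINT (x, y)|lborel2. f y * h (x - y)) = (LINT x|lborel. f x) * (LINT z|lborel. h z)"
proof -
  have ev: "h (x - y) = h (y - x)" for x y using even[of "y - x"] by simp
  have [measurable]: "f \<in> borel_measurable borel" "h \<in> borel_measurable borel" using f h by auto
  have eq: "(\<lambda>(x, y). f y * h (x - y)) = (\<lambda>(x, y). (\<lambda>(x, y). f x * h (x - y)) (y, x))"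
    using ev by auto
  show "integrable lborel2 (\<lambda>(x, y). f y * h (x - y))"
    unfolding eq by (rule lborel_pair.integrable_product_swap[OF integral_conv_fst(1)[OF f h]])
  have "(LINT (x, y)|lborel2. f y * h (x - y)) = (LINT (x, y)|lborel2. f x * h (x - y))"
    unfolding eq by (rule lborel_pair.integral_product_swap) measurable
  then show "(LINT (x, y)|lborel2. f y * h (x - y)) = (LINT x|lborel. f x) * (LINT z|lborel. h z)"
    using integral_conv_fst(2)[OF f h] by simp
qed

lemma AE_lborel2_fst:
  fixes P :: "'a::euclidean_space \<Rightarrow> bool"
  assumes "AE x in lborel. P x"
  shows "AE (x, y) in (lborel2 :: ('a \<times> 'a) measure). P x"
proof -
  obtain N where N: "{x. \<not> P x} \<subseteq> N" "N \<in> null_sets lborel"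
    using assms by (auto elim!: AE_E simp: null_setsI)
  have "N \<times> UNIV \<in> null_sets (lborel2 :: ('a \<times> 'a) measure)"
    by (rule lborel.times_in_null_sets1) (use N(2) in auto)
  then show ?thesis using N(1) by (intro AE_I'[of "N \<times> UNIV"]) auto
qed

lemma AE_lborel2_snd:
  fixes P :: "'a::euclidean_space \<Rightarrow> bool"
  assumes "AE x in lborel. P x"
  shows "AE (x, y) in (lborel2 :: ('a \<times> 'a) measure). P y"
proof -
  obtain N where N: "{x. \<not> P x} \<subseteq> N" "N \<in> null_sets lborel"
    using assms by (auto elim!: AE_E simp: null_setsI)
  have "UNIV \<times> N \<in> null_sets (lborel2 :: ('a \<times> 'a) measure)"
    by (rule lborel.times_in_null_sets2) (use N(2) in auto)
  then show ?thesis using N(1) by (intro AE_I'[of "UNIV \<times> N"]) auto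
qed

lemma C_const_pos:
  assumes "1 < p" "0 < s" "s < 1"
  shows "0 < C_const N s p"
proof -
  have "0 < real N + s * p" using assms by (intro add_nonneg_pos) auto
  then have "0 < Gamma ((real N + s * p) / 2)" "0 < Gamma (1 - s)" "0 < Gamma ((p + 1) / 2)"
    using assms by (auto intro!: Gamma_real_pos)
  then show ?thesis using assms by (auto simp: C_const_def intro!: divide_pos_pos mult_pos_pos)
qed

definition energy :: "real \<Rightarrow> ('a::euclidean_space \<Rightarrow> real) \<Rightarrow> ('a \<Rightarrow> real) \<Rightarrow> ennreal" where
  "energy p h u = (\<integral>\<^sup>+(x, y). ennreal (\<bar>u x - u y\<bar> powr p * h (x - y)) \<partial>lborel2)"

lemma energy_mono:
  assumes "\<And>z. g z \<le> h z"
  shows "energy p g u \<le> energy p h u"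
  unfolding energy_def using assms by (auto intro!: nn_integral_mono ennreal_leI mult_left_mono)

lemma energy_add:
  assumes [measurable]: "u \<in> borel_measurable borel" "g \<in> borel_measurable borel" "h \<in> borel_measurable borel"
    and "\<And>z. 0 \<le> g z" "\<And>z. 0 \<le> h z"
  shows "energy p (\<lambda>z. g z + h z) u = energy p g u + energy p h u"
  unfolding energy_def using assms
  by (subst nn_integral_add[symmetric]) (auto simp: distrib_left split_beta' intro!: nn_integral_cong)

lemma energy_cmult:
  assumes [measurable]: "u \<in> borel_measurable borel" "h \<in> borel_measurable borel"
    and "0 \<le> c"
  shows "energy p (\<lambda>z. c * h z) u = ennreal c * energy p h u"
proof -
  have "ennreal (\<bar>u x - u y\<bar> powr p * (c * h (x - y))) = ennreal c * ennreal (\<bar>u x - u y\<bar> powr p * h (x - y))" for x y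
    using assms by (subst ennreal_mult'[symmetric]) (auto simp: mult_ac)
  then show ?thesis
    unfolding energy_def by (subst nn_integral_cmult[symmetric]) (auto simp: split_beta')
qed

text \<open>
  Bound \<open>|u(x) - u(y)|\<^sup>p\<close> by \<open>2\<^sup>p (|u(x)|\<^sup>p + |u(y)|\<^sup>p)\<close> and integrate in the variable that does not
  occur.
\<close>

lemma energy_finite_of_integrable_kernel:
  assumes [measurable]: "u \<in> borel_measurable borel" "h \<in> borel_measurable borel"
    and nn: "\<And>z. 0 \<le> h z" and u: "integrable lborel (\<lambda>x. \<bar>u x\<bar> powr p)" 
    and h: "(\<integral>\<^sup>+z. ennreal (h z) \<partial>lborel) < \<infinity>" and p: "0 \<le> p"
  shows "energy p h u < \<infinity>"
proof -
  let ?f = "\<lambda>x. ennreal (2 powr p * \<bar>u x\<bar> powr p)"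
  have "energy p h u \<le> (\<integral>\<^sup>+z. (case z of (x, y) \<Rightarrow> ?f x * ennreal (h (x - y))) + (case z of (x, y) \<Rightarrow> ?f y * ennreal (h (x - y))) \<partial>lborel2)"
    unfolding energy_def
  proof (intro nn_integral_mono, clarify)
    fix x y
    have "\<bar>u x - u y\<bar> powr p * h (x - y) \<le> 2 powr p * (\<bar>u x\<bar> powr p + \<bar>u y\<bar> powr p) * h (x - y)"
      using nn p by (intro mult_right_mono abs_diff_powr_le) auto
    also have "\<dots> = 2 powr p * \<bar>u x\<bar> powr p * h (x - y) + 2 powr p * \<bar>u y\<bar> powr p * h (x - y)"
      by (simp add: algebra_simps)
    finally show "ennreal (\<bar>u x - u y\<bar> powr p * h (x - y)) \<le> ?f x * ennreal (h (x - y)) + ?f y * ennreal (h (x - y))"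
      using nn by (simp add: ennreal_mult'[symmetric] ennreal_plus[symmetric] ennreal_leI del: ennreal_plus)
  qed
  also have "\<dots> = (\<integral>\<^sup>+(x, y). ?f x * ennreal (h (x - y)) \<partial>lborel2) + (\<integral>\<^sup>+(x, y). ?f y * ennreal (h (x - y)) \<partial>lborel2)"
    by (rule nn_integral_add) measurable
  also have "\<dots> = (\<integral>\<^sup>+x. ?f x \<partial>lborel) * (\<integral>\<^sup>+z. ennreal (h z) \<partial>lborel) + (\<integral>\<^sup>+x. ?f x \<partial>lborel) * (\<integral>\<^sup>+z. ennreal (h z) \<partial>lborel)"
    by (subst nn_integral_conv_fst nn_integral_conv_snd; simp)+
  also have "\<dots> < \<infinity>"
  proof -
    have "integrable lborel (\<lambda>x. 2 powr p * \<bar>u x\<bar> powr p)" using u by simp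
    then have "(\<integral>\<^sup>+x. ?f x \<partial>lborel) < \<infinity>" unfolding integrable_iff_bounded by simp
    then show ?thesis using h by (simp add: ennreal_mult_less_top)
  qed
  finally show ?thesis .
qed

lemma kernel_plus_eq:
  "kernel_plus s p (z::'a::euclidean_space) = C_const DIM('a) s p * (max 0 (- ln (norm z)) * rker (s * p) z)"
  by (simp add: kernel_plus_def rker_def)

lemma kernel_minus_eq:
  "kernel_minus s p (z::'a::euclidean_space) = C_const DIM('a) s p * (max 0 (ln (norm z)) * rker (s * p) z)"
  by (simp add: kernel_minus_def rker_def)

lemma kernel_plus_measurable [measurable]: "kernel_plus s p \<in> borel_measurable borel"
  unfolding kernel_plus_def by measurable

lemma kernel_minus_measurable [measurable]: "kernel_minus s p \<in> borel_measurable borel"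
  unfolding kernel_minus_def by measurable

text \<open>
  The three forms combine into a single form with this kernel. It is positive near the origin and
  negative far from it.
\<close>

definition kernel_log :: "real \<Rightarrow> real \<Rightarrow> 'a::euclidean_space \<Rightarrow> real" where
  "kernel_log s p z = C_const DIM('a) s p / 2 * ((B_const DIM('a) s p - p * ln (norm z)) * rker (s * p) z)"

lemma kernel_log_measurable [measurable]: "kernel_log s p \<in> borel_measurable borel"
  unfolding kernel_log_def by measurable

lemma kernel_log_minus: "kernel_log s p (- z) = kernel_log s p z"
  by (simp add: kernel_log_def)

lemma kernel_log_split:
  "kernel_log s p (z::'a::euclidean_space) = p / 2 * (kernel_plus s p z - kernel_minus s p z)
    + B_const DIM('a) s p * C_const DIM('a) s p / 2 * rker (s * p) z"
proof -
  have "max 0 (- ln (norm z)) * rker (s * p) z - max 0 (ln (norm z)) * rker (s * p) z = - ln (norm z) * rker (s * p) z"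
    by (simp add: max_def)
  then have eq: "kernel_plus s p z - kernel_minus s p z = C_const DIM('a) s p * (- ln (norm z) * rker (s * p) z)"
    unfolding kernel_plus_eq kernel_minus_eq by (metis right_diff_distrib)
  show ?thesis unfolding eq kernel_log_def by (simp add: algebra_simps)
qed

lemma integral_linear_combination:
  fixes f g h :: "'b \<Rightarrow> real"
  assumes "integrable M f" "integrable M g" "integrable M h"
  shows "(LINT z|M. a * (f z - g z) + b * h z) = a * (integral\<^sup>L M f - integral\<^sup>L M g) + b * integral\<^sup>L M h"
  using assms by simp

text \<open>
  The two constants are parameters so that they can be written without mentioning the dimension.
\<close>

locale log_problem =
  fixes \<Omega> :: "'a::euclidean_space set" and s p B C :: real
  assumes p1: "1 < p" and s0: "0 < s" and s1: "s < 1"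
    and open_dom: "open \<Omega>" and bounded_dom: "bounded \<Omega>" and nonempty_dom: "\<Omega> \<noteq> {}"
    and B_eq: "B = B_const DIM('a) s p" and C_eq: "C = C_const DIM('a) s p"
begin

abbreviation K :: "'a \<Rightarrow> real" where "K \<equiv> kernel_log s p"
abbreviation W :: "'a \<Rightarrow> real" where "W \<equiv> logker (s * p)"
abbreviation "\<D> \<equiv> W0 s p \<Omega>"
abbreviation "J \<equiv> (J_log s p :: ('a \<Rightarrow> real) \<Rightarrow> _)"

lemma p0: "0 < p" and sp0: "0 < s * p" and sp_less: "s * p < p" and Cpos: "0 < C"
  using p1 s0 s1 C_const_pos[of p s] by (auto simp: C_eq)

lemma kernel_plus_C: "kernel_plus s p (z::'a) = C * (max 0 (- ln (norm z)) * rker (s * p) z)"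
  by (simp add: kernel_plus_eq C_eq)

lemma kernel_minus_C: "kernel_minus s p (z::'a) = C * (max 0 (ln (norm z)) * rker (s * p) z)"
  by (simp add: kernel_minus_eq C_eq)

lemma K_eq: "K z = C / 2 * ((B - p * ln (norm z)) * rker (s * p) z)"
  by (simp add: kernel_log_def C_eq B_eq)

lemma dom_measurable [measurable]: "\<Omega> \<in> sets borel"
  using open_dom by simp

lemma kernel_plus_le_W: "kernel_plus s p z \<le> C * W z"
  unfolding kernel_plus_C logker_def using Cpos by (intro mult_left_mono mult_right_mono) auto

lemma kernel_minus_le_W: "kernel_minus s p z \<le> C * W z"
  unfolding kernel_minus_C logker_def using Cpos by (intro mult_left_mono mult_right_mono) auto

lemma kernel_plus_nonneg: "0 \<le> kernel_plus s p (z::'a)" and kernel_minus_nonneg: "0 \<le> kernel_minus s p (z::'a)"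
  using Cpos by (simp_all add: kernel_plus_C kernel_minus_C)

lemma abs_K_le_W: "\<bar>K z\<bar> \<le> C / 2 * (\<bar>B\<bar> + p) * W z"
proof -
  have "\<bar>K z\<bar> = C / 2 * (\<bar>B - p * ln (norm z)\<bar> * rker (s * p) z)"
    using Cpos by (simp add: K_eq abs_mult)
  also have "\<dots> \<le> C / 2 * ((\<bar>B\<bar> + p) * (1 + \<bar>ln (norm z)\<bar>) * rker (s * p) z)"
  proof (intro mult_left_mono mult_right_mono)
    have "\<bar>B - p * ln (norm z)\<bar> \<le> \<bar>B\<bar> + p * \<bar>ln (norm z)\<bar>" using p0 by (simp add: abs_mult abs_triangle_ineq4[THEN order_trans])
    also have "\<dots> \<le> (\<bar>B\<bar> + p) * (1 + \<bar>ln (norm z)\<bar>)" using p0 by (simp add: algebra_simps)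
    finally show "\<bar>B - p * ln (norm z)\<bar> \<le> (\<bar>B\<bar> + p) * (1 + \<bar>ln (norm z)\<bar>)" .
  qed (use Cpos in auto)
  finally show ?thesis by (simp add: logker_def mult_ac)
qed

lemma W0_memD:
  assumes "u \<in> \<D>"
  shows "u \<in> borel_measurable borel" "integrable lborel (\<lambda>x. \<bar>u x\<bar> powr p)"
    "AE x in lborel. x \<notin> \<Omega> \<longrightarrow> u x = 0" "energy p (kernel_plus s p) u < \<infinity>"
  using assms by (auto simp: W0_def energy_def)

text \<open>
  Only the singularity at the origin matters for functions in \<open>L\<^sup>p\<close>, since the kernel is integrable away
  from it. So the energy with kernel \<open>W\<close> may be tested with any kernel that dominates \<open>W\<close> near \<open>0\<close>.
\<close>

lemma energy_finite_near:
  assumes [measurable]: "u \<in> borel_measurable borel" "g \<in> borel_measurable borel"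
    and u: "integrable lborel (\<lambda>x. \<bar>u x\<bar> powr p)"
    and g: "\<And>z. 0 \<le> g z" "energy p g u < \<infinity>"
    and \<delta>: "0 < \<delta>" and c: "0 \<le> c" and le: "\<And>z. z \<noteq> 0 \<Longrightarrow> norm z < \<delta> \<Longrightarrow> W z \<le> c * g z"
  shows "energy p W u < \<infinity>"
proof -
  let ?far = "\<lambda>z::'a. indicator {\<delta>..} (norm z) * W z"
  have "W z \<le> c * g z + ?far z" for z
    using le[of z] g(1)[of z] c by (cases "z = 0"; cases "norm z < \<delta>") (auto simp: logker_def)
  then have "energy p W u \<le> energy p (\<lambda>z. c * g z + ?far z) u" by (intro energy_mono)
  also have "\<dots> = ennreal c * energy p g u + energy p ?far u"
    using c g(1) by (subst energy_add) (auto simp: energy_cmult)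
  also have "\<dots> < \<infinity>"
  proof -
    have "energy p ?far u < \<infinity>"
      using u p0 logker_far_finite[OF sp0 \<delta>, where 'a='a]
      by (intro energy_finite_of_integrable_kernel) auto
    then show ?thesis using g(2) by (simp add: ennreal_mult_less_top)
  qed
  finally show ?thesis .
qed

text \<open>
  For \<open>|z| < 1/e\<close> the logarithm in the positive kernel is at least \<open>1\<close>, and it then bounds \<open>1 + |ln |z||\<close>
  up to a factor \<open>2\<close>.
\<close>

lemma W0_energy:
  assumes "u \<in> \<D>" shows "energy p W u < \<infinity>"
proof (rule energy_finite_near[where g = "kernel_plus s p" and \<delta> = "exp (-1)" and c = "2 / C"])
  fix z :: 'a assume z: "z \<noteq> 0" "norm z < exp (-1)"
  then have "ln (norm z) < ln (exp (-1))" by (subst ln_less_cancel_iff) auto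
  then have "1 + \<bar>ln (norm z)\<bar> \<le> 2 * max 0 (- ln (norm z))" by simp
  then have "W z \<le> 2 * max 0 (- ln (norm z)) * rker (s * p) z"
    unfolding logker_def by (intro mult_right_mono) auto
  then show "W z \<le> 2 / C * kernel_plus s p z" using Cpos by (simp add: kernel_plus_C)
qed (use W0_memD[OF assms] Cpos kernel_plus_nonneg in auto)

lemma W0_memI:
  assumes [measurable]: "u \<in> borel_measurable borel"
    and u: "integrable lborel (\<lambda>x. \<bar>u x\<bar> powr p)" "AE x in lborel. x \<notin> \<Omega> \<longrightarrow> u x = 0"
    and e: "energy p W u < \<infinity>"
  shows "u \<in> \<D>"
proof -
  have "energy p (kernel_plus s p) u \<le> energy p (\<lambda>z. C * W z) u"
    by (intro energy_mono kernel_plus_le_W)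
  also have "\<dots> = ennreal C * energy p W u" using Cpos by (intro energy_cmult) auto
  also have "\<dots> < \<infinity>" using e by (simp add: ennreal_mult_less_top)
  finally show ?thesis using assms by (simp add: W0_def energy_def)
qed

text \<open>
  All closure properties of the space (linear combinations, absolute values, \<open>p\<close>-means) are instances
  of this principle.
\<close>

lemma W0_dominated:
  assumes [measurable]: "v \<in> borel_measurable borel" and u: "u \<in> \<D>" "w \<in> \<D>"
    and c: "0 \<le> a" "0 \<le> b"
    and zero: "\<And>x. u x = 0 \<Longrightarrow> w x = 0 \<Longrightarrow> v x = 0"
    and le: "\<And>x. \<bar>v x\<bar> powr p \<le> a * \<bar>u x\<bar> powr p + b * \<bar>w x\<bar> powr p"
    and le2: "\<And>x y. \<bar>v x - v y\<bar> powr p \<le> a * \<bar>u x - u y\<bar> powr p + b * \<bar>w x - w y\<bar> powr p"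
  shows "v \<in> \<D>"
proof (rule W0_memI)
  note [measurable] = W0_memD(1)[OF u(1)] W0_memD(1)[OF u(2)]
  show "integrable lborel (\<lambda>x. \<bar>v x\<bar> powr p)"
  proof (rule Bochner_Integration.integrable_bound)
    show "integrable lborel (\<lambda>x. a * \<bar>u x\<bar> powr p + b * \<bar>w x\<bar> powr p)"
      using W0_memD(2)[OF u(1)] W0_memD(2)[OF u(2)] by auto
    show "AE x in lborel. norm (\<bar>v x\<bar> powr p) \<le> norm (a * \<bar>u x\<bar> powr p + b * \<bar>w x\<bar> powr p)"
      using le c by (intro AE_I2) simp
  qed measurable
  show "AE x in lborel. x \<notin> \<Omega> \<longrightarrow> v x = 0"
    using W0_memD(3)[OF u(1)] W0_memD(3)[OF u(2)] by eventually_elim (auto intro: zero)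
  have "energy p W v \<le> (\<integral>\<^sup>+z. ennreal a * (case z of (x, y) \<Rightarrow> ennreal (\<bar>u x - u y\<bar> powr p * W (x - y)))
      + ennreal b * (case z of (x, y) \<Rightarrow> ennreal (\<bar>w x - w y\<bar> powr p * W (x - y))) \<partial>lborel2)"
    unfolding energy_def
  proof (intro nn_integral_mono, clarify)
    fix x y
    have "\<bar>v x - v y\<bar> powr p * W (x - y) \<le> (a * \<bar>u x - u y\<bar> powr p + b * \<bar>w x - w y\<bar> powr p) * W (x - y)"
      by (intro mult_right_mono le2) auto
    also have "\<dots> = a * (\<bar>u x - u y\<bar> powr p * W (x - y)) + b * (\<bar>w x - w y\<bar> powr p * W (x - y))"
      by (simp add: algebra_simps)
    finally show "ennreal (\<bar>v x - v y\<bar> powr p * W (x - y)) \<le> ennreal a * ennreal (\<bar>u x - u y\<bar> powr p * W (x - y))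
       + ennreal b * ennreal (\<bar>w x - w y\<bar> powr p * W (x - y))"
      using c by (simp add: ennreal_mult'[symmetric] ennreal_plus[symmetric] ennreal_leI del: ennreal_plus)
  qed
  also have "\<dots> = ennreal a * energy p W u + ennreal b * energy p W w"
    unfolding energy_def by (subst nn_integral_add) (auto simp: nn_integral_cmult)
  also have "\<dots> < \<infinity>" using W0_energy u by (simp add: ennreal_mult_less_top)
  finally show "energy p W v < \<infinity>" .
qed measurable

lemma W0_add_scaled:
  assumes "u \<in> \<D>" "v \<in> \<D>" shows "(\<lambda>x. u x + c * v x) \<in> \<D>"
proof (rule W0_dominated[OF _ assms, where a = "2 powr p" and b = "2 powr p * \<bar>c\<bar> powr p"])
  note [measurable] = W0_memD(1)[OF assms(1)] W0_memD(1)[OF assms(2)]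
  show "(\<lambda>x. u x + c * v x) \<in> borel_measurable borel" by measurable
  fix x y
  show "\<bar>u x + c * v x\<bar> powr p \<le> 2 powr p * \<bar>u x\<bar> powr p + 2 powr p * \<bar>c\<bar> powr p * \<bar>v x\<bar> powr p"
    using abs_add_powr_le[of p "u x" "c * v x"] p0 by (simp add: abs_mult powr_mult distrib_left mult.assoc)
  have eq: "u x + c * v x - (u y + c * v y) = (u x - u y) + c * (v x - v y)" by (simp add: algebra_simps)
  show "\<bar>u x + c * v x - (u y + c * v y)\<bar> powr p \<le> 2 powr p * \<bar>u x - u y\<bar> powr p + 2 powr p * \<bar>c\<bar> powr p * \<bar>v x - v y\<bar> powr p"
    unfolding eq using abs_add_powr_le[of p "u x - u y" "c * (v x - v y)"] p0 by (simp add: abs_mult powr_mult distrib_left mult.assoc)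
qed auto

lemma W0_scaled:
  assumes "u \<in> \<D>" shows "(\<lambda>x. c * u x) \<in> \<D>"
  using W0_add_scaled[OF assms assms, of "c - 1"] by (simp add: algebra_simps)

lemma W0_abs:
  assumes "u \<in> \<D>" shows "(\<lambda>x. \<bar>u x\<bar>) \<in> \<D>"
proof (rule W0_dominated[OF _ assms assms, where a = 1 and b = 0])
  note [measurable] = W0_memD(1)[OF assms]
  show "(\<lambda>x. \<bar>u x\<bar>) \<in> borel_measurable borel" by measurable
  fix x y
  show "\<bar>\<bar>u x\<bar> - \<bar>u y\<bar>\<bar> powr p \<le> 1 * \<bar>u x - u y\<bar> powr p + 0 * \<bar>u x - u y\<bar> powr p"
    using p0 by (auto intro!: powr_mono2)
qed auto

text \<open>
  Hidden convexity at each pair of points bounds the energy of the \<open>p\<close>-mean.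
\<close>

lemma W0_pmean:
  assumes u: "u \<in> \<D>" "v \<in> \<D>" and nn: "\<And>x. 0 \<le> u x" "\<And>x. 0 \<le> v x" and t: "0 \<le> t" "t \<le> 1"
  shows "(\<lambda>x. pmean p t (u x) (v x)) \<in> \<D>"
proof (rule W0_dominated[OF _ u, where a = "1 - t" and b = t])
  note [measurable] = W0_memD(1)[OF u(1)] W0_memD(1)[OF u(2)]
  show "(\<lambda>x. pmean p t (u x) (v x)) \<in> borel_measurable borel" by measurable
  fix x y
  show "\<bar>pmean p t (u x) (v x)\<bar> powr p \<le> (1 - t) * \<bar>u x\<bar> powr p + t * \<bar>v x\<bar> powr p"
    using p0 t by (simp add: pmean_powr)
  show "\<bar>pmean p t (u x) (v x) - pmean p t (u y) (v y)\<bar> powr p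
     \<le> (1 - t) * \<bar>u x - u y\<bar> powr p + t * \<bar>v x - v y\<bar> powr p"
    by (intro hidden_convexity(1) p1 t nn)
qed (use t p0 in \<open>auto simp: pmean_def\<close>)

lemma integrable_energy:
  assumes u: "u \<in> \<D>" and [measurable]: "h \<in> borel_measurable borel" and h: "\<And>z. \<bar>h z\<bar> \<le> c * W z" "0 \<le> c"
  shows "integrable lborel2 (\<lambda>(x, y). \<bar>u x - u y\<bar> powr p * h (x - y))"
proof (rule integrableI_bounded)
  note [measurable] = W0_memD(1)[OF u]
  show "(\<lambda>(x, y). \<bar>u x - u y\<bar> powr p * h (x - y)) \<in> borel_measurable lborel2" by measurable
  have "(\<integral>\<^sup>+z. norm (case z of (x, y) \<Rightarrow> \<bar>u x - u y\<bar> powr p * h (x - y)) \<partial>lborel2) \<le> energy p (\<lambda>z. c * W z) u"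
    unfolding energy_def using h by (intro nn_integral_mono) (auto simp: abs_mult intro!: ennreal_leI mult_left_mono)
  also have "\<dots> = ennreal c * energy p W u" using h by (intro energy_cmult) auto
  also have "\<dots> < \<infinity>" using W0_energy[OF u] by (simp add: ennreal_mult_less_top)
  finally show "(\<integral>\<^sup>+z. norm (case z of (x, y) \<Rightarrow> \<bar>u x - u y\<bar> powr p * h (x - y)) \<partial>lborel2) < \<infinity>" .
qed

lemma integrable_form:
  assumes u: "u \<in> \<D>" "v \<in> \<D>" and [measurable]: "h \<in> borel_measurable borel" and h: "\<And>z. \<bar>h z\<bar> \<le> c * W z" "0 \<le> c"
  shows "integrable lborel2 (\<lambda>(x, y). spow p (u x - u y) * (v x - v y) * h (x - y))"
proof (rule Bochner_Integration.integrable_bound)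
  note [measurable] = W0_memD(1)[OF u(1)] W0_memD(1)[OF u(2)]
  show "(\<lambda>(x, y). spow p (u x - u y) * (v x - v y) * h (x - y)) \<in> borel_measurable lborel2" by measurable
  have abs: "\<bar>\<bar>h z\<bar>\<bar> \<le> c * W z" for z using h(1)[of z] by simp
  show "integrable lborel2 (\<lambda>z. (case z of (x, y) \<Rightarrow> \<bar>u x - u y\<bar> powr p * \<bar>h (x - y)\<bar>) + (case z of (x, y) \<Rightarrow> \<bar>v x - v y\<bar> powr p * \<bar>h (x - y)\<bar>))"
    by (intro Bochner_Integration.integrable_add integrable_energy[OF _ _ abs h(2)] u) measurable
  show "AE z in lborel2. norm (case z of (x, y) \<Rightarrow> spow p (u x - u y) * (v x - v y) * h (x - y))
     \<le> norm ((case z of (x, y) \<Rightarrow> \<bar>u x - u y\<bar> powr p * \<bar>h (x - y)\<bar>) + (case z of (x, y) \<Rightarrow> \<bar>v x - v y\<bar> powr p * \<bar>h (x - y)\<bar>))"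
  proof (intro AE_I2, clarify)
    fix x y
    have "\<bar>spow p (u x - u y) * (v x - v y)\<bar> * \<bar>h (x - y)\<bar> \<le> (\<bar>u x - u y\<bar> powr p + \<bar>v x - v y\<bar> powr p) * \<bar>h (x - y)\<bar>"
      by (intro mult_right_mono abs_spow_mult_le p1) auto
    then show "norm (spow p (u x - u y) * (v x - v y) * h (x - y)) \<le> norm (\<bar>u x - u y\<bar> powr p * \<bar>h (x - y)\<bar> + \<bar>v x - v y\<bar> powr p * \<bar>h (x - y)\<bar>)"
      by (simp add: abs_mult distrib_right)
  qed
qed

lemma K_const_nonneg: "0 \<le> C / 2 * (\<bar>B\<bar> + p)"
  using Cpos p0 by simp

lemmas integrable_energy_K = integrable_energy[OF _ kernel_log_measurable abs_K_le_W K_const_nonneg]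
lemmas integrable_form_K = integrable_form[OF _ _ kernel_log_measurable abs_K_le_W K_const_nonneg]

text \<open>
  For functions of the space the three double integrals converge, and their combination is one double
  integral.
\<close>

lemma J_eq:
  assumes u: "u \<in> \<D>" "v \<in> \<D>"
  shows "J u v = (LINT (x, y)|lborel2. spow p (u x - u y) * (v x - v y) * K (x - y))"
proof -
  let ?G = "\<lambda>h z. case z of (x, y) \<Rightarrow> spow p (u x - u y) * (v x - v y) * h (x - y)"
  have "\<bar>kernel_plus s p z\<bar> \<le> C * W z" "\<bar>kernel_minus s p z\<bar> \<le> C * W z" for z
    using kernel_plus_le_W[of z] kernel_minus_le_W[of z] kernel_plus_nonneg[of z] kernel_minus_nonneg[of z] by auto
  then have 1: "integrable lborel2 (?G (kernel_plus s p))" and 2: "integrable lborel2 (?G (kernel_minus s p))"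
    using Cpos by (auto intro!: integrable_form[OF u, where c = C])
  have 3: "integrable lborel2 (?G (rker (s * p)))"
    by (intro integrable_form[OF u, where c = 1]) (auto simp: logker_def distrib_right)
  have fr: "J_frac s p u v = (LINT z|lborel2. ?G (rker (s * p)) z)"
    unfolding J_frac_def by (simp add: rker_def)
  have "?G K z = p / 2 * (?G (kernel_plus s p) z - ?G (kernel_minus s p) z) + B * C / 2 * ?G (rker (s * p)) z" for z
    by (cases z) (simp only: prod.case kernel_log_split B_eq[symmetric] C_eq[symmetric], simp only: algebra_simps)
  then have "(LINT z|lborel2. ?G K z) = (LINT z|lborel2. p / 2 * (?G (kernel_plus s p) z - ?G (kernel_minus s p) z) + B * C / 2 * ?G (rker (s * p)) z)"
    by (simp only:)
  also have "\<dots> = p / 2 * ((LINT z|lborel2. ?G (kernel_plus s p) z) - (LINT z|lborel2. ?G (kernel_minus s p) z)) + B * C / 2 * (LINT z|lborel2. ?G (rker (s * p)) z)"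
    by (rule integral_linear_combination[OF 1 2 3])
  finally show ?thesis unfolding J_log_def B_eq[symmetric] C_eq[symmetric] fr J_plus_def J_minus_def by simp
qed

lemma J_self:
  assumes "u \<in> \<D>"
  shows "J u u = (LINT (x, y)|lborel2. \<bar>u x - u y\<bar> powr p * K (x - y))"
  using J_eq[OF assms assms] by (simp add: spow_times_self)

lemma J_scaled:
  assumes "u \<in> \<D>"
  shows "J (\<lambda>x. c * u x) (\<lambda>x. c * u x) = \<bar>c\<bar> powr p * J u u"
proof -
  have "J (\<lambda>x. c * u x) (\<lambda>x. c * u x) = (LINT z|lborel2. \<bar>c\<bar> powr p * (case z of (x, y) \<Rightarrow> \<bar>u x - u y\<bar> powr p * K (x - y)))"
    unfolding J_self[OF W0_scaled[OF assms]]
    by (intro Bochner_Integration.integral_cong) (auto simp: right_diff_distrib[symmetric] abs_mult powr_mult)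
  then show ?thesis by (simp add: J_self[OF assms])
qed

definition mass :: "('a \<Rightarrow> real) \<Rightarrow> real" where
  "mass u = (LINT x|lborel. \<bar>u x\<bar> powr p)"

lemma mass_nonneg: "0 \<le> mass u"
  by (simp add: mass_def)

lemma set_integral_dom:
  fixes f :: "'a \<Rightarrow> real"
  assumes "AE x in lborel. x \<notin> \<Omega> \<longrightarrow> f x = 0" "f \<in> borel_measurable borel"
  shows "(LINT x:\<Omega>|lborel. f x) = (LINT x|lborel. f x)"
  unfolding set_lebesgue_integral_def using assms
  by (intro integral_cong_AE) (auto elim!: AE_mp simp: indicator_def)

lemma mass_dom:
  assumes "u \<in> \<D>" shows "(LINT x:\<Omega>|lborel. \<bar>u x\<bar> powr p) = mass u"
  unfolding mass_def using W0_memD[OF assms] p0 by (intro set_integral_dom) (auto elim!: AE_mp)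

lemma normalized_iff: "u \<in> normalized_W0 s p \<Omega> \<longleftrightarrow> u \<in> \<D> \<and> mass u = 1"
proof -
  have "mass u powr (1 / p) = 1 \<longleftrightarrow> mass u = 1"
    using powr_left_injective[of "1/p" "mass u" 1] p0 mass_nonneg[of u] by auto
  then show ?thesis by (auto simp: normalized_W0_def Lp_norm_def mass_dom)
qed

lemma mass_scaled: "mass (\<lambda>x. c * u x) = \<bar>c\<bar> powr p * mass u"
  by (simp add: mass_def abs_mult powr_mult)

lemma mass_eq_0_iff:
  assumes "u \<in> \<D>" shows "mass u = 0 \<longleftrightarrow> (AE x in lborel. u x = 0)"
proof -
  have "mass u = 0 \<longleftrightarrow> (AE x in lborel. \<bar>u x\<bar> powr p = 0)"
    unfolding mass_def using W0_memD(2)[OF assms] by (intro integral_nonneg_eq_0_iff_AE) auto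
  then show ?thesis by simp
qed

lemma J_self_null:
  assumes "u \<in> \<D>" "mass u = 0" shows "J u u = 0"
proof -
  note [measurable] = W0_memD(1)[OF assms(1)]
  have z: "AE x in lborel. u x = 0" using assms mass_eq_0_iff by simp
  have "AE (x, y) in lborel2. \<bar>u x - u y\<bar> powr p * K (x - y) = 0"
    using AE_lborel2_fst[OF z] AE_lborel2_snd[OF z] by eventually_elim auto
  then have "(LINT (x, y)|lborel2. \<bar>u x - u y\<bar> powr p * K (x - y)) = (LINT z::'a \<times> 'a|lborel2. 0)"
    by (intro integral_cong_AE) auto
  then show ?thesis by (simp add: J_self[OF assms(1)])
qed

end

section \<open>Compactness in the Lebesgue space\<close>

definition Lp_dist :: "real \<Rightarrow> ('a::euclidean_space \<Rightarrow> real) \<Rightarrow> ('a \<Rightarrow> real) \<Rightarrow> ennreal" where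
  "Lp_dist p f g = (\<integral>\<^sup>+x. ennreal (\<bar>f x - g x\<bar> powr p) \<partial>lborel)"

lemma Lp_dist_commute: "Lp_dist p f g = Lp_dist p g f"
  by (simp add: Lp_dist_def abs_minus_commute)

lemma Lp_dist_triangle:
  assumes [measurable]: "f \<in> borel_measurable borel" "g \<in> borel_measurable borel" "h \<in> borel_measurable borel"
    and p: "0 \<le> p"
  shows "Lp_dist p f h \<le> ennreal (2 powr p) * (Lp_dist p f g + Lp_dist p g h)"
proof -
  have "Lp_dist p f h \<le> (\<integral>\<^sup>+x. ennreal (2 powr p) * (ennreal (\<bar>f x - g x\<bar> powr p) + ennreal (\<bar>g x - h x\<bar> powr p)) \<partial>lborel)"
    unfolding Lp_dist_def
  proof (rule nn_integral_mono)
    fix x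
    have "\<bar>f x - h x\<bar> powr p \<le> 2 powr p * (\<bar>f x - g x\<bar> powr p + \<bar>g x - h x\<bar> powr p)"
      using p by (intro powr_le_sum_powr) auto
    then show "ennreal (\<bar>f x - h x\<bar> powr p) \<le> ennreal (2 powr p) * (ennreal (\<bar>f x - g x\<bar> powr p) + ennreal (\<bar>g x - h x\<bar> powr p))"
      by (simp add: ennreal_mult'[symmetric] ennreal_plus[symmetric] ennreal_leI del: ennreal_plus)
  qed
  also have "\<dots> = ennreal (2 powr p) * (Lp_dist p f g + Lp_dist p g h)"
    unfolding Lp_dist_def by (subst nn_integral_cmult, simp, subst nn_integral_add) auto
  finally show ?thesis .
qed

text \<open>
  The Riesz-Fischer theorem, in the form of a subsequence that converges both in the mean and almost
  everywhere: along a subsequence the consecutive distances decay geometrically, so the increments are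
  almost everywhere dominated by a geometric series.
\<close>

lemma Lp_Cauchy_subseq:
  fixes X :: "nat \<Rightarrow> 'a::euclidean_space \<Rightarrow> real"
  assumes p: "0 < p" and [measurable]: "\<And>n. X n \<in> borel_measurable borel"
    and Cauchy: "\<And>\<epsilon>. 0 < \<epsilon> \<Longrightarrow> \<exists>N. \<forall>m\<ge>N. \<forall>n\<ge>N. Lp_dist p (X m) (X n) \<le> ennreal \<epsilon>"
  obtains r v where "strict_mono r" "v \<in> borel_measurable borel"
    "(\<lambda>n. Lp_dist p (X (r n)) v) \<longlonglongrightarrow> 0" "AE x in lborel. (\<lambda>n. X (r n) x) \<longlonglongrightarrow> v x"
proof -
  \<comment> \<open>the weights \<open>2\<^sup>p\<^sup>k\<close> make the pointwise increments decay like \<open>2\<^sup>-\<^sup>k\<close>, and \<open>2\<^sup>p\<^sup>k e k = 2\<^sup>-\<^sup>k\<close> is still summable\<close>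
  define e where "e k = (2 powr (- (p + 1))) ^ k" for k :: nat
  have e0: "0 < e k" for k by (simp add: e_def)
  obtain N where N: "\<And>k m n. N k \<le> m \<Longrightarrow> N k \<le> n \<Longrightarrow> Lp_dist p (X m) (X n) \<le> ennreal (e k)"
    using Cauchy[OF e0] by metis
  \<comment> \<open>strictly increasing and at least \<open>N k\<close>\<close>
  define r where "r k = k + (\<Sum>j\<le>k. N j)" for k
  have r: "strict_mono r" by (intro strict_mono_Suc_iff[THEN iffD2]) (simp add: r_def)
  have rN: "N k \<le> r m" if "k \<le> m" for k m
  proof -
    have "N k \<le> (\<Sum>j\<le>m. N j)" using that by (intro member_le_sum) auto
    then show ?thesis by (simp add: r_def)
  qed
  have D: "Lp_dist p (X (r m)) (X (r n)) \<le> ennreal (e k)" if "k \<le> m" "k \<le> n" for k m n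
    using N rN that by blast
  let ?d = "\<lambda>k x. \<bar>X (r (Suc k)) x - X (r k) x\<bar>"
  let ?w = "\<lambda>k. 2 powr (p * real k)"
  have "(\<integral>\<^sup>+x. (\<Sum>k. ennreal (?w k) * ennreal (?d k x powr p)) \<partial>lborel) = (\<Sum>k. ennreal (?w k) * Lp_dist p (X (r (Suc k))) (X (r k)))"
    unfolding Lp_dist_def by (subst nn_integral_suminf) (auto simp: nn_integral_cmult)
  also have "\<dots> \<le> (\<Sum>k. ennreal ((1 / 2) ^ k))"
  proof (rule suminf_le)
    fix k
    have "ennreal (?w k) * Lp_dist p (X (r (Suc k))) (X (r k)) \<le> ennreal (?w k) * ennreal (e k)"
      by (intro mult_left_mono D) auto
    also have "\<dots> = ennreal (?w k * e k)" by (simp add: ennreal_mult')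
    also have "?w k * e k = (1 / 2) ^ k"
    proof -
      have "e k = 2 powr (- (p + 1) * real k)"
        unfolding e_def by (subst powr_realpow[symmetric]) (simp_all add: powr_powr)
      then have "?w k * e k = 2 powr (p * real k + - (p + 1) * real k)" by (simp only: powr_add)
      also have "p * real k + - (p + 1) * real k = - real k" by (simp add: algebra_simps)
      also have "2 powr (- real k) = (1 / 2) ^ k" by (simp add: powr_minus powr_realpow power_one_over field_simps)
      finally show ?thesis .
    qed
    finally show "ennreal (?w k) * Lp_dist p (X (r (Suc k))) (X (r k)) \<le> ennreal ((1 / 2) ^ k)" .
  qed auto
  also have "\<dots> = ennreal (\<Sum>k. (1 / 2) ^ k)" by (intro suminf_ennreal2) (auto intro: summable_geometric)
  also have "\<dots> < \<infinity>" by simp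
  finally have "AE x in lborel. (\<Sum>k. ennreal (?w k) * ennreal (?d k x powr p)) \<noteq> \<infinity>"
    by (intro nn_integral_noteq_infinite) auto
  then have conv: "AE x in lborel. convergent (\<lambda>n. X (r n) x)"
  proof (rule AE_mp, intro AE_I2 impI)
    fix x assume fin: "(\<Sum>k. ennreal (?w k) * ennreal (?d k x powr p)) \<noteq> \<infinity>"
    define S where "S = enn2real (\<Sum>k. ennreal (?w k) * ennreal (?d k x powr p))"
    have S: "(\<Sum>k. ennreal (?w k) * ennreal (?d k x powr p)) = ennreal S" "0 \<le> S"
      using fin by (auto simp: S_def less_top)
    have b: "norm (X (r (Suc k)) x - X (r k) x) \<le> S powr (1 / p) * (1 / 2) ^ k" for k
    proof -
      have "ennreal (?w k * ?d k x powr p) = sum (\<lambda>k. ennreal (?w k) * ennreal (?d k x powr p)) {k}"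
        by (simp add: ennreal_mult')
      also have "\<dots> \<le> ennreal S" unfolding S(1)[symmetric] by (rule sum_le_suminf) auto
      finally have "?w k * ?d k x powr p \<le> S" using S(2) by (simp add: ennreal_le_iff)
      then have "(?w k * ?d k x powr p) powr (1 / p) \<le> S powr (1 / p)"
        using p by (intro powr_mono2) auto
      moreover have "(?w k * ?d k x powr p) powr (1 / p) = 2 ^ k * ?d k x"
        using p by (simp add: powr_mult powr_powr powr_realpow)
      ultimately show ?thesis by (simp add: power_one_over field_simps)
    qed
    have "summable (\<lambda>k. S powr (1 / p) * (1 / 2) ^ k)" by (intro summable_mult summable_geometric) simp
    then have "summable (\<lambda>k. X (r (Suc k)) x - X (r k) x)"
      by (rule summable_comparison_test'[where N = 0]) (use b in auto)
    then have "convergent (\<lambda>n. \<Sum>k<n. X (r (Suc k)) x - X (r k) x)"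
      by (simp add: summable_iff_convergent)
    then have "convergent (\<lambda>n. X (r n) x - X (r 0) x)" by (simp add: sum_lessThan_telescope[of "\<lambda>k. X (r k) x"])
    then show "convergent (\<lambda>n. X (r n) x)"
      using convergent_add[of "\<lambda>n. X (r n) x - X (r 0) x" "\<lambda>_. X (r 0) x"] by (simp add: convergent_const)
  qed
  define v where "v x = lim (\<lambda>n. X (r n) x)" for x
  have v [measurable]: "v \<in> borel_measurable borel"
    unfolding v_def by (rule borel_measurable_lim_metric) simp
  have lim: "AE x in lborel. (\<lambda>n. X (r n) x) \<longlonglongrightarrow> v x"
    using conv by eventually_elim (simp add: v_def convergent_LIMSEQ_iff)
  have bound: "Lp_dist p (X (r n)) v \<le> ennreal (e n)" for n
  proof -
    have "Lp_dist p (X (r n)) v = (\<integral>\<^sup>+x. liminf (\<lambda>m. ennreal (\<bar>X (r n) x - X (r m) x\<bar> powr p)) \<partial>lborel)"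
      unfolding Lp_dist_def
    proof (rule nn_integral_cong_AE, use lim in eventually_elim)
      fix x assume "(\<lambda>m. X (r m) x) \<longlonglongrightarrow> v x"
      then have "(\<lambda>m. ennreal (\<bar>X (r n) x - X (r m) x\<bar> powr p)) \<longlonglongrightarrow> ennreal (\<bar>X (r n) x - v x\<bar> powr p)"
        using p by (intro tendsto_ennrealI tendsto_powr' tendsto_intros) auto
      then show "ennreal (\<bar>X (r n) x - v x\<bar> powr p) = liminf (\<lambda>m. ennreal (\<bar>X (r n) x - X (r m) x\<bar> powr p))"
        by (intro lim_imp_Liminf[symmetric]) auto
    qed
    also have "\<dots> \<le> liminf (\<lambda>m. Lp_dist p (X (r n)) (X (r m)))"
      unfolding Lp_dist_def by (rule nn_integral_liminf) auto
    also have "\<dots> \<le> liminf (\<lambda>m. ennreal (e n))"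
      by (intro Liminf_mono eventually_sequentiallyI[of n] D) auto
    finally show ?thesis by (simp add: Liminf_const)
  qed
  have "e \<longlonglongrightarrow> 0" unfolding e_def using p by (intro LIMSEQ_power_zero) (simp add: powr_less_one)
  then have "(\<lambda>n. ennreal (e n)) \<longlonglongrightarrow> ennreal 0" by (rule tendsto_ennrealI)
  then have "(\<lambda>n. Lp_dist p (X (r n)) v) \<longlonglongrightarrow> 0"
    by (intro tendsto_sandwich[of "\<lambda>_. 0" "\<lambda>n. Lp_dist p (X (r n)) v" sequentially "\<lambda>n. ennreal (e n)"] always_eventually allI)
      (simp_all add: bound)
  then show ?thesis using that[OF r v _ lim] by blast
qed

text \<open>
  The map is constant exactly on the half-open cubes of side \<open>h\<close> of the grid \<open>h \<int>\<^sup>N\<close>; its value is the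
  integer corner of the cube, before multiplication by \<open>h\<close>.
\<close>

definition cell :: "real \<Rightarrow> 'a::euclidean_space \<Rightarrow> 'a" where
  "cell h x = (\<Sum>b\<in>Basis. real_of_int \<lfloor>x \<bullet> b / h\<rfloor> *\<^sub>R b)"

lemma cell_measurable [measurable]: "cell h \<in> borel_measurable borel"
  unfolding cell_def by measurable

lemma cell_inner: "b \<in> Basis \<Longrightarrow> cell h x \<bullet> b = real_of_int \<lfloor>x \<bullet> b / h\<rfloor>"
  unfolding cell_def by (simp add: inner_sum_left inner_Basis if_distrib cong: if_cong)

lemma countable_range_cell: "countable (range (cell h :: 'a::euclidean_space \<Rightarrow> 'a))"
proof (rule countable_subset)
  show "range (cell h :: 'a \<Rightarrow> 'a) \<subseteq> (\<lambda>f. \<Sum>b\<in>Basis. real_of_int (f b) *\<^sub>R b) ` (Basis \<rightarrow>\<^sub>E UNIV)"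
  proof clarify
    fix x :: 'a
    show "cell h x \<in> (\<lambda>f. \<Sum>b\<in>Basis. real_of_int (f b) *\<^sub>R b) ` (Basis \<rightarrow>\<^sub>E UNIV)"
      by (rule image_eqI[where x = "\<lambda>b\<in>Basis. \<lfloor>x \<bullet> b / h\<rfloor>"]) (auto simp: cell_def)
  qed
qed (intro countable_image countable_PiE finite_Basis, simp)

lemma cell_eq_dist:
  fixes x y :: "'a::euclidean_space"
  assumes h: "0 < h" and eq: "cell h x = cell h y"
  shows "norm (x - y) \<le> real DIM('a) * h"
proof -
  have "norm (x - y) \<le> (\<Sum>b\<in>Basis. \<bar>(x - y) \<bullet> b\<bar>)" by (rule norm_le_l1)
  also have "\<dots> \<le> (\<Sum>b\<in>(Basis::'a set). h)"
  proof (rule sum_mono)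
    fix b :: 'a assume b: "b \<in> Basis"
    have "\<lfloor>x \<bullet> b / h\<rfloor> = \<lfloor>y \<bullet> b / h\<rfloor>" using arg_cong[OF eq, of "\<lambda>z. z \<bullet> b"] b by (simp add: cell_inner)
    then have "\<bar>x \<bullet> b / h - y \<bullet> b / h\<bar> \<le> 1" by linarith
    then show "\<bar>(x - y) \<bullet> b\<bar> \<le> h" using h by (simp add: inner_diff_left diff_divide_distrib[symmetric] abs_divide)
  qed
  finally show ?thesis by simp
qed

lemma emeasure_cell:
  fixes x :: "'a::euclidean_space"
  assumes h: "0 < h"
  shows "emeasure lborel {y. cell h y = cell h x} = ennreal (h ^ DIM('a))"
proof (rule antisym)
  define l where "l = h *\<^sub>R cell h x"
  define u where "u = l + h *\<^sub>R One"
  have lb: "l \<bullet> b = h * real_of_int \<lfloor>x \<bullet> b / h\<rfloor>" if "b \<in> Basis" for b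
    using that by (simp add: l_def cell_inner)
  have ub: "u \<bullet> b = l \<bullet> b + h" if "b \<in> Basis" for b
    using that by (simp add: u_def inner_add_left)
  have le: "l \<bullet> b \<le> u \<bullet> b" if "b \<in> Basis" for b
    using ub[OF that] h by linarith
  have eq: "cell h y = cell h x \<longleftrightarrow> (\<forall>b\<in>Basis. \<lfloor>y \<bullet> b / h\<rfloor> = \<lfloor>x \<bullet> b / h\<rfloor>)" for y
    unfolding euclidean_eq_iff[of "cell h y"] by (simp add: cell_inner)
  have bd: "h * real_of_int \<lfloor>y \<bullet> b / h\<rfloor> \<le> y \<bullet> b \<and> y \<bullet> b \<le> h * real_of_int \<lfloor>y \<bullet> b / h\<rfloor> + h" for y b :: 'a
  proof -
    have "real_of_int \<lfloor>y \<bullet> b / h\<rfloor> \<le> y \<bullet> b / h" "y \<bullet> b / h \<le> real_of_int \<lfloor>y \<bullet> b / h\<rfloor> + 1" by linarith+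
    moreover have "k \<le> c / h \<Longrightarrow> h * k \<le> c" "c / h \<le> k + 1 \<Longrightarrow> c \<le> h * k + h" for k c :: real
      using h by (simp_all add: field_simps)
    ultimately show ?thesis by blast
  qed
  have prod: "(\<Prod>b\<in>(Basis::'a set). (u - l) \<bullet> b) = h ^ DIM('a)"
    by (simp add: inner_diff_left ub)
  have "{y. cell h y = cell h x} \<subseteq> cbox l u"
  proof
    fix y assume "y \<in> {y. cell h y = cell h x}"
    then have "\<lfloor>y \<bullet> b / h\<rfloor> = \<lfloor>x \<bullet> b / h\<rfloor>" if "b \<in> Basis" for b
      using that eq by blast
    then have "l \<bullet> b \<le> y \<bullet> b \<and> y \<bullet> b \<le> u \<bullet> b" if "b \<in> Basis" for b
      using bd[of y b] that by (simp only: ub lb)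
    then show "y \<in> cbox l u" by (simp only: mem_box) blast
  qed
  then have "emeasure lborel {y. cell h y = cell h x} \<le> emeasure lborel (cbox l u)"
    by (rule emeasure_mono) simp
  also have "\<dots> = ennreal (h ^ DIM('a))" unfolding prod[symmetric] using le by (rule emeasure_lborel_cbox)
  finally show "emeasure lborel {y. cell h y = cell h x} \<le> ennreal (h ^ DIM('a))" .
  have sub: "box l u \<subseteq> {y. cell h y = cell h x}"
  proof
    fix y assume y: "y \<in> box l u"
    have "\<lfloor>y \<bullet> b / h\<rfloor> = \<lfloor>x \<bullet> b / h\<rfloor>" if b: "b \<in> Basis" for b
    proof -
      have "l \<bullet> b < y \<bullet> b" "y \<bullet> b < u \<bullet> b" using y b by (auto simp only: mem_box)
      then have "h * real_of_int \<lfloor>x \<bullet> b / h\<rfloor> < y \<bullet> b" "y \<bullet> b < h * real_of_int \<lfloor>x \<bullet> b / h\<rfloor> + h"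
        by (simp_all only: ub[OF b] lb[OF b])
      then show ?thesis using h by (intro floor_unique) (auto simp: field_simps)
    qed
    then show "y \<in> {y. cell h y = cell h x}" using eq by blast
  qed
  have "ennreal (h ^ DIM('a)) = emeasure lborel (box l u)"
    unfolding prod[symmetric] using le by (rule emeasure_lborel_box[symmetric])
  also have "\<dots> \<le> emeasure lborel {y. cell h y = cell h x}"
    using sub by (rule emeasure_mono) measurable
  finally show "ennreal (h ^ DIM('a)) \<le> emeasure lborel {y. cell h y = cell h x}" .
qed

definition cell_average :: "real \<Rightarrow> ('a::euclidean_space \<Rightarrow> real) \<Rightarrow> 'a \<Rightarrow> real" where
  "cell_average h u x = (LINT y|lborel. indicator {y. cell h y = cell h x} y * u y) / h ^ DIM('a)"

lemma cell_average_measurable [measurable]: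
  fixes u :: "'a::euclidean_space \<Rightarrow> real"
  assumes [measurable]: "u \<in> borel_measurable borel"
  shows "cell_average h u \<in> borel_measurable borel"
proof -
  have "(\<lambda>x. (LINT y|lborel. (if cell h y = cell h x then u y else 0)) / h ^ DIM('a)) \<in> borel_measurable borel"
    by measurable
  also have "(\<lambda>x. (LINT y|lborel. (if cell h y = cell h x then u y else 0)) / h ^ DIM('a)) = cell_average h u"
    unfolding cell_average_def by (intro ext arg_cong2[where f = "(/)"] Bochner_Integration.integral_cong) (auto simp: indicator_def)
  finally show ?thesis .
qed

text \<open>
  Jensen's inequality for the average over the cell of \<open>x\<close>: integrate the tangent inequality at the
  point \<open>u x - cell_average h u x\<close> over the cell, where the linear term has mean zero.
\<close>

lemma cell_average_error:
  fixes u :: "'a::euclidean_space \<Rightarrow> real"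
  assumes [measurable]: "u \<in> borel_measurable borel" and p: "1 < p" and h: "0 < h"
    and u1: "integrable lborel u" and up: "integrable lborel (\<lambda>x. \<bar>u x\<bar> powr p)"
  shows "ennreal (h ^ DIM('a)) * ennreal (\<bar>u x - cell_average h u x\<bar> powr p)
    \<le> (\<integral>\<^sup>+y. ennreal (indicator {y. cell h y = cell h x} y * \<bar>u x - u y\<bar> powr p) \<partial>lborel)"
proof -
  let ?A = "{y. cell h y = cell h x}" and ?V = "h ^ DIM('a)" and ?m = "cell_average h u x"
  let ?a = "u x - ?m"
  have A [measurable]: "?A \<in> sets lborel" by measurable
  have V: "0 < ?V" using h by simp
  have mA: "measure lborel ?A = ?V" using emeasure_cell[OF h, of x] V by (simp add: measure_def)
  have iA: "integrable lborel (\<lambda>y. indicator ?A y :: real)"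
    using emeasure_cell[OF h, of x] by (intro integrable_real_indicator A) simp
  have iu: "integrable lborel (\<lambda>y. indicator ?A y * u y)"
    using integrable_mult_indicator[OF A u1] by simp
  have ip: "integrable lborel (\<lambda>y. indicator ?A y * \<bar>u x - u y\<bar> powr p)"
  proof (rule Bochner_Integration.integrable_bound)
    show "integrable lborel (\<lambda>y. 2 powr p * (indicator ?A y * \<bar>u x\<bar> powr p + \<bar>u y\<bar> powr p))"
      using iA up by auto
    show "AE y in lborel. norm (indicator ?A y * \<bar>u x - u y\<bar> powr p) \<le> norm (2 powr p * (indicator ?A y * \<bar>u x\<bar> powr p + \<bar>u y\<bar> powr p))"
      using abs_diff_powr_le[of p "u x" "u _"] p by (intro AE_I2) (auto simp: indicator_def)
  qed measurable
  have um: "(LINT y|lborel. indicator ?A y * u y) = ?V * ?m" using h by (simp add: cell_average_def)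
  let ?t = "\<lambda>y. (\<bar>?a\<bar> powr p + p * spow p ?a * ?m) * indicator ?A y - p * spow p ?a * (indicator ?A y * u y)"
  have "?V * \<bar>?a\<bar> powr p = (\<bar>?a\<bar> powr p + p * spow p ?a * ?m) * ?V - p * spow p ?a * (?V * ?m)"
    by (simp add: algebra_simps)
  also have "\<dots> = (LINT y|lborel. ?t y)"
    using iA iu by (simp add: um mA)
  also have "\<dots> \<le> (LINT y|lborel. indicator ?A y * \<bar>u x - u y\<bar> powr p)"
  proof (rule integral_mono)
    fix y
    have "\<bar>?a\<bar> powr p + p * spow p ?a * ((u x - u y) - ?a) \<le> \<bar>u x - u y\<bar> powr p"
      by (rule powr_tangent[OF p])
    then show "?t y \<le> indicator ?A y * \<bar>u x - u y\<bar> powr p"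
      by (cases "y \<in> ?A") (auto simp: algebra_simps)
  qed (use iA iu ip in auto)
  finally have "ennreal (?V * \<bar>?a\<bar> powr p) \<le> ennreal (LINT y|lborel. indicator ?A y * \<bar>u x - u y\<bar> powr p)"
    by (rule ennreal_leI)
  also have "\<dots> = (\<integral>\<^sup>+y. ennreal (indicator ?A y * \<bar>u x - u y\<bar> powr p) \<partial>lborel)"
    using ip by (intro nn_integral_eq_integral[symmetric]) auto
  finally show ?thesis using V by (simp add: ennreal_mult')
qed

text \<open>
  Two points of one cell have distance at most \<open>N h\<close>, so on that cell \<open>1\<close> is bounded by \<open>(N h)\<^sup>N\<^sup>+\<^sup>\<sigma>\<close> times the
  kernel. Dividing by the volume \<open>h\<^sup>N\<close> of the cell leaves the factor \<open>h\<^sup>\<sigma>\<close>, which tends to zero with \<open>h\<close>.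
\<close>

lemma cell_average_Lp_error:
  fixes u :: "'a::euclidean_space \<Rightarrow> real"
  assumes [measurable]: "u \<in> borel_measurable borel" and p: "1 < p" and h: "0 < h"
    and u1: "integrable lborel u" and up: "integrable lborel (\<lambda>x. \<bar>u x\<bar> powr p)"
    and \<sigma>: "0 < \<sigma>" and \<delta>: "real DIM('a) * h < \<delta>"
  shows "Lp_dist p u (cell_average h u)
    \<le> ennreal (real DIM('a) powr (real DIM('a) + \<sigma>) * h powr \<sigma>) * energy p (\<lambda>z. indicator {..<\<delta>} (norm z) * rker \<sigma> z) u"
proof -
  let ?N = "real DIM('a)" and ?V = "h ^ DIM('a)"
  let ?k = "\<lambda>z::'a. indicator {..<\<delta>} (norm z) * rker \<sigma> z"
  let ?c = "(?N * h) powr (?N + \<sigma>)"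
  have V: "0 < ?V" using h by simp
  have "ennreal ?V * Lp_dist p u (cell_average h u) = (\<integral>\<^sup>+x. ennreal ?V * ennreal (\<bar>u x - cell_average h u x\<bar> powr p) \<partial>lborel)"
    unfolding Lp_dist_def by (rule nn_integral_cmult[symmetric]) measurable
  also have "\<dots> \<le> (\<integral>\<^sup>+x. \<integral>\<^sup>+y. ennreal (indicator {y. cell h y = cell h x} y * \<bar>u x - u y\<bar> powr p) \<partial>lborel \<partial>lborel)"
    by (intro nn_integral_mono cell_average_error[OF _ p h u1 up]) measurable
  also have "\<dots> \<le> (\<integral>\<^sup>+x. \<integral>\<^sup>+y. ennreal ?c * ennreal (\<bar>u x - u y\<bar> powr p * ?k (x - y)) \<partial>lborel \<partial>lborel)"
  proof (intro nn_integral_mono)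
    fix x y :: 'a
    have "indicator {y. cell h y = cell h x} y * \<bar>u x - u y\<bar> powr p \<le> ?c * (\<bar>u x - u y\<bar> powr p * ?k (x - y))"
    proof (cases "cell h y = cell h x \<and> x \<noteq> y")
      case True
      have le: "norm (x - y) \<le> ?N * h" using cell_eq_dist[OF h] True by metis
      have "norm (x - y) powr (?N + \<sigma>) \<le> ?c" using le \<sigma> by (intro powr_mono2) auto
      then have "1 \<le> ?c * rker \<sigma> (x - y)" using True by (simp add: rker_def divide_simps)
      then have "1 * \<bar>u x - u y\<bar> powr p \<le> (?c * rker \<sigma> (x - y)) * \<bar>u x - u y\<bar> powr p"
        by (intro mult_right_mono) auto
      then show ?thesis using True le \<delta> by (simp add: mult_ac)
    next
      case False
      then show ?thesis by (auto simp: indicator_def)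
    qed
    then show "ennreal (indicator {y. cell h y = cell h x} y * \<bar>u x - u y\<bar> powr p) \<le> ennreal ?c * ennreal (\<bar>u x - u y\<bar> powr p * ?k (x - y))"
      by (simp only: ennreal_mult'[symmetric] powr_ge_zero ennreal_leI)
  qed
  also have "\<dots> = (\<integral>\<^sup>+z. ennreal ?c * (case z of (x, y) \<Rightarrow> ennreal (\<bar>u x - u y\<bar> powr p * ?k (x - y))) \<partial>lborel2)"
    by (subst lborel.nn_integral_fst[symmetric]) auto
  also have "\<dots> = ennreal ?c * energy p ?k u"
    unfolding energy_def by (rule nn_integral_cmult) measurable
  finally have le: "ennreal ?V * Lp_dist p u (cell_average h u) \<le> ennreal ?c * energy p ?k u" .
  have "Lp_dist p u (cell_average h u) = ennreal (1 / ?V) * (ennreal ?V * Lp_dist p u (cell_average h u))"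
    using h by (simp add: mult.assoc[symmetric] ennreal_mult'[symmetric])
  also have "\<dots> \<le> ennreal (1 / ?V) * (ennreal ?c * energy p ?k u)" by (intro mult_left_mono le) simp
  also have "\<dots> = ennreal (1 / ?V * ?c) * energy p ?k u"
    using V by (subst ennreal_mult') (auto simp: mult.assoc)
  also have "1 / ?V * ?c = ?N powr (?N + \<sigma>) * h powr \<sigma>"
    using h by (simp add: powr_mult powr_add powr_realpow)
  finally show ?thesis .
qed

lemma Lp_supported_integrable:
  fixes u :: "'a::euclidean_space \<Rightarrow> real"
  assumes [measurable]: "u \<in> borel_measurable borel" "\<Omega> \<in> sets borel" and bd: "bounded \<Omega>"
    and zero: "AE x in lborel. x \<notin> \<Omega> \<longrightarrow> u x = 0" and p: "1 < p" and up: "integrable lborel (\<lambda>x. \<bar>u x\<bar> powr p)"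
  shows "integrable lborel u" "(LINT x|lborel. \<bar>u x\<bar>) \<le> measure lborel \<Omega> + (LINT x|lborel. \<bar>u x\<bar> powr p)"
proof -
  have i: "integrable lborel (indicator \<Omega> :: 'a \<Rightarrow> real)"
    using emeasure_bounded_finite[OF bd] by (intro integrable_real_indicator) auto
  have le: "AE x in lborel. \<bar>u x\<bar> \<le> indicator \<Omega> x + \<bar>u x\<bar> powr p"
    using zero
  proof eventually_elim
    fix x assume z: "x \<notin> \<Omega> \<longrightarrow> u x = 0"
    have "\<bar>u x\<bar> \<le> 1 + \<bar>u x\<bar> powr p"
    proof (cases "\<bar>u x\<bar> \<le> 1")
      case False
      then have "\<bar>u x\<bar> powr 1 \<le> \<bar>u x\<bar> powr p" using p by (intro powr_mono) auto
      then show ?thesis using False by simp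
    qed (simp add: add_increasing2)
    then show "\<bar>u x\<bar> \<le> indicator \<Omega> x + \<bar>u x\<bar> powr p" using z by (cases "x \<in> \<Omega>") auto
  qed
  show int: "integrable lborel u"
  proof (rule Bochner_Integration.integrable_bound)
    show "integrable lborel (\<lambda>x. indicator \<Omega> x + \<bar>u x\<bar> powr p)" using i up by (rule Bochner_Integration.integrable_add)
    show "AE x in lborel. norm (u x) \<le> norm (indicator \<Omega> x + \<bar>u x\<bar> powr p)" using le by eventually_elim simp
  qed measurable
  have "(LINT x|lborel. \<bar>u x\<bar>) \<le> (LINT x|lborel. indicator \<Omega> x + \<bar>u x\<bar> powr p)"
    using int i up le by (intro integral_mono_AE) auto
  also have "\<dots> = measure lborel \<Omega> + (LINT x|lborel. \<bar>u x\<bar> powr p)"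
    using i up by simp
  finally show "(LINT x|lborel. \<bar>u x\<bar>) \<le> measure lborel \<Omega> + (LINT x|lborel. \<bar>u x\<bar> powr p)" .
qed

lemma abs_integral_indicator_le:
  fixes u :: "'a::euclidean_space \<Rightarrow> real"
  assumes "integrable lborel u" "A \<in> sets borel"
  shows "\<bar>LINT y|lborel. indicator A y * u y\<bar> \<le> (LINT y|lborel. \<bar>u y\<bar>)"
proof -
  have "\<bar>LINT y|lborel. indicator A y * u y\<bar> \<le> (LINT y|lborel. \<bar>indicator A y * u y\<bar>)"
    by (rule integral_abs_bound)
  also have "\<dots> \<le> (LINT y|lborel. \<bar>u y\<bar>)"
  proof (rule integral_mono)
    show "integrable lborel (\<lambda>y. \<bar>indicator A y * u y\<bar>)"
      using assms integrable_mult_indicator[of A lborel u] by (intro integrable_abs) auto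
  qed (use assms in \<open>auto simp: abs_mult indicator_def\<close>)
  finally show ?thesis .
qed

lemma abs_cell_average_le:
  fixes u :: "'a::euclidean_space \<Rightarrow> real"
  assumes "integrable lborel u" "0 < h" "(LINT y|lborel. \<bar>u y\<bar>) \<le> M"
  shows "\<bar>cell_average h u x\<bar> \<le> M / h ^ DIM('a)"
proof -
  have "\<bar>LINT y|lborel. indicator {y. cell h y = cell h x} y * u y\<bar> \<le> M"
    by (rule order_trans[OF abs_integral_indicator_le[OF assms(1)] assms(3)]) measurable
  then show ?thesis using assms(2) by (simp add: cell_average_def abs_divide divide_right_mono)
qed

lemma cell_average_eq_0:
  fixes u :: "'a::euclidean_space \<Rightarrow> real"
  assumes [measurable]: "u \<in> borel_measurable borel" and h: "0 < h"
    and zero: "AE y in lborel. y \<notin> \<Omega> \<longrightarrow> u y = 0" and R: "\<Omega> \<subseteq> ball 0 R" and x: "R + real DIM('a) * h \<le> norm x"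
  shows "cell_average h u x = 0"
proof -
  have "(LINT y|lborel. indicator {y. cell h y = cell h x} y * u y) = (LINT y::'a|lborel. 0)"
  proof (intro integral_cong_AE)
    show "AE y in lborel. indicator {y. cell h y = cell h x} y * u y = 0"
      using zero
    proof eventually_elim
      fix y assume z: "y \<notin> \<Omega> \<longrightarrow> u y = 0"
      show "indicator {y. cell h y = cell h x} y * u y = 0"
      proof (cases "y \<in> \<Omega>")
        case True
        then have "norm y < R" using R by auto
        then have "real DIM('a) * h < norm (y - x)"
          using x norm_triangle_ineq2[of x y] by (simp add: norm_minus_commute)
        then have "cell h y \<noteq> cell h x" using cell_eq_dist[OF h, of y x] by linarith
        then show ?thesis by simp
      qed (use z in simp)
    qed
  qed measurable
  then show ?thesis by (simp add: cell_average_def)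
qed

lemma abs_diff_powr_measurable:
  fixes f g :: "'a::euclidean_space \<Rightarrow> real"
  assumes [measurable]: "f \<in> borel_measurable borel" "g \<in> borel_measurable borel"
  shows "(\<lambda>x. ennreal (\<bar>f x - g x\<bar> powr p)) \<in> borel_measurable lborel"
  by measurable

text \<open>
  The compact embedding. A bound on the part of the energy near the diagonal makes the functions
  uniformly close to their averages over a fine grid, and for each cell of each grid they
  form a bounded sequence of numbers. A diagonal subsequence makes all of them converge, for all grids
  at once, and such a subsequence is Cauchy in \<open>L\<^sup>p\<close>.
\<close>

theorem Lp_compactness:
  fixes u :: "nat \<Rightarrow> 'a::euclidean_space \<Rightarrow> real"
  assumes [measurable]: "\<And>n. u n \<in> borel_measurable borel" "\<Omega> \<in> sets borel" and bd: "bounded \<Omega>" and p: "1 < p"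
    and zero: "\<And>n. AE x in lborel. x \<notin> \<Omega> \<longrightarrow> u n x = 0"
    and up: "\<And>n. integrable lborel (\<lambda>x. \<bar>u n x\<bar> powr p)" and M: "\<And>n. (LINT x|lborel. \<bar>u n x\<bar> powr p) \<le> M"
    and \<delta>: "0 < \<delta>" and \<sigma>: "0 < \<sigma>"
    and E: "\<And>n. energy p (\<lambda>z. indicator {..<\<delta>} (norm z) * rker \<sigma> z) (u n) \<le> ennreal E"
  obtains r v where "strict_mono r" "v \<in> borel_measurable borel"
    "(\<lambda>n. Lp_dist p (u (r n)) v) \<longlonglongrightarrow> 0" "AE x in lborel. (\<lambda>n. u (r n) x) \<longlonglongrightarrow> v x"
proof -
  let ?N = "real DIM('a)"
  obtain R where R: "0 < R" "\<Omega> \<subseteq> ball 0 R" using bounded_subset_ballD[OF bd] by blast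
  define M0 where "M0 = measure lborel \<Omega> + M"
  have u1: "integrable lborel (u n)" and M0: "(LINT x|lborel. \<bar>u n x\<bar>) \<le> M0" for n
    using Lp_supported_integrable[OF _ _ bd zero p up, of n] M[of n] by (auto simp: M0_def)
  \<comment> \<open>side lengths for which cells have diameter below \<open>\<delta>\<close>\<close>
  define h where "h k = \<delta> / ((?N + 1) * (real k + 1))" for k :: nat
  have h0: "0 < h k" for k unfolding h_def using \<delta> by (intro divide_pos_pos mult_pos_pos) auto
  have hN: "?N * h k < \<delta>" for k
  proof -
    have "?N < (?N + 1) * (real k + 1)" by (simp add: algebra_simps add_pos_nonneg)
    then have "?N * \<delta> < (?N + 1) * (real k + 1) * \<delta>" using \<delta> by (intro mult_strict_right_mono) auto
    moreover have "0 < (?N + 1) * (real k + 1)" by (intro mult_pos_pos) auto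
    ultimately show ?thesis unfolding h_def by (simp add: divide_less_eq mult.commute)
  qed
  define Err where "Err k = ?N powr (?N + \<sigma>) * h k powr \<sigma> * max 0 E" for k
  have Err: "Lp_dist p (u n) (cell_average (h k) (u n)) \<le> ennreal (Err k)" for n k
  proof -
    have "Lp_dist p (u n) (cell_average (h k) (u n)) \<le> ennreal (?N powr (?N + \<sigma>) * h k powr \<sigma>) * ennreal (max 0 E)"
      using E[of n] by (intro order_trans[OF cell_average_Lp_error[OF _ p h0 u1 up \<sigma> hN]] mult_left_mono)
        (auto simp: max_def ennreal_neg)
    then show ?thesis by (simp add: Err_def ennreal_mult')
  qed
  have Err0: "Err \<longlonglongrightarrow> 0"
  proof -
    have "(\<lambda>k. \<delta> / (?N + 1) * inverse (real (Suc k))) \<longlonglongrightarrow> \<delta> / (?N + 1) * 0"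
      by (intro tendsto_mult tendsto_const LIMSEQ_inverse_real_of_nat)
    moreover have "h = (\<lambda>k. \<delta> / (?N + 1) * inverse (real (Suc k)))"
      by (auto simp: h_def fun_eq_iff field_simps)
    ultimately have "h \<longlonglongrightarrow> 0" by simp
    then have "(\<lambda>k. h k powr \<sigma>) \<longlonglongrightarrow> 0 powr \<sigma>"
      using \<sigma> h0 by (intro tendsto_powr' tendsto_const) (auto intro!: always_eventually less_imp_le)
    then have "(\<lambda>k. ?N powr (?N + \<sigma>) * h k powr \<sigma> * max 0 E) \<longlonglongrightarrow> ?N powr (?N + \<sigma>) * 0 powr \<sigma> * max 0 E"
      by (intro tendsto_mult tendsto_const)
    then show ?thesis unfolding Err_def using \<sigma> by simp
  qed
  \<comment> \<open>the index set of the diagonal argument: all cells of all grids\<close>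
  define S where "S = (SIGMA k:UNIV. range (cell (h k) :: 'a \<Rightarrow> 'a))"
  define f where "f n = (\<lambda>(k, c). LINT y|lborel. indicator {y. cell (h k) y = c} y * u n y)" for n
  have "countable S" unfolding S_def by (intro countable_SIGMA countable_range_cell) auto
  moreover have "norm (f n z) \<le> M0" if "z \<in> S" for n z
  proof (cases z)
    case (Pair k c)
    show ?thesis unfolding f_def Pair
      using order_trans[OF abs_integral_indicator_le[OF u1] M0, of "{y. cell (h k) y = c}"] by simp
  qed
  ultimately obtain r where r: "strict_mono (r :: nat \<Rightarrow> nat)" and rl: "\<And>z. z \<in> S \<Longrightarrow> \<exists>l. (\<lambda>n. f (r n) z) \<longlonglongrightarrow> l"
    using function_convergent_subsequence[of S f M0] by blast
  let ?P = "\<lambda>k n. cell_average (h k) (u (r n))"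
  define g where "g k x = lim (\<lambda>n. ?P k n x)" for k x
  have g: "(\<lambda>n. ?P k n x) \<longlonglongrightarrow> g k x" for k x
  proof -
    have "(k, cell (h k) x) \<in> S" by (auto simp: S_def)
    from rl[OF this] obtain l where "(\<lambda>n. f (r n) (k, cell (h k) x)) \<longlonglongrightarrow> l" by blast
    then have "(\<lambda>n. ?P k n x) \<longlonglongrightarrow> l / h k ^ DIM('a)"
      unfolding f_def prod.case cell_average_def using h0[of k] by (intro tendsto_divide tendsto_const) auto
    then show ?thesis unfolding g_def by (simp add: limI)
  qed
  have gm [measurable]: "g k \<in> borel_measurable borel" for k
    unfolding g_def by (rule borel_measurable_lim_metric) measurable
  have g_lim: "(\<lambda>n. Lp_dist p (?P k n) (g k)) \<longlonglongrightarrow> 0" for k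
  proof -
    define V where "V = M0 / h k ^ DIM('a)"
    define Q where "Q = R + ?N * h k"
    let ?w = "\<lambda>x. ennreal ((2 * V) powr p) * indicator (ball 0 Q) (x::'a)"
    have Pm: "?P k n \<in> borel_measurable borel" for n by (rule cell_average_measurable) simp
    have m1: "(\<lambda>x. ennreal (\<bar>?P k n x - g k x\<bar> powr p)) \<in> borel_measurable lborel" for n
      by (rule abs_diff_powr_measurable[OF Pm gm])
    have m2: "?w \<in> borel_measurable lborel"
      by (intro borel_measurable_times_ennreal borel_measurable_const borel_measurable_indicator) simp
    have "(\<lambda>n. (\<integral>\<^sup>+x. ennreal (\<bar>?P k n x - g k x\<bar> powr p) \<partial>lborel)) \<longlonglongrightarrow> (\<integral>\<^sup>+x. 0 \<partial>(lborel :: 'a measure))"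
    proof (rule nn_integral_dominated_convergence[where w = ?w and u' = "\<lambda>_. 0"
        and u = "\<lambda>n x. ennreal (\<bar>?P k n x - g k x\<bar> powr p)"])
      have bP: "\<bar>?P k n x\<bar> \<le> V" for n x unfolding V_def by (rule abs_cell_average_le[OF u1 h0 M0])
      then have bg: "\<bar>g k x\<bar> \<le> V" for x
        by (intro LIMSEQ_le_const2[OF tendsto_rabs[OF g]]) auto
      show "AE x in lborel. ennreal (\<bar>?P k n x - g k x\<bar> powr p) \<le> ?w x" for n
      proof (intro AE_I2)
        fix x :: 'a
        show "ennreal (\<bar>?P k n x - g k x\<bar> powr p) \<le> ?w x"
        proof (cases "norm x < Q")
          case True
          have "\<bar>?P k n x - g k x\<bar> \<le> 2 * V" using bP[of n x] bg[of x] by linarith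
          then have "\<bar>?P k n x - g k x\<bar> powr p \<le> (2 * V) powr p" using p by (intro powr_mono2) auto
          then show ?thesis using True by (simp add: ennreal_leI)
        next
          case False
          then have z: "?P k m x = 0" for m
            using cell_average_eq_0[OF _ h0 zero R(2), of "r m" k x] by (simp add: Q_def)
          then have "g k x = 0" using LIMSEQ_unique[OF g[of k x], of 0] by simp
          then show ?thesis using z by simp
        qed
      qed
      have "(\<integral>\<^sup>+x. ?w x \<partial>lborel) = ennreal ((2 * V) powr p) * emeasure lborel (ball (0::'a) Q)"
        by (intro nn_integral_cmult_indicator) simp
      also have "\<dots> < \<infinity>" using emeasure_lborel_ball_finite[of "0::'a" Q] by (simp add: ennreal_mult_less_top)
      finally show "(\<integral>\<^sup>+x. ?w x \<partial>lborel) < \<infinity>" .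
      show "AE x in lborel. (\<lambda>n. ennreal (\<bar>?P k n x - g k x\<bar> powr p)) \<longlonglongrightarrow> 0"
      proof (intro AE_I2)
        fix x
        have "(\<lambda>n. \<bar>?P k n x - g k x\<bar>) \<longlonglongrightarrow> \<bar>g k x - g k x\<bar>"
          by (intro tendsto_intros g)
        then have "(\<lambda>n. \<bar>?P k n x - g k x\<bar> powr p) \<longlonglongrightarrow> \<bar>g k x - g k x\<bar> powr p"
          using p by (intro tendsto_powr' tendsto_const) auto
        from tendsto_ennrealI[OF this] show "(\<lambda>n. ennreal (\<bar>?P k n x - g k x\<bar> powr p)) \<longlonglongrightarrow> 0" by simp
      qed
    qed (rule m1 m2 measurable_const, (simp; fail)?)+
    then show ?thesis by (simp add: Lp_dist_def)
  qed
  have Cauchy: "\<exists>N. \<forall>m\<ge>N. \<forall>n\<ge>N. Lp_dist p (u (r m)) (u (r n)) \<le> ennreal \<epsilon>" if \<epsilon>: "0 < \<epsilon>" for \<epsilon>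
  proof -
    let ?c = "2 powr p"
    \<comment> \<open>the triangle inequality with constant \<open>?c\<close> is applied twice, to four terms of size at most \<open>\<eta>\<close>\<close>
    define \<eta> where "\<eta> = \<epsilon> / (4 * ?c * ?c)"
    have \<eta>: "0 < \<eta>" using \<epsilon> by (simp add: \<eta>_def)
    obtain k where k: "Err k < \<eta>"
      using order_tendstoD(2)[OF Err0 \<eta>] by (auto simp: eventually_sequentially)
    obtain N where N: "\<And>n. N \<le> n \<Longrightarrow> Lp_dist p (?P k n) (g k) < ennreal \<eta>"
      using order_tendstoD(2)[OF g_lim[of k], of "ennreal \<eta>"] \<eta> by (auto simp: eventually_sequentially)
    have 1: "Lp_dist p (u (r n)) (g k) \<le> ennreal (?c * (\<eta> + \<eta>))" if "N \<le> n" for n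
    proof -
      have "Lp_dist p (u (r n)) (g k) \<le> ennreal ?c * (Lp_dist p (u (r n)) (?P k n) + Lp_dist p (?P k n) (g k))"
        using p by (intro Lp_dist_triangle) auto
      also have "\<dots> \<le> ennreal ?c * (ennreal \<eta> + ennreal \<eta>)"
        using N[OF that] order_trans[OF Err ennreal_leI[OF less_imp_le[OF k]], of "r n"]
        by (intro mult_left_mono add_mono) auto
      also have "\<dots> = ennreal (?c * (\<eta> + \<eta>))"
        using \<eta> by (simp add: ennreal_mult'[symmetric] ennreal_plus[symmetric] del: ennreal_plus)
      finally show ?thesis .
    qed
    have "Lp_dist p (u (r m)) (u (r n)) \<le> ennreal \<epsilon>" if "N \<le> m" "N \<le> n" for m n
    proof -
      have "Lp_dist p (u (r m)) (u (r n)) \<le> ennreal ?c * (Lp_dist p (u (r m)) (g k) + Lp_dist p (u (r n)) (g k))"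
        using p Lp_dist_triangle[of "u (r m)" "g k" "u (r n)" p] by (simp add: Lp_dist_commute[of p "u (r n)"])
      also have "\<dots> \<le> ennreal ?c * (ennreal (?c * (\<eta> + \<eta>)) + ennreal (?c * (\<eta> + \<eta>)))"
        using 1 that by (intro mult_left_mono add_mono) auto
      also have "\<dots> = ennreal (?c * (?c * (\<eta> + \<eta>) + ?c * (\<eta> + \<eta>)))"
        using \<eta> by (simp add: ennreal_mult'[symmetric] ennreal_plus[symmetric] del: ennreal_plus)
      also have "?c * (?c * (\<eta> + \<eta>) + ?c * (\<eta> + \<eta>)) = \<epsilon>" by (simp add: \<eta>_def)
      finally show ?thesis .
    qed
    then show ?thesis by blast
  qed
  obtain r' v where r': "strict_mono r'" "v \<in> borel_measurable borel"
    "(\<lambda>n. Lp_dist p (u (r (r' n))) v) \<longlonglongrightarrow> 0" "AE x in lborel. (\<lambda>n. u (r (r' n)) x) \<longlonglongrightarrow> v x"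
    using p by (rule Lp_Cauchy_subseq[of p "\<lambda>n. u (r n)", OF less_trans[OF zero_less_one] _ Cauchy]) auto
  show ?thesis
    by (rule that[of "r \<circ> r'" v]) (use r r' in \<open>auto intro: strict_mono_o\<close>)
qed

section \<open>Existence of extremal functions\<close>

context log_problem begin

text \<open>
  The radius \<open>\<delta>0\<close> is so small that the full kernel dominates \<open>c0 W\<close> inside it, whatever the sign of \<open>B\<close>;
  outside of it the kernel is integrable.
\<close>

definition c0 :: real where "c0 = C * p / 4"
definition \<delta>0 :: real where "\<delta>0 = exp (- (1 + 2 * \<bar>B\<bar> / p))"
definition far :: "'a \<Rightarrow> real" where "far z = indicator {\<delta>0..} (norm z) * \<bar>K z\<bar>"
definition far_mass :: real where "far_mass = 2 * 2 powr p * (LINT z|lborel. far z)"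

lemma c0_pos: "0 < c0" and \<delta>0_pos: "0 < \<delta>0"
  using Cpos p0 by (auto simp: c0_def \<delta>0_def)

lemma K_ge_W_near:
  assumes "norm z < \<delta>0" shows "c0 * W z \<le> K z"
proof (cases "z = 0")
  case True then show ?thesis by (simp add: logker_def K_eq)
next
  case False
  then have "ln (norm z) < ln \<delta>0" using assms \<delta>0_pos by (subst ln_less_cancel_iff) auto
  then have L: "1 + 2 * \<bar>B\<bar> / p < - ln (norm z)" by (simp add: \<delta>0_def)
  moreover have "0 \<le> 2 * \<bar>B\<bar> / p" using p0 by simp
  ultimately have neg: "ln (norm z) < 0" by linarith
  have "p * (1 + 2 * \<bar>B\<bar> / p) \<le> p * (- ln (norm z))" using L p0 by (intro mult_left_mono) auto
  moreover have "p * (1 + 2 * \<bar>B\<bar> / p) = p + 2 * \<bar>B\<bar>" using p0 by (simp add: field_simps)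
  ultimately have "p + 2 * \<bar>B\<bar> \<le> - p * ln (norm z)" by simp
  then have "p * (1 - ln (norm z)) \<le> 2 * (B - p * ln (norm z))" 
    by (simp add: right_diff_distrib)
  then have "C / 4 * (p * (1 - ln (norm z))) \<le> C / 4 * (2 * (B - p * ln (norm z)))"
    using Cpos by (intro mult_left_mono) auto
  then have "C / 4 * (p * (1 - ln (norm z))) * rker (s * p) z \<le> C / 4 * (2 * (B - p * ln (norm z))) * rker (s * p) z"
    by (rule mult_right_mono) simp
  moreover have "c0 * W z = C / 4 * (p * (1 - ln (norm z))) * rker (s * p) z"
    using neg by (simp add: logker_def c0_def)
  moreover have "K z = C / 4 * (2 * (B - p * ln (norm z))) * rker (s * p) z"
    by (simp add: K_eq)
  ultimately show ?thesis by simp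
qed

lemma far_measurable [measurable]: "far \<in> borel_measurable borel"
  unfolding far_def by measurable

lemma far_nonneg: "0 \<le> far z"
  by (simp add: far_def)

lemma far_minus: "far (- z) = far z"
  by (simp add: far_def kernel_log_minus)

lemma far_integrable: "integrable lborel far"
proof (rule integrableI_bounded)
  let ?c = "C / 2 * (\<bar>B\<bar> + p)"
  have "(\<integral>\<^sup>+z. norm (far z) \<partial>lborel) \<le> (\<integral>\<^sup>+z. ennreal ?c * ennreal (indicator {\<delta>0..} (norm z) * W z) \<partial>lborel)"
  proof (rule nn_integral_mono)
    fix z :: 'a
    have "norm (far z) \<le> ?c * (indicator {\<delta>0..} (norm z) * W z)"
      using abs_K_le_W[of z] by (auto simp: far_def indicator_def)
    then show "ennreal (norm (far z)) \<le> ennreal ?c * ennreal (indicator {\<delta>0..} (norm z) * W z)"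
      using K_const_nonneg by (simp add: ennreal_mult'[symmetric] ennreal_leI)
  qed
  also have "\<dots> = ennreal ?c * (\<integral>\<^sup>+z. ennreal (indicator {\<delta>0..} (norm z) * W z) \<partial>lborel)"
    by (rule nn_integral_cmult) measurable
  also have "\<dots> < \<infinity>"
    using logker_far_finite[OF sp0 \<delta>0_pos, where 'a='a] by (simp add: ennreal_mult_less_top)
  finally show "(\<integral>\<^sup>+z. norm (far z) \<partial>lborel) < \<infinity>" .
qed measurable

text \<open>
  The integrand of the energy plus a correction that makes it nonnegative. For functions of unit mass
  the integral of the correction is a constant, so Fatou's lemma applied to this integrand gives the
  lower semicontinuity of the energy, although the kernel changes sign.
\<close>

definition coercive :: "('a \<Rightarrow> real) \<Rightarrow> 'a \<times> 'a \<Rightarrow> real" where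
  "coercive u = (\<lambda>(x, y). \<bar>u x - u y\<bar> powr p * K (x - y)
     + (2 powr p * \<bar>u x\<bar> powr p * far (x - y) + 2 powr p * \<bar>u y\<bar> powr p * far (x - y)))"

lemma coercive_ge: "c0 * (\<bar>u x - u y\<bar> powr p * (indicator {..<\<delta>0} (norm (x - y)) * W (x - y))) \<le> coercive u (x, y)"
proof (cases "norm (x - y) < \<delta>0")
  case True
  have "\<bar>u x - u y\<bar> powr p * (c0 * W (x - y)) \<le> \<bar>u x - u y\<bar> powr p * K (x - y)"
    by (intro mult_left_mono K_ge_W_near True) auto
  moreover have "0 \<le> 2 powr p * \<bar>u x\<bar> powr p * far (x - y)" "0 \<le> 2 powr p * \<bar>u y\<bar> powr p * far (x - y)"
    using far_nonneg by auto
  ultimately show ?thesis using True by (simp add: coercive_def mult_ac)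
next
  case False
  then have f: "far (x - y) = \<bar>K (x - y)\<bar>" by (simp add: far_def)
  have "\<bar>u x - u y\<bar> powr p * \<bar>K (x - y)\<bar> \<le> 2 powr p * (\<bar>u x\<bar> powr p + \<bar>u y\<bar> powr p) * \<bar>K (x - y)\<bar>"
    using p0 by (intro mult_right_mono abs_diff_powr_le) auto
  moreover have "- (\<bar>u x - u y\<bar> powr p * \<bar>K (x - y)\<bar>) \<le> \<bar>u x - u y\<bar> powr p * K (x - y)"
    using mult_left_mono[OF abs_ge_minus_self[of "K (x - y)"], of "\<bar>u x - u y\<bar> powr p"] by (simp add: minus_le_iff)
  ultimately show ?thesis using False by (simp add: coercive_def f algebra_simps)
qed

lemma coercive_nonneg: "0 \<le> coercive u z"
proof (cases z)
  case (Pair x y)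
  have "0 \<le> c0 * (\<bar>u x - u y\<bar> powr p * (indicator {..<\<delta>0} (norm (x - y)) * W (x - y)))"
    using c0_pos by simp
  then show ?thesis using coercive_ge[of u x y] Pair by simp
qed

lemma coercive_measurable:
  assumes [measurable]: "u \<in> borel_measurable borel"
  shows "coercive u \<in> borel_measurable lborel2"
  unfolding coercive_def by measurable

lemma coercive_integral:
  assumes u: "u \<in> \<D>"
  shows "integrable lborel2 (coercive u)" "integral\<^sup>L lborel2 (coercive u) = J u u + far_mass * mass u"
proof -
  have up: "integrable lborel (\<lambda>x. 2 powr p * \<bar>u x\<bar> powr p)" using W0_memD(2)[OF u] by simp
  note 1 = integrable_energy_K[OF u]
  note 2 = integral_conv_fst[OF up far_integrable] 
  note 3 = integral_conv_snd[OF up far_integrable far_minus]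
  have eq: "coercive u = (\<lambda>z. (case z of (x, y) \<Rightarrow> \<bar>u x - u y\<bar> powr p * K (x - y))
     + ((case z of (x, y) \<Rightarrow> 2 powr p * \<bar>u x\<bar> powr p * far (x - y)) + (case z of (x, y) \<Rightarrow> 2 powr p * \<bar>u y\<bar> powr p * far (x - y))))"
    by (auto simp: coercive_def fun_eq_iff)
  show "integrable lborel2 (coercive u)"
    unfolding eq by (intro Bochner_Integration.integrable_add 1 2(1) 3(1))
  have "integral\<^sup>L lborel2 (coercive u) = J u u
     + ((LINT x|lborel. 2 powr p * \<bar>u x\<bar> powr p) * (LINT z|lborel. far z) + (LINT x|lborel. 2 powr p * \<bar>u x\<bar> powr p) * (LINT z|lborel. far z))"
    unfolding eq J_self[OF u] 2(2)[symmetric]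
    by (subst Bochner_Integration.integral_add[OF 1 Bochner_Integration.integrable_add[OF 2(1) 3(1)]],
        subst Bochner_Integration.integral_add[OF 2(1) 3(1)]) (simp only: 2(2) 3(2))
  also have "(LINT x|lborel. 2 powr p * \<bar>u x\<bar> powr p) = 2 powr p * mass u" by (simp add: mass_def)
  finally show "integral\<^sup>L lborel2 (coercive u) = J u u + far_mass * mass u"
    by (simp add: far_mass_def)
qed

text \<open>
  The energy is bounded below on functions of unit mass, because the correction has finite integral.
\<close>

lemma J_lower_bound:
  assumes "u \<in> \<D>" shows "- far_mass * mass u \<le> J u u"
proof -
  have "0 \<le> integral\<^sup>L lborel2 (coercive u)" by (intro integral_nonneg_AE) (auto simp: coercive_nonneg)
  then show ?thesis using coercive_integral(2)[OF assms] by simp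
qed

lemma near_energy_le:
  assumes [measurable]: "u \<in> borel_measurable borel"
  shows "ennreal c0 * energy p (\<lambda>z. indicator {..<\<delta>0} (norm z) * W z) u \<le> (\<integral>\<^sup>+z. ennreal (coercive u z) \<partial>lborel2)"
proof -
  have "ennreal c0 * energy p (\<lambda>z. indicator {..<\<delta>0} (norm z) * W z) u
     = energy p (\<lambda>z. c0 * (indicator {..<\<delta>0} (norm z) * W z)) u"
    using c0_pos by (intro energy_cmult[symmetric]) auto
  also have "\<dots> \<le> (\<integral>\<^sup>+z. ennreal (coercive u z) \<partial>lborel2)"
    unfolding energy_def
  proof (intro nn_integral_mono, clarify)
    fix x y show "ennreal (\<bar>u x - u y\<bar> powr p * (c0 * (indicator {..<\<delta>0} (norm (x - y)) * W (x - y)))) \<le> ennreal (coercive u (x, y))"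
      using coercive_ge[of u x y] by (intro ennreal_leI) (simp add: mult_ac)
  qed
  finally show ?thesis .
qed

lemma bdd_below_J: "bdd_below ((\<lambda>u. J u u) ` normalized_W0 s p \<Omega>)"
proof (rule bdd_belowI2)
  fix u assume "u \<in> normalized_W0 s p \<Omega>"
  then have "u \<in> \<D>" "mass u = 1" by (auto simp: normalized_iff)
  then show "- far_mass \<le> J u u" using J_lower_bound[of u] by simp
qed

text \<open>
  A cone over a ball in the domain. It is Lipschitz, and \<open>|z|\<^sup>p\<close> compensates the singularity of the kernel
  because \<open>s p < p\<close>.
\<close>

lemma bump_in_W0: obtains u where "u \<in> \<D>" "mass u \<noteq> 0"
proof -
  obtain x0 \<rho> where \<rho>: "0 < \<rho>" "ball x0 \<rho> \<subseteq> \<Omega>"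
    using open_dom nonempty_dom by (meson ex_in_conv open_contains_ball)
  define u where "u x = max 0 (\<rho> - norm (x - x0))" for x
  have [measurable]: "u \<in> borel_measurable borel" unfolding u_def by measurable
  have u0: "u x = 0" if "x \<notin> ball x0 \<rho>" for x
    using that by (simp add: u_def dist_norm norm_minus_commute)
  have ule: "\<bar>u x\<bar> powr p \<le> \<rho> powr p * indicator (ball x0 \<rho>) x" for x
    using u0[of x] p0 \<rho> by (cases "x \<in> ball x0 \<rho>") (auto simp: u_def intro!: powr_mono2)
  have ib: "integrable lborel (indicator (ball x0 \<rho>) :: 'a \<Rightarrow> real)"
    using emeasure_lborel_ball_finite[of x0 \<rho>] by (intro integrable_real_indicator) auto
  have up: "integrable lborel (\<lambda>x. \<bar>u x\<bar> powr p)"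
  proof (rule Bochner_Integration.integrable_bound)
    show "integrable lborel (\<lambda>x. \<rho> powr p * indicator (ball x0 \<rho>) x)" using ib by simp
    show "AE x in lborel. norm (\<bar>u x\<bar> powr p) \<le> norm (\<rho> powr p * indicator (ball x0 \<rho>) x)"
      using ule by (intro AE_I2) simp
  qed measurable
  let ?g = "\<lambda>z::'a. indicator {0..1} (norm z) * W z"
  let ?h = "\<lambda>z::'a. ennreal (indicator {0..1} (norm z) * (norm z powr p * W z))"
  let ?i = "\<lambda>x. ennreal (indicator (ball x0 \<rho>) x)"
  have mi [measurable]: "?i \<in> borel_measurable borel"
    by (intro measurable_compose[OF _ measurable_ennreal] borel_measurable_indicator) simp
  have mh [measurable]: "?h \<in> borel_measurable borel" by measurable
  have "energy p ?g u \<le> (\<integral>\<^sup>+z. (case z of (x, y) \<Rightarrow> ?i x * ?h (x - y)) + (case z of (x, y) \<Rightarrow> ?i y * ?h (x - y)) \<partial>lborel2)"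
    unfolding energy_def
  proof (intro nn_integral_mono, clarify)
    fix x y
    have L: "\<bar>u x - u y\<bar> powr p \<le> norm (x - y) powr p"
    proof (rule powr_mono2)
      have "\<bar>norm (x - x0) - norm (y - x0)\<bar> \<le> norm (x - y)"
        using norm_triangle_ineq3[of "x - x0" "y - x0"] by simp
      then show "\<bar>u x - u y\<bar> \<le> norm (x - y)" unfolding u_def by linarith
    qed (use p0 in auto)
    have "\<bar>u x - u y\<bar> powr p \<le> (indicator (ball x0 \<rho>) x + indicator (ball x0 \<rho>) y) * norm (x - y) powr p"
    proof (cases "x \<in> ball x0 \<rho> \<or> y \<in> ball x0 \<rho>")
      case True
      then have "1 \<le> indicator (ball x0 \<rho>) x + (indicator (ball x0 \<rho>) y :: real)" by (auto simp: indicator_def)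
      then have "1 * norm (x - y) powr p \<le> (indicator (ball x0 \<rho>) x + indicator (ball x0 \<rho>) y) * norm (x - y) powr p"
        by (rule mult_right_mono) simp
      then show ?thesis using L by linarith
    next
      case False
      then show ?thesis using u0[of x] u0[of y] by simp
    qed
    then have "\<bar>u x - u y\<bar> powr p * ?g (x - y) \<le> (indicator (ball x0 \<rho>) x + indicator (ball x0 \<rho>) y) * norm (x - y) powr p * ?g (x - y)"
      by (rule mult_right_mono) simp
    also have "\<dots> = indicator (ball x0 \<rho>) x * (indicator {0..1} (norm (x - y)) * (norm (x - y) powr p * W (x - y)))
       + indicator (ball x0 \<rho>) y * (indicator {0..1} (norm (x - y)) * (norm (x - y) powr p * W (x - y)))"
      by (simp only: algebra_simps)
    finally show "ennreal (\<bar>u x - u y\<bar> powr p * ?g (x - y)) \<le> ?i x * ?h (x - y) + ?i y * ?h (x - y)"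
      by (subst (1 2) ennreal_mult'[symmetric], simp, simp, subst ennreal_plus[symmetric], simp, simp) (rule ennreal_leI)
  qed
  also have "\<dots> = (\<integral>\<^sup>+(x, y). ?i x * ?h (x - y) \<partial>lborel2) + (\<integral>\<^sup>+(x, y). ?i y * ?h (x - y) \<partial>lborel2)"
    by (rule nn_integral_add) measurable
  also have "\<dots> = (\<integral>\<^sup>+x. ?i x \<partial>lborel) * (\<integral>\<^sup>+z. ?h z \<partial>lborel) + (\<integral>\<^sup>+x. ?i x \<partial>lborel) * (\<integral>\<^sup>+z. ?h z \<partial>lborel)"
    by (simp only: nn_integral_conv_fst[OF mi mh] nn_integral_conv_snd[OF mi mh])
  also have "\<dots> < \<infinity>"
  proof -
    have "(\<integral>\<^sup>+x. ?i x \<partial>lborel) < \<infinity>" using ib unfolding integrable_iff_bounded by simp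
    moreover have "(\<integral>\<^sup>+z. ?h z \<partial>lborel) < \<infinity>" by (rule logker_near_finite[OF sp_less])
    ultimately show ?thesis by (simp add: ennreal_mult_less_top)
  qed
  finally have eg: "energy p ?g u < \<infinity>" .
  have "energy p W u < \<infinity>"
    by (rule energy_finite_near[where g = ?g and \<delta> = 1 and c = 1]) (use up eg in auto)
  moreover have "AE x in lborel. x \<notin> \<Omega> \<longrightarrow> u x = 0" using u0 \<rho>(2) by (intro AE_I2) blast
  ultimately have uD: "u \<in> \<D>" using up by (intro W0_memI) auto
  have "mass u \<noteq> 0"
  proof
    assume "mass u = 0"
    then have "AE x in lborel. u x = 0" using mass_eq_0_iff[OF uD] by simp
    then have "AE x in lborel. x \<notin> ball x0 \<rho>"
      by eventually_elim (auto simp: u_def dist_norm norm_minus_commute)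
    then have "emeasure lborel (ball x0 \<rho>) = 0"
      by (subst (asm) AE_iff_measurable[of "ball x0 \<rho>"]) auto
    then show False using content_ball_pos[OF \<rho>(1), of x0] by (simp add: measure_def)
  qed
  then show ?thesis using that uD by blast
qed

lemma normalize:
  assumes "u \<in> \<D>" "mass u \<noteq> 0"
  defines "c \<equiv> mass u powr (- (1 / p))"
  shows "(\<lambda>x. c * u x) \<in> normalized_W0 s p \<Omega>" "J (\<lambda>x. c * u x) (\<lambda>x. c * u x) = J u u / mass u" "0 < c"
proof -
  have m: "0 < mass u" using assms(2) mass_nonneg[of u] by simp
  have "\<bar>c\<bar> powr p = mass u powr (- (1 / p) * p)" by (simp only: c_def powr_powr powr_ge_zero abs_of_nonneg)
  then have c: "\<bar>c\<bar> powr p = 1 / mass u" using m p0 by (simp add: powr_minus_divide)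
  show "(\<lambda>x. c * u x) \<in> normalized_W0 s p \<Omega>"
    using W0_scaled[OF assms(1)] m by (simp add: normalized_iff mass_scaled c)
  show "J (\<lambda>x. c * u x) (\<lambda>x. c * u x) = J u u / mass u" using J_scaled[OF assms(1)] by (simp add: c)
  show "0 < c" using m by (simp add: c_def)
qed

lemma normalized_nonempty: "normalized_W0 s p \<Omega> \<noteq> {}"
  using bump_in_W0 normalize(1) by blast

text \<open>
  By homogeneity the infimum bounds the Rayleigh quotient of every admissible function.
\<close>

lemma lambda1_le:
  assumes "u \<in> \<D>" shows "lambda1 s p \<Omega> * mass u \<le> J u u"
proof (cases "mass u = 0")
  case True then show ?thesis using J_self_null[OF assms] by simp
next
  case False
  have "lambda1 s p \<Omega> \<le> J u u / mass u"
    unfolding lambda1_def using normalize[OF assms False] cINF_lower[OF bdd_below_J] by metis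
  then show ?thesis using False mass_nonneg[of u] by (simp add: field_simps)
qed

text \<open>
  A substitute for the triangle inequality in \<open>L\<^sup>p\<close>: the coefficient of \<open>|b|\<^sup>p\<close> is as close to \<open>1\<close> as
  desired, at the expense of the coefficient of \<open>|a - b|\<^sup>p\<close>.
\<close>

lemma powr_le_convex_split:
  assumes "0 < t" "t < 1"
  shows "\<bar>a\<bar> powr p \<le> (1 - t) powr (1 - p) * \<bar>b\<bar> powr p + t powr (1 - p) * \<bar>a - b\<bar> powr p"
proof -
  have "\<bar>a\<bar> powr p \<le> (\<bar>b\<bar> + \<bar>a - b\<bar>) powr p" using p0 by (intro powr_mono2) auto
  also have "\<dots> \<le> (1 - t) * (\<bar>b\<bar> / (1 - t)) powr p + t * (\<bar>a - b\<bar> / t) powr p"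
    using powr_convex_fraction(1)[OF p1, of "\<bar>b\<bar>" "\<bar>a - b\<bar>" "1 - t" t] assms by simp
  also have "\<dots> = (1 - t) powr (1 - p) * \<bar>b\<bar> powr p + t powr (1 - p) * \<bar>a - b\<bar> powr p"
    using assms by (simp add: powr_divide powr_diff)
  finally show ?thesis .
qed

lemma mass_le_split:
  assumes [measurable]: "f \<in> borel_measurable borel" "g \<in> borel_measurable borel"
    and f: "integrable lborel (\<lambda>x. \<bar>f x\<bar> powr p)" and g: "integrable lborel (\<lambda>x. \<bar>g x\<bar> powr p)"
    and t: "0 < t" "t < 1"
  shows "ennreal (mass f) \<le> ennreal ((1 - t) powr (1 - p) * mass g) + ennreal (t powr (1 - p)) * Lp_dist p f g"
proof -
  have m: "(\<integral>\<^sup>+x. ennreal (\<bar>f x\<bar> powr p) \<partial>lborel) = ennreal (mass f)" if "integrable lborel (\<lambda>x. \<bar>f x\<bar> powr p)" for f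
    unfolding mass_def using that by (intro nn_integral_eq_integral) auto
  have "ennreal (mass f) \<le> (\<integral>\<^sup>+x. ennreal ((1 - t) powr (1 - p)) * ennreal (\<bar>g x\<bar> powr p) + ennreal (t powr (1 - p)) * ennreal (\<bar>f x - g x\<bar> powr p) \<partial>lborel)"
    unfolding m[OF f, symmetric]
    using powr_le_convex_split[OF t]
    by (intro nn_integral_mono) (simp add: ennreal_mult'[symmetric] ennreal_plus[symmetric] ennreal_leI del: ennreal_plus)
  also have "\<dots> = ennreal ((1 - t) powr (1 - p)) * ennreal (mass g) + ennreal (t powr (1 - p)) * Lp_dist p f g"
    unfolding Lp_dist_def m[OF g, symmetric] by (subst nn_integral_add) (auto simp: nn_integral_cmult)
  finally show ?thesis by (simp add: ennreal_mult')
qed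

text \<open>
  Half of the continuity of the mass under convergence in \<open>L\<^sup>p\<close>; with two sequences the statement serves
  for both halves. Let \<open>n\<close> tend to infinity first and then \<open>t\<close> to \<open>0\<close>.
\<close>

lemma mass_le_of_Lp_limit:
  assumes [measurable]: "\<And>n. f n \<in> borel_measurable borel" "\<And>n. g n \<in> borel_measurable borel"
    and f: "\<And>n. integrable lborel (\<lambda>x. \<bar>f n x\<bar> powr p)" and g: "\<And>n. integrable lborel (\<lambda>x. \<bar>g n x\<bar> powr p)"
    and D: "(\<lambda>n. Lp_dist p (f n) (g n)) \<longlonglongrightarrow> 0" and a: "\<And>n. mass (f n) = a" and b: "\<And>n. mass (g n) = b"
  shows "a \<le> b"
proof -
  have b0: "0 \<le> b" using b mass_nonneg by metis
  have 1: "a \<le> (1 - t) powr (1 - p) * b" if t: "0 < t" "t < 1" for t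
  proof -
    have "(\<lambda>n. ennreal ((1 - t) powr (1 - p) * b) + ennreal (t powr (1 - p)) * Lp_dist p (f n) (g n))
       \<longlonglongrightarrow> ennreal ((1 - t) powr (1 - p) * b) + ennreal (t powr (1 - p)) * 0"
      by (intro tendsto_add tendsto_const ennreal_tendsto_cmult D) auto
    then have "ennreal a \<le> ennreal ((1 - t) powr (1 - p) * b) + ennreal (t powr (1 - p)) * 0"
      using mass_le_split[OF _ _ f g t, of n n for n] by (intro LIMSEQ_le_const) (auto simp: a b)
    then show ?thesis using b0 by (simp add: ennreal_le_iff)
  qed
  have "((\<lambda>t. (1 - t) powr (1 - p) * b) \<longlongrightarrow> (1 - 0) powr (1 - p) * b) (at_right 0)"
    by (intro tendsto_intros) auto
  moreover have "eventually (\<lambda>t. a \<le> (1 - t) powr (1 - p) * b) (at_right (0::real))"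
    using eventually_at_right_real[of 0 "1::real"] by (auto elim!: eventually_mono intro!: 1)
  ultimately have "a \<le> (1 - 0) powr (1 - p) * b" by (intro tendsto_lowerbound) auto
  then show ?thesis by simp
qed

text \<open>
  The direct method: a minimising sequence has bounded energy near the diagonal, hence converges along a
  subsequence in \<open>L\<^sup>p\<close> and almost everywhere. The limit has unit mass, and by Fatou's lemma for the
  corrected integrand its energy is at most the infimum; the same estimate shows that it belongs to the
  space.
\<close>

theorem extremal_exists: "\<exists>\<phi>. extremal s p \<Omega> \<phi>"
proof -
  define l where "l = lambda1 s p \<Omega>"
  have "\<exists>u. u \<in> normalized_W0 s p \<Omega> \<and> J u u < l + 1 / real (Suc n)" for n
  proof -
    have "Inf ((\<lambda>u. J u u) ` normalized_W0 s p \<Omega>) < l + 1 / real (Suc n)" by (simp add: l_def lambda1_def)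
    then show ?thesis using cInf_lessD[of "(\<lambda>u. J u u) ` normalized_W0 s p \<Omega>"] normalized_nonempty by blast
  qed
  then obtain u where u: "\<And>n. u n \<in> normalized_W0 s p \<Omega>" and Ju: "\<And>n. J (u n) (u n) < l + 1 / real (Suc n)"
    by metis
  have uD: "u n \<in> \<D>" and mu: "mass (u n) = 1" for n using u[of n] by (auto simp: normalized_iff)
  have um [measurable]: "u n \<in> borel_measurable borel" for n using W0_memD(1)[OF uD] .
  have cu: "(\<integral>\<^sup>+z. ennreal (coercive (u n) z) \<partial>lborel2) = ennreal (J (u n) (u n) + far_mass)" for n
    using coercive_integral[OF uD[of n]] mu[of n]
    by (subst nn_integral_eq_integral) (auto simp: coercive_nonneg)
  have en: "energy p (\<lambda>z. indicator {..<\<delta>0} (norm z) * rker (s * p) z) (u n) \<le> ennreal ((l + 1 + far_mass) / c0)" for n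
  proof -
    have le: "rker (s * p) z \<le> W z" for z :: 'a by (simp add: logker_def distrib_right)
    have "energy p (\<lambda>z. indicator {..<\<delta>0} (norm z) * rker (s * p) z) (u n) \<le> energy p (\<lambda>z. indicator {..<\<delta>0} (norm z) * W z) (u n)"
      by (intro energy_mono mult_left_mono le) auto
    also have "\<dots> = ennreal (1 / c0) * (ennreal c0 * energy p (\<lambda>z. indicator {..<\<delta>0} (norm z) * W z) (u n))"
      using c0_pos by (simp add: mult.assoc[symmetric] ennreal_mult'[symmetric])
    also have "\<dots> \<le> ennreal (1 / c0) * ennreal (l + 1 + far_mass)"
    proof (intro mult_left_mono order_trans[OF near_energy_le])
      have "J (u n) (u n) + far_mass \<le> l + 1 + far_mass"
        using Ju[of n] by (simp add: divide_le_eq_1 order.trans[OF less_imp_le])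
      then show "(\<integral>\<^sup>+z. ennreal (coercive (u n) z) \<partial>lborel2) \<le> ennreal (l + 1 + far_mass)"
        unfolding cu by (rule ennreal_leI)
    qed auto
    also have "\<dots> = ennreal ((l + 1 + far_mass) / c0)"
      using c0_pos by (subst ennreal_mult'[symmetric]) auto
    finally show ?thesis .
  qed
  obtain r v where r: "strict_mono r" and v [measurable]: "v \<in> borel_measurable borel"
    and D: "(\<lambda>n. Lp_dist p (u (r n)) v) \<longlonglongrightarrow> 0" and lim: "AE x in lborel. (\<lambda>n. u (r n) x) \<longlonglongrightarrow> v x"
    by (rule Lp_compactness[OF um dom_measurable bounded_dom p1 W0_memD(3)[OF uD] W0_memD(2)[OF uD]
        eq_refl[OF mu[unfolded mass_def]] \<delta>0_pos sp0 en])
  have zero: "AE x in lborel. x \<notin> \<Omega> \<longrightarrow> v x = 0"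
  proof -
    have "AE x in lborel. \<forall>n. x \<notin> \<Omega> \<longrightarrow> u n x = 0"
      unfolding AE_all_countable using W0_memD(3)[OF uD] by blast
    with lim show ?thesis
    proof eventually_elim
      fix x assume x: "(\<lambda>n. u (r n) x) \<longlonglongrightarrow> v x" "\<forall>n. x \<notin> \<Omega> \<longrightarrow> u n x = 0"
      show "x \<notin> \<Omega> \<longrightarrow> v x = 0"
      proof
        assume "x \<notin> \<Omega>"
        then have "(\<lambda>n. u (r n) x) = (\<lambda>n. 0)" using x(2) by simp
        then have "(\<lambda>n::nat. 0::real) \<longlonglongrightarrow> v x" using x(1) by (simp only:)
        then show "v x = 0" by (simp add: LIMSEQ_const_iff)
      qed
    qed
  qed
  have vp: "integrable lborel (\<lambda>x. \<bar>v x\<bar> powr p)"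
  proof (rule integrableI_bounded)
    obtain n where n: "Lp_dist p (u (r n)) v < 1"
      using order_tendstoD(2)[OF D, of 1] by (auto simp: eventually_sequentially)
    have "(\<integral>\<^sup>+x. norm (\<bar>v x\<bar> powr p) \<partial>lborel) = Lp_dist p v (\<lambda>_. 0)" by (simp add: Lp_dist_def)
    also have "\<dots> \<le> ennreal (2 powr p) * (Lp_dist p v (u (r n)) + Lp_dist p (u (r n)) (\<lambda>_. 0))"
      using p0 by (intro Lp_dist_triangle) auto
    also have "\<dots> < \<infinity>"
    proof -
      have "Lp_dist p (u (r n)) (\<lambda>_. 0) < \<infinity>"
        using W0_memD(2)[OF uD[of "r n"]] unfolding integrable_iff_bounded Lp_dist_def by simp
      moreover have "Lp_dist p v (u (r n)) < \<infinity>"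
        unfolding Lp_dist_commute[of p v] using n by (rule less_trans) simp
      ultimately show ?thesis by (simp add: ennreal_mult_less_top)
    qed
    finally show "(\<integral>\<^sup>+x. norm (\<bar>v x\<bar> powr p) \<partial>lborel) < \<infinity>" .
  qed measurable
  have mv: "mass v = 1"
  proof (rule antisym)
    show "mass v \<le> 1"
      by (rule mass_le_of_Lp_limit[where f = "\<lambda>_. v" and g = "\<lambda>n. u (r n)"])
        (use vp W0_memD(2)[OF uD] D mu in \<open>simp_all add: Lp_dist_commute[of p v]\<close>)
    show "1 \<le> mass v"
      by (rule mass_le_of_Lp_limit[where g = "\<lambda>_. v" and f = "\<lambda>n. u (r n)"])
        (use vp W0_memD(2)[OF uD] D mu in simp_all)
  qed
  have Fatou: "(\<integral>\<^sup>+z. ennreal (coercive v z) \<partial>lborel2) \<le> ennreal (l + far_mass)"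
  proof -
    have "(\<integral>\<^sup>+z. ennreal (coercive v z) \<partial>lborel2) = (\<integral>\<^sup>+z. liminf (\<lambda>n. ennreal (coercive (u (r n)) z)) \<partial>lborel2)"
    proof (rule nn_integral_cong_AE)
      show "AE z in lborel2. ennreal (coercive v z) = liminf (\<lambda>n. ennreal (coercive (u (r n)) z))"
        using AE_lborel2_fst[OF lim] AE_lborel2_snd[OF lim]
      proof eventually_elim
        fix z assume z: "case z of (x, y) \<Rightarrow> (\<lambda>n. u (r n) x) \<longlonglongrightarrow> v x" "case z of (x, y) \<Rightarrow> (\<lambda>n. u (r n) y) \<longlonglongrightarrow> v y"
        obtain x y where xy: "z = (x, y)" by (cases z)
        have l: "(\<lambda>n. u (r n) x) \<longlonglongrightarrow> v x" "(\<lambda>n. u (r n) y) \<longlonglongrightarrow> v y" using z xy by auto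
        have pw: "(\<lambda>n. \<bar>a n\<bar> powr p) \<longlonglongrightarrow> \<bar>b\<bar> powr p" if "a \<longlonglongrightarrow> b" for a b
          using p0 by (intro tendsto_powr' tendsto_const tendsto_rabs that) auto
        have "(\<lambda>n. coercive (u (r n)) z) \<longlonglongrightarrow> coercive v z"
          unfolding coercive_def xy prod.case
          by (intro tendsto_add tendsto_mult tendsto_const pw tendsto_diff l)
        then show "ennreal (coercive v z) = liminf (\<lambda>n. ennreal (coercive (u (r n)) z))"
          by (intro lim_imp_Liminf[symmetric] tendsto_ennrealI) auto
      qed
    qed
    also have "\<dots> \<le> liminf (\<lambda>n. \<integral>\<^sup>+z. ennreal (coercive (u (r n)) z) \<partial>lborel2)"
      by (rule nn_integral_liminf) (intro measurable_compose[OF _ measurable_ennreal] coercive_measurable um)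
    also have "\<dots> \<le> liminf (\<lambda>n. ennreal (l + 1 / real (Suc n) + far_mass))"
    proof (intro Liminf_mono always_eventually allI)
      fix n
      have "1 / real (Suc (r n)) \<le> 1 / real (Suc n)" using seq_suble[OF r, of n] by (intro divide_left_mono) auto
      then have "J (u (r n)) (u (r n)) + far_mass \<le> l + 1 / real (Suc n) + far_mass" using Ju[of "r n"] by linarith
      then show "(\<integral>\<^sup>+z. ennreal (coercive (u (r n)) z) \<partial>lborel2) \<le> ennreal (l + 1 / real (Suc n) + far_mass)"
        unfolding cu by (rule ennreal_leI)
    qed
    also have "\<dots> = ennreal (l + 0 + far_mass)"
      by (intro lim_imp_Liminf tendsto_ennrealI tendsto_add tendsto_const
          LIMSEQ_inverse_real_of_nat[unfolded inverse_eq_divide] sequentially_bot)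
    finally show ?thesis by simp
  qed
  have vD: "v \<in> \<D>"
  proof (rule W0_memI[OF v vp zero])
    let ?g = "\<lambda>z::'a. indicator {..<\<delta>0} (norm z) * W z"
    have fin: "ennreal c0 * energy p ?g v < \<infinity>"
      using order_trans[OF near_energy_le[OF v] Fatou] by (rule le_less_trans) simp
    have "energy p ?g v < \<infinity>"
    proof (rule ccontr)
      assume "\<not> energy p ?g v < \<infinity>"
      then have "energy p ?g v = \<infinity>" by (metis infinity_ennreal_def top.not_eq_extremum)
      then show False using fin c0_pos by (simp add: ennreal_mult_top)
    qed
    then show "energy p W v < \<infinity>"
      by (intro energy_finite_near[where g = ?g and \<delta> = \<delta>0 and c = 1]) (use vp \<delta>0_pos in auto)
  qed
  have "(\<integral>\<^sup>+z. ennreal (coercive v z) \<partial>lborel2) = ennreal (J v v + far_mass)"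
    using coercive_integral[OF vD] mv by (subst nn_integral_eq_integral) (auto simp: coercive_nonneg)
  then have "ennreal (J v v + far_mass) \<le> ennreal (l + far_mass)" using Fatou by simp
  moreover have "0 \<le> l + far_mass"
  proof -
    have "- far_mass \<le> l" unfolding l_def lambda1_def
    proof (rule cINF_greatest[OF normalized_nonempty])
      fix w assume "w \<in> normalized_W0 s p \<Omega>"
      then show "- far_mass \<le> J w w" using J_lower_bound[of w] by (simp add: normalized_iff)
    qed
    then show ?thesis by simp
  qed
  ultimately have "J v v \<le> l" by (simp add: ennreal_le_iff)
  moreover have "l \<le> J v v" using lambda1_le[OF vD] mv by (simp add: l_def)
  ultimately have "extremal s p \<Omega> v" using vD mv by (simp add: extremal_def normalized_iff l_def)
  then show ?thesis by blast
qed

end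

section \<open>First variation\<close>

lemma powr_quotient_bounds:
  fixes a b t p :: real
  assumes p: "1 < p" and t: "0 < t"
  shows "p * spow p a * b \<le> (\<bar>a + t * b\<bar> powr p - \<bar>a\<bar> powr p) / t"
    and "(\<bar>a + t * b\<bar> powr p - \<bar>a\<bar> powr p) / t \<le> p * spow p (a + t * b) * b"
proof -
  have "\<bar>a\<bar> powr p + p * spow p a * ((a + t * b) - a) \<le> \<bar>a + t * b\<bar> powr p"
    by (rule powr_tangent[OF p])
  then show "p * spow p a * b \<le> (\<bar>a + t * b\<bar> powr p - \<bar>a\<bar> powr p) / t"
    using t by (simp add: pos_le_divide_eq algebra_simps)
  have "\<bar>a + t * b\<bar> powr p + p * spow p (a + t * b) * (a - (a + t * b)) \<le> \<bar>a\<bar> powr p"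
    by (rule powr_tangent[OF p])
  then show "(\<bar>a + t * b\<bar> powr p - \<bar>a\<bar> powr p) / t \<le> p * spow p (a + t * b) * b"
    using t by (simp add: pos_divide_le_eq algebra_simps)
qed

lemma powr_quotient_tendsto:
  fixes a b p :: real
  assumes p: "1 < p" and t: "\<And>n. 0 < t n" and lim: "t \<longlonglongrightarrow> 0"
  shows "(\<lambda>n. (\<bar>a + t n * b\<bar> powr p - \<bar>a\<bar> powr p) / t n) \<longlonglongrightarrow> p * spow p a * b"
proof (rule tendsto_sandwich[where f = "\<lambda>_. p * spow p a * b" and h = "\<lambda>n. p * spow p (a + t n * b) * b"])
  have "(\<lambda>n. a + t n * b) \<longlonglongrightarrow> a + 0 * b" by (intro tendsto_intros lim)
  then have "(\<lambda>n. spow p (a + t n * b)) \<longlonglongrightarrow> spow p (a + 0 * b)"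
    by (rule isCont_tendsto_compose[OF isCont_spow[OF p]])
  then show "(\<lambda>n. p * spow p (a + t n * b) * b) \<longlonglongrightarrow> p * spow p a * b"
    by (intro tendsto_intros) simp
  show "\<forall>\<^sub>F n in sequentially. p * spow p a * b \<le> (\<bar>a + t n * b\<bar> powr p - \<bar>a\<bar> powr p) / t n"
    by (intro always_eventually allI powr_quotient_bounds(1) p t)
  show "\<forall>\<^sub>F n in sequentially. (\<bar>a + t n * b\<bar> powr p - \<bar>a\<bar> powr p) / t n \<le> p * spow p (a + t n * b) * b"
    by (intro always_eventually allI powr_quotient_bounds(2) p t)
qed simp

lemma abs_powr_quotient_le:
  fixes a b t p :: real
  assumes p: "1 < p" and t: "0 < t" "t \<le> 1"
  shows "\<bar>(\<bar>a + t * b\<bar> powr p - \<bar>a\<bar> powr p) / t\<bar> \<le> p * (2 + 2 powr p) * (\<bar>a\<bar> powr p + \<bar>b\<bar> powr p)"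
proof -
  have 1: "\<bar>spow p a * b\<bar> \<le> \<bar>a\<bar> powr p + \<bar>b\<bar> powr p" by (rule abs_spow_mult_le[OF p])
  have 2: "\<bar>spow p (a + t * b) * b\<bar> \<le> \<bar>a + t * b\<bar> powr p + \<bar>b\<bar> powr p" by (rule abs_spow_mult_le[OF p])
  have "\<bar>t * b\<bar> \<le> \<bar>b\<bar>" using t by (simp add: abs_mult mult_left_le_one_le)
  then have 3: "\<bar>a + t * b\<bar> powr p \<le> 2 powr p * (\<bar>a\<bar> powr p + \<bar>b\<bar> powr p)"
    using p by (intro powr_le_sum_powr) auto
  define X where "X = \<bar>a\<bar> powr p + \<bar>b\<bar> powr p"
  define c where "c = (2::real) powr p"
  have X: "0 \<le> X" "\<bar>b\<bar> powr p \<le> X" and c: "0 \<le> c * X" by (auto simp: X_def c_def)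
  have 4: "\<bar>spow p (a + t * b) * b\<bar> \<le> c * X + X"
    by (rule order_trans[OF 2 add_mono[OF 3[folded X_def c_def] X(2)]])
  let ?q = "(\<bar>a + t * b\<bar> powr p - \<bar>a\<bar> powr p) / t"
  have q: "p * (spow p a * b) \<le> ?q" "?q \<le> p * (spow p (a + t * b) * b)"
    using powr_quotient_bounds[OF p t(1), of a b] by (simp_all add: mult.assoc)
  have l: "- (c * X + 2 * X) \<le> spow p a * b"
    using 1[folded X_def] c X(1) by linarith
  have u: "spow p (a + t * b) * b \<le> c * X + 2 * X"
    using 4 X(1) by linarith
  have "p * (- (c * X + 2 * X)) \<le> ?q"
    using p by (intro order_trans[OF mult_left_mono[OF l] q(1)]) auto
  moreover have "?q \<le> p * (c * X + 2 * X)"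
    using p by (intro order_trans[OF q(2) mult_left_mono[OF u]]) auto
  ultimately have "\<bar>?q\<bar> \<le> p * (c * X + 2 * X)" by (simp only: abs_le_iff mult_minus_right minus_le_iff)
  also have "\<dots> = p * (2 + c) * X" by (simp add: algebra_simps)
  finally show ?thesis by (simp only: X_def c_def)
qed

text \<open>
  Differentiation under the integral sign for a kernel of either sign: the difference quotients lie
  between two tangents, which gives both their limit and an integrable majorant.
\<close>

lemma first_variation:
  fixes f g k :: "'b \<Rightarrow> real"
  assumes [measurable]: "f \<in> borel_measurable M" "g \<in> borel_measurable M" "k \<in> borel_measurable M"
    and f: "integrable M (\<lambda>z. \<bar>f z\<bar> powr p * \<bar>k z\<bar>)" and g: "integrable M (\<lambda>z. \<bar>g z\<bar> powr p * \<bar>k z\<bar>)"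
    and p: "1 < p" and t: "\<And>n. 0 < t n" "\<And>n. t n \<le> 1" "t \<longlonglongrightarrow> 0"
  shows "(\<lambda>n. LINT z|M. (\<bar>f z + t n * g z\<bar> powr p - \<bar>f z\<bar> powr p) / t n * k z) \<longlonglongrightarrow> (LINT z|M. p * spow p (f z) * g z * k z)"
proof (rule integral_dominated_convergence[where w = "\<lambda>z. p * (2 + 2 powr p) * (\<bar>f z\<bar> powr p * \<bar>k z\<bar> + \<bar>g z\<bar> powr p * \<bar>k z\<bar>)"])
  show "integrable M (\<lambda>z. p * (2 + 2 powr p) * (\<bar>f z\<bar> powr p * \<bar>k z\<bar> + \<bar>g z\<bar> powr p * \<bar>k z\<bar>))"
    using f g by (intro integrable_mult_right Bochner_Integration.integrable_add) auto
  show "AE z in M. (\<lambda>n. (\<bar>f z + t n * g z\<bar> powr p - \<bar>f z\<bar> powr p) / t n * k z) \<longlonglongrightarrow> p * spow p (f z) * g z * k z"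
    by (intro AE_I2 tendsto_mult tendsto_const powr_quotient_tendsto[OF p t(1,3)])
  show "AE z in M. norm ((\<bar>f z + t n * g z\<bar> powr p - \<bar>f z\<bar> powr p) / t n * k z)
      \<le> p * (2 + 2 powr p) * (\<bar>f z\<bar> powr p * \<bar>k z\<bar> + \<bar>g z\<bar> powr p * \<bar>k z\<bar>)" for n
  proof (intro AE_I2)
    fix z
    have "\<bar>(\<bar>f z + t n * g z\<bar> powr p - \<bar>f z\<bar> powr p) / t n\<bar> * \<bar>k z\<bar>
       \<le> p * (2 + 2 powr p) * (\<bar>f z\<bar> powr p + \<bar>g z\<bar> powr p) * \<bar>k z\<bar>"
      by (intro mult_right_mono abs_powr_quotient_le[OF p t(1,2)]) auto
    then show "norm ((\<bar>f z + t n * g z\<bar> powr p - \<bar>f z\<bar> powr p) / t n * k z)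
      \<le> p * (2 + 2 powr p) * (\<bar>f z\<bar> powr p * \<bar>k z\<bar> + \<bar>g z\<bar> powr p * \<bar>k z\<bar>)"
      unfolding real_norm_def abs_mult distrib_right[of _ _ "\<bar>k z\<bar>", symmetric] by (simp only: mult.assoc)
  qed
qed measurable

context log_problem begin

lemma mass_integrable: "u \<in> \<D> \<Longrightarrow> integrable lborel (\<lambda>x. \<bar>u x\<bar> powr p * \<bar>1\<bar>)"
  using W0_memD(2) by simp

lemma J_variation:
  assumes u: "u \<in> \<D>" "v \<in> \<D>" and t: "\<And>n. 0 < t n" "\<And>n. t n \<le> 1" "t \<longlonglongrightarrow> 0"
  shows "(\<lambda>n. (J (\<lambda>x. u x + t n * v x) (\<lambda>x. u x + t n * v x) - J u u) / t n) \<longlonglongrightarrow> p * J u v"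
proof -
  note [measurable] = W0_memD(1)[OF u(1)] W0_memD(1)[OF u(2)]
  let ?f = "\<lambda>z. u (fst z) - u (snd z)" and ?g = "\<lambda>z. v (fst z) - v (snd z)" and ?k = "\<lambda>z. K (fst z - snd z)"
  have abs: "\<bar>\<bar>K z\<bar>\<bar> \<le> C / 2 * (\<bar>B\<bar> + p) * W z" for z using abs_K_le_W[of z] by simp
  have i: "integrable lborel2 (\<lambda>z. \<bar>w (fst z) - w (snd z)\<bar> powr p * \<bar>?k z\<bar>)" if "w \<in> \<D>" for w
    using integrable_energy[OF that _ abs K_const_nonneg] by (simp add: split_beta')
  have "(\<lambda>n. LINT z|lborel2. (\<bar>?f z + t n * ?g z\<bar> powr p - \<bar>?f z\<bar> powr p) / t n * ?k z) \<longlonglongrightarrow> (LINT z|lborel2. p * spow p (?f z) * ?g z * ?k z)"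
    by (rule first_variation[OF _ _ _ i[OF u(1)] i[OF u(2)] p1 t]) measurable
  also have "(LINT z|lborel2. p * spow p (?f z) * ?g z * ?k z) = p * J u v"
    unfolding J_eq[OF u] by (simp add: split_beta' mult.assoc)
  also have "(\<lambda>n. LINT z|lborel2. (\<bar>?f z + t n * ?g z\<bar> powr p - \<bar>?f z\<bar> powr p) / t n * ?k z)
     = (\<lambda>n. (J (\<lambda>x. u x + t n * v x) (\<lambda>x. u x + t n * v x) - J u u) / t n)"
  proof
    fix n
    let ?w = "\<lambda>x. u x + t n * v x"
    have w: "?w \<in> \<D>" by (rule W0_add_scaled[OF u])
    have "(LINT z|lborel2. (\<bar>?f z + t n * ?g z\<bar> powr p - \<bar>?f z\<bar> powr p) / t n * ?k z)
      = (LINT z|lborel2. (1 / t n) * ((case z of (x, y) \<Rightarrow> \<bar>?w x - ?w y\<bar> powr p * K (x - y)) - (case z of (x, y) \<Rightarrow> \<bar>u x - u y\<bar> powr p * K (x - y))))"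
      by (intro Bochner_Integration.integral_cong) (auto simp: algebra_simps diff_divide_distrib)
    also have "\<dots> = (1 / t n) * ((LINT (x, y)|lborel2. \<bar>?w x - ?w y\<bar> powr p * K (x - y)) - (LINT (x, y)|lborel2. \<bar>u x - u y\<bar> powr p * K (x - y)))"
      by (subst integral_mult_right_zero, subst Bochner_Integration.integral_diff[OF integrable_energy_K[OF w] integrable_energy_K[OF u(1)]]) simp
    finally show "(LINT z|lborel2. (\<bar>?f z + t n * ?g z\<bar> powr p - \<bar>?f z\<bar> powr p) / t n * ?k z)
      = (J ?w ?w - J u u) / t n" by (simp add: J_self[OF w] J_self[OF u(1)])
  qed
  finally show ?thesis .
qed

lemma mass_variation:
  assumes u: "u \<in> \<D>" "v \<in> \<D>" and t: "\<And>n. 0 < t n" "\<And>n. t n \<le> 1" "t \<longlonglongrightarrow> 0"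
  shows "(\<lambda>n. (mass (\<lambda>x. u x + t n * v x) - mass u) / t n) \<longlonglongrightarrow> p * (LINT x|lborel. spow p (u x) * v x)"
proof -
  note [measurable] = W0_memD(1)[OF u(1)] W0_memD(1)[OF u(2)]
  have "(\<lambda>n. LINT x|lborel. (\<bar>u x + t n * v x\<bar> powr p - \<bar>u x\<bar> powr p) / t n * 1) \<longlonglongrightarrow> (LINT x|lborel. p * spow p (u x) * v x * 1)"
    by (rule first_variation[OF _ _ _ mass_integrable[OF u(1)] mass_integrable[OF u(2)] p1 t]) measurable
  also have "(LINT x|lborel. p * spow p (u x) * v x * 1) = p * (LINT x|lborel. spow p (u x) * v x)"
    by (simp add: mult.assoc)
  also have "(\<lambda>n. LINT x|lborel. (\<bar>u x + t n * v x\<bar> powr p - \<bar>u x\<bar> powr p) / t n * 1)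
     = (\<lambda>n. (mass (\<lambda>x. u x + t n * v x) - mass u) / t n)"
    using W0_memD(2)[OF W0_add_scaled[OF u]] W0_memD(2)[OF u(1)] by (simp add: mass_def)
  finally show ?thesis .
qed

lemma J_scaled_right:
  assumes u: "u \<in> \<D>" "v \<in> \<D>" shows "J u (\<lambda>x. c * v x) = c * J u v"
proof -
  have "J u (\<lambda>x. c * v x) = (LINT z|lborel2. c * (case z of (x, y) \<Rightarrow> spow p (u x - u y) * (v x - v y) * K (x - y)))"
    unfolding J_eq[OF u(1) W0_scaled[OF u(2)]]
    by (intro Bochner_Integration.integral_cong) (auto simp: algebra_simps)
  then show ?thesis by (simp add: J_eq[OF u])
qed

lemma dom_integral_spow:
  assumes "u \<in> \<D>" "v \<in> \<D>"
  shows "(LINT x:\<Omega>|lborel. spow p (u x) * v x) = (LINT x|lborel. spow p (u x) * v x)"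
proof (rule set_integral_dom)
  show "AE x in lborel. x \<notin> \<Omega> \<longrightarrow> spow p (u x) * v x = 0"
    using W0_memD(3)[OF assms(2)] by eventually_elim auto
qed (use W0_memD(1)[OF assms(1)] W0_memD(1)[OF assms(2)] in measurable)

lemma integrable_spow_mult:
  assumes u: "u \<in> \<D>" and w: "w \<in> \<D>"
  shows "integrable lborel (\<lambda>x. spow p (u x) * w x)"
proof (rule Bochner_Integration.integrable_bound)
  note [measurable] = W0_memD(1)[OF u] W0_memD(1)[OF w]
  show "integrable lborel (\<lambda>x. \<bar>u x\<bar> powr p + \<bar>w x\<bar> powr p)" using W0_memD(2)[OF u] W0_memD(2)[OF w] by simp
  show "AE x in lborel. norm (spow p (u x) * w x) \<le> norm (\<bar>u x\<bar> powr p + \<bar>w x\<bar> powr p)"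
    using abs_spow_mult_le[OF p1] by (intro AE_I2) simp
  show "(\<lambda>x. spow p (u x) * w x) \<in> borel_measurable lborel" by measurable
qed

lemma extremal_iff: "extremal s p \<Omega> \<phi> \<longleftrightarrow> \<phi> \<in> \<D> \<and> mass \<phi> = 1 \<and> J \<phi> \<phi> = lambda1 s p \<Omega>"
  by (auto simp: extremal_def normalized_iff)

text \<open>
  The function \<open>t \<mapsto> J(\<phi> + t v) - \<lambda> \<parallel>\<phi> + t v\<parallel>\<^sup>p\<close> is nonnegative and vanishes at \<open>0\<close>, so its right
  derivative there is nonnegative. Applied to \<open>v\<close> and to \<open>-v\<close> this is the weak equation.
\<close>

theorem extremal_imp_eigenfunction:
  assumes "extremal s p \<Omega> \<phi>" shows "eigenfunction s p \<Omega> (lambda1 s p \<Omega>) \<phi>"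
proof -
  let ?l = "lambda1 s p \<Omega>"
  have \<phi>: "\<phi> \<in> \<D>" and m: "mass \<phi> = 1" and J\<phi>: "J \<phi> \<phi> = ?l" using assms by (auto simp: extremal_iff)
  have ineq: "?l * (LINT x|lborel. spow p (\<phi> x) * v x) \<le> J \<phi> v" if v: "v \<in> \<D>" for v
  proof -
    define t where "t n = inverse (real (Suc n))" for n
    have "t = (\<lambda>n. inverse (real (Suc n)))" by (simp add: t_def fun_eq_iff)
    then have "t \<longlonglongrightarrow> 0" using LIMSEQ_inverse_real_of_nat by (simp only:)
    then have t: "\<And>n. 0 < t n" "\<And>n. t n \<le> 1" "t \<longlonglongrightarrow> 0"
      by (simp_all add: t_def inverse_le_1_iff)
    have "(\<lambda>n. ?l * ((mass (\<lambda>x. \<phi> x + t n * v x) - mass \<phi>) / t n)) \<longlonglongrightarrow> ?l * (p * (LINT x|lborel. spow p (\<phi> x) * v x))"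
      by (intro tendsto_mult tendsto_const mass_variation[OF \<phi> v t])
    then have "?l * (p * (LINT x|lborel. spow p (\<phi> x) * v x)) \<le> p * J \<phi> v"
    proof (rule LIMSEQ_le[OF _ J_variation[OF \<phi> v t]], intro exI allI impI)
      fix n
      have "?l * mass (\<lambda>x. \<phi> x + t n * v x) \<le> J (\<lambda>x. \<phi> x + t n * v x) (\<lambda>x. \<phi> x + t n * v x)"
        by (rule lambda1_le[OF W0_add_scaled[OF \<phi> v]])
      then have "?l * (mass (\<lambda>x. \<phi> x + t n * v x) - mass \<phi>) \<le> J (\<lambda>x. \<phi> x + t n * v x) (\<lambda>x. \<phi> x + t n * v x) - J \<phi> \<phi>"
        by (simp add: m J\<phi> right_diff_distrib)
      then show "?l * ((mass (\<lambda>x. \<phi> x + t n * v x) - mass \<phi>) / t n)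
         \<le> (J (\<lambda>x. \<phi> x + t n * v x) (\<lambda>x. \<phi> x + t n * v x) - J \<phi> \<phi>) / t n"
        using t(1)[of n] by (simp add: divide_right_mono)
    qed
    then have "p * (?l * (LINT x|lborel. spow p (\<phi> x) * v x)) \<le> p * J \<phi> v" by (simp only: mult_ac)
    then show ?thesis using p0 by simp
  qed
  have "J \<phi> v = ?l * (LINT x:\<Omega>|lborel. spow p (\<phi> x) * v x)" if v: "v \<in> \<D>" for v
  proof (rule antisym)
    show "?l * (LINT x:\<Omega>|lborel. spow p (\<phi> x) * v x) \<le> J \<phi> v"
      using ineq[OF v] by (simp add: dom_integral_spow[OF \<phi> v])
    have "?l * (LINT x|lborel. spow p (\<phi> x) * (- 1 * v x)) \<le> J \<phi> (\<lambda>x. - 1 * v x)"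
      by (rule ineq[OF W0_scaled[OF v]])
    then show "J \<phi> v \<le> ?l * (LINT x:\<Omega>|lborel. spow p (\<phi> x) * v x)"
      by (simp only: J_scaled_right[OF \<phi> v]) (simp add: dom_integral_spow[OF \<phi> v])
  qed
  then show ?thesis using \<phi> m mass_eq_0_iff[OF \<phi>] by (auto simp: eigenfunction_def)
qed

end

section \<open>Domains of small diameter\<close>

lemma same_sign:
  fixes a b p :: real
  assumes "0 < p" "\<bar>a - b\<bar> powr p = \<bar>\<bar>a\<bar> - \<bar>b\<bar>\<bar> powr p"
  shows "0 \<le> a * b"
proof -
  have "\<bar>a - b\<bar> = \<bar>\<bar>a\<bar> - \<bar>b\<bar>\<bar>" by (rule powr_left_injective[OF assms(1) _ _ assms(2)]) auto
  then have "(0 \<le> a \<and> 0 \<le> b) \<or> (a \<le> 0 \<and> b \<le> 0)" by (auto simp: abs_if split: if_splits)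
  then show ?thesis by (auto simp: zero_le_mult_iff)
qed

lemma pmean_0_0: "0 < p \<Longrightarrow> pmean p t 0 0 = 0"
  by (simp add: pmean_def)

text \<open>
  The derivative at \<open>t = 0\<close> of the curve of \<open>p\<close>-means from \<open>a\<close> to \<open>b\<close>, multiplied by \<open>a\<^sup>p\<^sup>-\<^sup>1\<close>. Positivity of
  \<open>a\<close> is essential: for \<open>a = 0\<close> the left-hand side is \<open>0\<close>.
\<close>

lemma pmean_quotient_tendsto:
  fixes a b p :: real
  assumes p: "1 < p" and nn: "0 < a" "0 \<le> b" and t: "\<And>n. 0 < t n" "t \<longlonglongrightarrow> 0"
  shows "(\<lambda>n. spow p a * ((pmean p (t n) a b - a) / t n)) \<longlonglongrightarrow> (b powr p - a powr p) / p"
proof -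
  let ?f = "\<lambda>x. (a powr p + x * (b powr p - a powr p)) powr (1 / p)"
  have "((\<lambda>x. a powr p + x * (b powr p - a powr p)) has_real_derivative (b powr p - a powr p)) (at 0)"
    by (auto intro!: derivative_eq_intros)
  moreover have "((\<lambda>y. y powr (1 / p)) has_real_derivative 1 / p * (a powr p + 0 * (b powr p - a powr p)) powr (1 / p - 1)) (at (a powr p + 0 * (b powr p - a powr p)))"
    using nn by (intro has_real_derivative_powr) simp
  ultimately have "(?f has_real_derivative 1 / p * (a powr p + 0 * (b powr p - a powr p)) powr (1 / p - 1) * (b powr p - a powr p)) (at 0)"
    by (rule DERIV_chain2[rotated])
  then have "((\<lambda>h. (?f h - ?f 0) / h) \<longlongrightarrow> 1 / p * (a powr p) powr (1 / p - 1) * (b powr p - a powr p)) (at 0)"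
    by (simp add: DERIV_def)
  moreover have "filterlim t (at 0) sequentially"
    using t by (auto simp: filterlim_at intro!: always_eventually less_imp_neq[symmetric])
  ultimately have "(\<lambda>n. (?f (t n) - ?f 0) / t n) \<longlonglongrightarrow> 1 / p * (a powr p) powr (1 / p - 1) * (b powr p - a powr p)"
    by (rule filterlim_compose)
  then have "(\<lambda>n. spow p a * ((?f (t n) - ?f 0) / t n)) \<longlonglongrightarrow> spow p a * (1 / p * (a powr p) powr (1 / p - 1) * (b powr p - a powr p))"
    by (intro tendsto_mult tendsto_const)
  moreover have "?f (t n) = pmean p (t n) a b" for n
  proof -
    have "a powr p + t n * (b powr p - a powr p) = (1 - t n) * a powr p + t n * b powr p" by (simp add: algebra_simps)
    then show ?thesis using nn by (simp add: pmean_def)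
  qed
  moreover have "?f 0 = a" using nn p by (simp add: powr_powr)
  moreover have "spow p a * (1 / p * (a powr p) powr (1 / p - 1) * (b powr p - a powr p)) = (b powr p - a powr p) / p"
  proof -
    have "p * (1 / p - 1) = - (p - 1)" using p by (simp add: field_simps)
    then have "(a powr p) powr (1 / p - 1) = a powr (- (p - 1))" by (simp add: powr_powr)
    then have "spow p a * (a powr p) powr (1 / p - 1) = 1" using nn by (simp add: spow_pos powr_add[symmetric])
    then have "(spow p a * (a powr p) powr (1 / p - 1)) * ((b powr p - a powr p) / p) = (b powr p - a powr p) / p" by simp
    then show ?thesis by (simp add: mult_ac)
  qed
  ultimately show ?thesis by (simp only:)
qed

text \<open>
  The upper bound is the tangent inequality at \<open>a\<close>; the lower bound follows from \<open>(1 - t) a \<le> pmean p t a b\<close>.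
\<close>

lemma pmean_quotient_bound:
  fixes a b p t :: real
  assumes p: "1 < p" and nn: "0 \<le> a" "0 \<le> b" and t: "0 < t" "t \<le> 1"
  shows "\<bar>spow p a * ((pmean p t a b - a) / t)\<bar> \<le> a powr p + b powr p"
proof -
  let ?g = "pmean p t a b"
  have gp: "?g powr p = (1 - t) * a powr p + t * b powr p" using p t nn by (simp add: pmean_powr)
  have "a powr p + p * spow p a * (?g - a) \<le> ?g powr p"
    using powr_tangent[OF p, of a ?g] nn by simp
  then have "p * (spow p a * (?g - a)) \<le> t * b powr p - t * a powr p" by (simp add: gp algebra_simps)
  moreover have "0 \<le> t * a powr p" using t by simp
  ultimately have "p * (spow p a * (?g - a)) \<le> t * b powr p" by linarith
  moreover have "t * b powr p \<le> p * (t * b powr p)" using mult_right_mono[of 1 p "t * b powr p"] p t by simp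
  ultimately have "p * (spow p a * (?g - a)) \<le> p * (t * b powr p)" by linarith
  then have up: "spow p a * (?g - a) \<le> t * b powr p" using p by simp
  have "(1 - t) * a \<le> ?g"
  proof (cases "a = 0 \<or> t = 1")
    case False
    then have a: "0 < a" "0 < 1 - t" using nn t by auto
    have "((1 - t) * a) powr p \<le> ?g powr p"
    proof -
      have "(1 - t) powr p \<le> (1 - t) powr 1" using a t p by (intro powr_mono') auto
      then have "(1 - t) powr p * a powr p \<le> (1 - t) * a powr p" using a by (intro mult_right_mono) auto
      moreover have "0 \<le> t * b powr p" using t by simp
      moreover have "((1 - t) * a) powr p = (1 - t) powr p * a powr p" using a by (simp add: powr_mult)
      ultimately show ?thesis unfolding gp by linarith
    qed
    then show ?thesis
      using powr_less_mono2[of p ?g "(1 - t) * a"] p by (meson linorder_not_le pmean_nonneg less_trans zero_less_one)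
  qed auto
  then have "spow p a * (- (t * a)) \<le> spow p a * (?g - a)"
    using spow_nonneg[OF nn(1)] by (intro mult_left_mono) (auto simp: algebra_simps)
  then have lo: "- (t * a powr p) \<le> spow p a * (?g - a)"
  proof -
    have "spow p a * (- (t * a)) = - (t * (spow p a * a))" by simp
    also have "spow p a * a = a powr p" using nn by (simp add: spow_times_self)
    finally show ?thesis using \<open>spow p a * (- (t * a)) \<le> spow p a * (?g - a)\<close> by linarith
  qed
  have "0 \<le> t * a powr p" "0 \<le> t * b powr p" using t by auto
  then have "\<bar>spow p a * (?g - a)\<bar> \<le> t * (a powr p + b powr p)"
    unfolding distrib_left using up lo by linarith
  then show ?thesis using t by (simp add: abs_divide pos_divide_le_eq mult.commute)
qed

context log_problem begin

lemma J_cong_AE: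
  assumes u: "u \<in> \<D>" "u' \<in> \<D>" "AE x in lborel. u x = u' x" and v: "v \<in> \<D>" "v' \<in> \<D>" "AE x in lborel. v x = v' x"
  shows "J u v = J u' v'"
proof -
  note [measurable] = W0_memD(1)[OF u(1)] W0_memD(1)[OF u(2)] W0_memD(1)[OF v(1)] W0_memD(1)[OF v(2)]
  show ?thesis unfolding J_eq[OF u(1) v(1)] J_eq[OF u(2) v(2)]
  proof (rule integral_cong_AE)
    show "AE z in lborel2. (case z of (x, y) \<Rightarrow> spow p (u x - u y) * (v x - v y) * K (x - y))
      = (case z of (x, y) \<Rightarrow> spow p (u' x - u' y) * (v' x - v' y) * K (x - y))"
      using AE_lborel2_fst[OF u(3)] AE_lborel2_snd[OF u(3)] AE_lborel2_fst[OF v(3)] AE_lborel2_snd[OF v(3)]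
      by eventually_elim auto
  qed measurable
qed

lemma eigenfunction_energy:
  assumes "eigenfunction s p \<Omega> \<mu> u"
  shows "u \<in> \<D>" "mass u \<noteq> 0" "v \<in> \<D> \<Longrightarrow> J u v = \<mu> * (LINT x|lborel. spow p (u x) * v x)" "J u u = \<mu> * mass u"
proof -
  show u: "u \<in> \<D>" using assms by (simp add: eigenfunction_def)
  show "mass u \<noteq> 0" using assms mass_eq_0_iff[OF u] by (simp add: eigenfunction_def)
  show *: "J u v = \<mu> * (LINT x|lborel. spow p (u x) * v x)" if "v \<in> \<D>" for v
    using assms that dom_integral_spow[OF u that] by (simp add: eigenfunction_def)
  show "J u u = \<mu> * mass u" using *[OF u] by (simp add: spow_times_self mass_def)
qed

end

locale small_log_problem = log_problem +
  assumes small_diam: "diameter \<Omega> < exp (- 1 / (s * p))" and B_nonneg: "0 \<le> B"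
begin

text \<open>
  Any number strictly between the diameter and the threshold would do. With it, two points of the domain
  have distance below \<open>d0\<close>, a point at distance at least \<open>d0\<close> from a point of the domain lies outside,
  and the integral of the kernel over \<open>|z| \<ge> d0\<close> is positive.
\<close>

definition d0 :: real where "d0 = (diameter \<Omega> + exp (- 1 / (s * p))) / 2"
definition tail :: "'a \<Rightarrow> real" where "tail z = indicator {d0..} (norm z) * K z"
definition \<kappa> :: real where "\<kappa> = (LINT z|lborel. tail z)"

lemma d0: "0 < d0" "d0 < exp (- 1 / (s * p))" "d0 < 1" "ln d0 < - (1 / (s * p))"
proof -
  have "0 \<le> diameter \<Omega>" using bounded_dom by (rule diameter_ge_0)
  moreover have e: "0 < exp (- 1 / (s * p))" by simp
  ultimately show 1: "0 < d0" unfolding d0_def by (simp add: add_nonneg_pos)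
  show 2: "d0 < exp (- 1 / (s * p))" using small_diam by (simp add: d0_def)
  have "exp (- 1 / (s * p)) < 1" using sp0 by simp
  then show "d0 < 1" using 2 by linarith
  have "ln d0 < ln (exp (- 1 / (s * p)))" using 1 2 by (subst ln_less_cancel_iff) auto
  then show "ln d0 < - (1 / (s * p))" by simp
qed

lemma dist_dom_less: "x \<in> \<Omega> \<Longrightarrow> y \<in> \<Omega> \<Longrightarrow> norm (x - y) < d0"
  using diameter_bounded_bound[OF bounded_dom, of x y] small_diam by (simp add: d0_def dist_norm)

lemma K_pos: "z \<noteq> 0 \<Longrightarrow> norm z < d0 \<Longrightarrow> 0 < K z"
proof -
  assume z: "z \<noteq> 0" "norm z < d0"
  then have "ln (norm z) < 0" using d0(3) by simp
  then have "0 < B - p * ln (norm z)" using B_nonneg p0 by (simp add: mult_pos_neg add_nonneg_pos diff_conv_add_uminus del: add_uminus_conv_diff)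
  then show "0 < K z" using Cpos rker_pos[OF z(1)] by (simp add: K_eq)
qed

lemma K_nonneg: "norm z < d0 \<Longrightarrow> 0 \<le> K z"
  using K_pos[of z] by (cases "z = 0") (auto simp: K_eq)

lemma tail_eq: "tail z = C / 2 * (indicator {d0..} (norm z) * ((B - p * ln (norm z)) * rker (s * p) z))"
  by (simp add: tail_def K_eq)

lemma tail_integrable: "integrable lborel tail" and \<kappa>_pos: "0 < \<kappa>"
proof -
  note * = log_tail_integral_pos[OF d0(1) sp0 p0 B_nonneg d0(4), where 'a='a]
  show "integrable lborel tail" unfolding tail_eq[abs_def] using *(1) by (rule integrable_mult_right)
  show "0 < \<kappa>" unfolding \<kappa>_def tail_eq using *(2) Cpos by simp
qed

lemma tail_minus: "tail (- z) = tail z"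
  by (simp add: tail_def kernel_log_minus)

definition in_dom :: "'a \<times> 'a \<Rightarrow> bool" where "in_dom = (\<lambda>(x, y). x \<in> \<Omega> \<and> y \<in> \<Omega>)"

lemma in_dom_measurable [measurable]: "Measurable.pred lborel2 in_dom"
  unfolding in_dom_def by measurable

text \<open>
  The shape of an integrand built from functions that vanish outside the domain: when exactly one of the
  two points lies in the domain, its value depends on that point only.
\<close>

definition compatible :: "('a \<Rightarrow> 'a \<Rightarrow> real) \<Rightarrow> ('a \<Rightarrow> real) \<Rightarrow> 'a \<times> 'a \<Rightarrow> bool" where
  "compatible F g = (\<lambda>(x, y). (x \<in> \<Omega> \<longrightarrow> y \<in> \<Omega> \<longrightarrow> 0 \<le> F x y) \<and> (x \<in> \<Omega> \<longrightarrow> y \<notin> \<Omega> \<longrightarrow> F x y = g x)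
    \<and> (x \<notin> \<Omega> \<longrightarrow> y \<in> \<Omega> \<longrightarrow> F x y = g y) \<and> (x \<notin> \<Omega> \<longrightarrow> y \<notin> \<Omega> \<longrightarrow> F x y = 0))"

text \<open>
  The kernel is positive at pairs of points of the domain but not everywhere. For pairs with one point \<open>x\<close>
  in the domain the integrand is \<open>g(x)\<close> times the kernel, and integrating the kernel over the complement
  of the domain gives at least \<open>\<kappa>\<close>: the complement contains all points at distance at least \<open>d0\<close>, and the
  rest of it only adds a region where the kernel is nonnegative. Hence the form behaves as if the kernel
  were positive. All statements on the first eigenvalue below are applications of this lemma to
  suitable \<open>F\<close> and \<open>g\<close>.
\<close>

lemma positivity:
  fixes F :: "'a \<Rightarrow> 'a \<Rightarrow> real" and g :: "'a \<Rightarrow> real"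
  assumes F: "AE z in lborel2. compatible F g z"
    and g: "\<And>x. 0 \<le> g x" "integrable lborel g"
    and int: "integrable lborel2 (\<lambda>(x, y). F x y * K (x - y))"
  shows "(LINT z|lborel2. indicator {z. in_dom z} z * (case z of (x, y) \<Rightarrow> F x y * K (x - y)))
      + 2 * \<kappa> * (LINT x|lborel. indicator \<Omega> x * g x) \<le> (LINT (x, y)|lborel2. F x y * K (x - y))"
    and "(LINT (x, y)|lborel2. F x y * K (x - y)) \<le> 0 \<Longrightarrow>
      AE (x, y) in lborel2. x \<in> \<Omega> \<longrightarrow> y \<in> \<Omega> \<longrightarrow> x \<noteq> y \<longrightarrow> F x y = 0"
    and "2 * \<kappa> * (LINT x|lborel. indicator \<Omega> x * g x) \<le> (LINT (x, y)|lborel2. F x y * K (x - y))"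
proof -
  let ?FK = "\<lambda>z. case z of (x, y) \<Rightarrow> F x y * K (x - y)"
  let ?I = "\<lambda>z. indicator {z. in_dom z} z * ?FK z"
  let ?g = "\<lambda>x. indicator \<Omega> x * g x"
  let ?T1 = "\<lambda>z. case z of (x, y) \<Rightarrow> ?g x * tail (x - y)"
  let ?T2 = "\<lambda>z. case z of (x, y) \<Rightarrow> ?g y * tail (x - y)"
  have gi: "integrable lborel ?g" using integrable_mult_indicator[of \<Omega> lborel g] g(2) by simp
  note T1 = integral_conv_fst[OF gi tail_integrable] and T2 = integral_conv_snd[OF gi tail_integrable tail_minus]
  have set: "{z. in_dom z} \<in> sets lborel2" using in_dom_measurable by (simp add: pred_def space_pair_measure)
  have Ii: "integrable lborel2 ?I" using integrable_mult_indicator[OF set int] by simp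
  have le: "AE z in lborel2. ?I z + (?T1 z + ?T2 z) \<le> ?FK z"
    using F
  proof eventually_elim
    fix z :: "'a \<times> 'a"
    obtain x y where z: "z = (x, y)" by (cases z)
    assume "compatible F g z"
    then have F': "x \<in> \<Omega> \<Longrightarrow> y \<notin> \<Omega> \<Longrightarrow> F x y = g x" "x \<notin> \<Omega> \<Longrightarrow> y \<in> \<Omega> \<Longrightarrow> F x y = g y" "x \<notin> \<Omega> \<Longrightarrow> y \<notin> \<Omega> \<Longrightarrow> F x y = 0"
      using z by (auto simp: compatible_def)
    have tK: "tail (x - y) \<le> K (x - y)" using K_nonneg[of "x - y"] by (cases "norm (x - y) < d0") (auto simp: tail_def)
    have t0: "tail (x - y) = 0" if "x \<in> \<Omega>" "y \<in> \<Omega>" using dist_dom_less[OF that] by (simp add: tail_def)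
    show "?I z + (?T1 z + ?T2 z) \<le> ?FK z"
      using F' tK t0 g(1) unfolding z in_dom_def
      by (cases "x \<in> \<Omega>"; cases "y \<in> \<Omega>") (auto intro!: mult_left_mono)
  qed
  have "(LINT z|lborel2. ?I z + (?T1 z + ?T2 z)) \<le> (LINT z|lborel2. ?FK z)"
    by (intro integral_mono_AE Bochner_Integration.integrable_add Ii T1(1) T2(1) int le)
  moreover have "(LINT z|lborel2. ?I z + (?T1 z + ?T2 z)) = (LINT z|lborel2. ?I z) + ((LINT z|lborel2. ?T1 z) + (LINT z|lborel2. ?T2 z))"
    by (subst Bochner_Integration.integral_add[OF Ii Bochner_Integration.integrable_add[OF T1(1) T2(1)]],
        subst Bochner_Integration.integral_add[OF T1(1) T2(1)]) simp
  moreover have "(LINT z|lborel2. ?T1 z) + (LINT z|lborel2. ?T2 z) = 2 * \<kappa> * (LINT x|lborel. ?g x)"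
    unfolding T1(2) T2(2) \<kappa>_def[symmetric] by simp
  ultimately show main: "(LINT z|lborel2. ?I z) + 2 * \<kappa> * (LINT x|lborel. ?g x) \<le> (LINT z|lborel2. ?FK z)" by simp
  have I0: "AE z in lborel2. 0 \<le> ?I z"
    using F
  proof eventually_elim
    fix z :: "'a \<times> 'a"
    obtain x y where z: "z = (x, y)" by (cases z)
    assume "compatible F g z"
    then have "x \<in> \<Omega> \<Longrightarrow> y \<in> \<Omega> \<Longrightarrow> 0 \<le> F x y * K (x - y)"
      using z K_nonneg[OF dist_dom_less] by (auto simp: compatible_def intro!: mult_nonneg_nonneg)
    then show "0 \<le> ?I z" by (auto simp: z in_dom_def indicator_def)
  qed
  then have I0': "0 \<le> (LINT z|lborel2. ?I z)" by (rule integral_nonneg_AE)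
  have G0: "0 \<le> 2 * \<kappa> * (LINT x|lborel. ?g x)"
    using \<kappa>_pos g(1) by (intro mult_nonneg_nonneg integral_nonneg_AE) auto
  show "2 * \<kappa> * (LINT x|lborel. ?g x) \<le> (LINT z|lborel2. ?FK z)" using main I0' by linarith
  assume "(LINT z|lborel2. ?FK z) \<le> 0"
  then have "(LINT z|lborel2. ?I z) = 0" using main I0' G0 by linarith
  then have "AE z in lborel2. ?I z = 0" using integral_nonneg_eq_0_iff_AE[OF Ii I0] by simp
  then show "AE (x, y) in lborel2. x \<in> \<Omega> \<longrightarrow> y \<in> \<Omega> \<longrightarrow> x \<noteq> y \<longrightarrow> F x y = 0"
  proof eventually_elim
    fix z :: "'a \<times> 'a" assume I: "?I z = 0"
    obtain x y where z: "z = (x, y)" by (cases z)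
    have "F x y = 0" if "x \<in> \<Omega>" "y \<in> \<Omega>" "x \<noteq> y"
      using I that K_pos[of "x - y"] dist_dom_less[of x y] by (simp add: z in_dom_def)
    then show "case z of (x, y) \<Rightarrow> x \<in> \<Omega> \<longrightarrow> y \<in> \<Omega> \<longrightarrow> x \<noteq> y \<longrightarrow> F x y = 0" by (simp add: z)
  qed
qed

lemma AE_zero_outside:
  assumes "u \<in> \<D>"
  shows "AE (x, y) in lborel2. (x \<notin> \<Omega> \<longrightarrow> u x = 0) \<and> (y \<notin> \<Omega> \<longrightarrow> u y = 0)"
  using AE_lborel2_fst[OF W0_memD(3)[OF assms]] AE_lborel2_snd[OF W0_memD(3)[OF assms]] by eventually_elim auto

lemma mass_dom_indicator:
  assumes "u \<in> \<D>" shows "(LINT x|lborel. indicator \<Omega> x * \<bar>u x\<bar> powr p) = mass u"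
  using mass_dom[OF assms] by (simp add: set_lebesgue_integral_def)

theorem lambda1_pos: "0 < lambda1 s p \<Omega>"
proof -
  obtain \<phi> where \<phi>: "\<phi> \<in> \<D>" "mass \<phi> = 1" "J \<phi> \<phi> = lambda1 s p \<Omega>"
    using extremal_exists by (auto simp: extremal_iff)
  have "2 * \<kappa> * (LINT x|lborel. indicator \<Omega> x * \<bar>\<phi> x\<bar> powr p) \<le> (LINT (x, y)|lborel2. \<bar>\<phi> x - \<phi> y\<bar> powr p * K (x - y))"
  proof (rule positivity(3))
    show "AE z in lborel2. compatible (\<lambda>x y. \<bar>\<phi> x - \<phi> y\<bar> powr p) (\<lambda>x. \<bar>\<phi> x\<bar> powr p) z"
      using AE_zero_outside[OF \<phi>(1)] by eventually_elim (auto simp: compatible_def)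
  qed (use W0_memD(2)[OF \<phi>(1)] integrable_energy_K[OF \<phi>(1)] in auto)
  then show ?thesis using \<kappa>_pos by (simp add: mass_dom_indicator[OF \<phi>(1)] \<phi> J_self[OF \<phi>(1), symmetric])
qed

lemma mass_abs: "mass (\<lambda>x. \<bar>u x\<bar>) = mass u"
  by (simp add: mass_def)

text \<open>
  Passing to absolute values does not change the terms with one point outside the domain and decreases the
  others, so \<open>|\<phi>|\<close> is extremal too. Equality of the energies then says that \<open>\<phi>(x) \<phi>(y) \<ge> 0\<close> for almost every
  pair, and fixing one point at which \<open>\<phi>\<close> is positive determines the sign of \<open>\<phi>\<close> almost everywhere.
\<close>

lemma extremal_abs:
  assumes "extremal s p \<Omega> \<phi>"
  shows "extremal s p \<Omega> (\<lambda>x. \<bar>\<phi> x\<bar>)" "(AE x in lborel. \<phi> x = \<bar>\<phi> x\<bar>) \<or> (AE x in lborel. \<phi> x = - \<bar>\<phi> x\<bar>)"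
proof -
  have \<phi>: "\<phi> \<in> \<D>" "mass \<phi> = 1" "J \<phi> \<phi> = lambda1 s p \<Omega>" using assms by (auto simp: extremal_iff)
  let ?a = "\<lambda>x. \<bar>\<phi> x\<bar>"
  have a: "?a \<in> \<D>" by (rule W0_abs[OF \<phi>(1)])
  let ?F = "\<lambda>x y. \<bar>\<phi> x - \<phi> y\<bar> powr p - \<bar>?a x - ?a y\<bar> powr p"
  have F: "AE z in lborel2. compatible ?F (\<lambda>_. 0) z"
    using AE_zero_outside[OF \<phi>(1)]
  proof eventually_elim
    fix z :: "'a \<times> 'a"
    obtain x y where z: "z = (x, y)" by (cases z)
    assume "case z of (x, y) \<Rightarrow> (x \<notin> \<Omega> \<longrightarrow> \<phi> x = 0) \<and> (y \<notin> \<Omega> \<longrightarrow> \<phi> y = 0)"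
    moreover have "\<bar>?a x - ?a y\<bar> powr p \<le> \<bar>\<phi> x - \<phi> y\<bar> powr p" using p0 by (intro powr_mono2) auto
    ultimately show "compatible ?F (\<lambda>_. 0) z" by (simp add: z compatible_def)
  qed
  have eq: "(\<lambda>(x, y). ?F x y * K (x - y)) = (\<lambda>z. (case z of (x, y) \<Rightarrow> \<bar>\<phi> x - \<phi> y\<bar> powr p * K (x - y)) - (case z of (x, y) \<Rightarrow> \<bar>?a x - ?a y\<bar> powr p * K (x - y)))"
    by (auto simp: fun_eq_iff left_diff_distrib)
  have int: "integrable lborel2 (\<lambda>(x, y). ?F x y * K (x - y))"
    unfolding eq by (intro Bochner_Integration.integrable_diff integrable_energy_K \<phi>(1) a)
  have val: "(LINT (x, y)|lborel2. ?F x y * K (x - y)) = J \<phi> \<phi> - J ?a ?a"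
    unfolding eq J_self[OF \<phi>(1)] J_self[OF a] by (rule Bochner_Integration.integral_diff[OF integrable_energy_K[OF \<phi>(1)] integrable_energy_K[OF a]])
  note pos = positivity[OF F _ _ int]
  have "0 \<le> J \<phi> \<phi> - J ?a ?a" using pos(3) by (simp add: val)
  moreover have "lambda1 s p \<Omega> \<le> J ?a ?a" using lambda1_le[OF a] by (simp add: mass_abs \<phi>(2))
  ultimately have Ja: "J ?a ?a = lambda1 s p \<Omega>" using \<phi>(3) by linarith
  then show "extremal s p \<Omega> ?a" using a \<phi>(2) by (simp add: extremal_iff mass_abs)
  have "AE (x, y) in lborel2. x \<in> \<Omega> \<longrightarrow> y \<in> \<Omega> \<longrightarrow> x \<noteq> y \<longrightarrow> ?F x y = 0"
    by (rule pos(2)) (simp_all add: val Ja \<phi>(3))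
  then have "AE z in lborel2. 0 \<le> \<phi> (fst z) * \<phi> (snd z)"
    using AE_zero_outside[OF \<phi>(1)]
  proof eventually_elim
    fix z :: "'a \<times> 'a"
    obtain x y where z: "z = (x, y)" by (cases z)
    assume "case z of (x, y) \<Rightarrow> x \<in> \<Omega> \<longrightarrow> y \<in> \<Omega> \<longrightarrow> x \<noteq> y \<longrightarrow> ?F x y = 0"
      "case z of (x, y) \<Rightarrow> (x \<notin> \<Omega> \<longrightarrow> \<phi> x = 0) \<and> (y \<notin> \<Omega> \<longrightarrow> \<phi> y = 0)"
    then show "0 \<le> \<phi> (fst z) * \<phi> (snd z)"
      using same_sign[OF p0, of "\<phi> x" "\<phi> y"] by (cases "x = y"; cases "x \<in> \<Omega>"; cases "y \<in> \<Omega>") (auto simp: z)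
  qed
  then have ae: "AE x in lborel. AE y in lborel. 0 \<le> \<phi> x * \<phi> y"
    using lborel_pair.AE_pair[of "\<lambda>z. 0 \<le> \<phi> (fst z) * \<phi> (snd z)"] by simp
  show "(AE x in lborel. \<phi> x = \<bar>\<phi> x\<bar>) \<or> (AE x in lborel. \<phi> x = - \<bar>\<phi> x\<bar>)"
  proof (cases "AE x in lborel. \<phi> x \<le> 0")
    case True
    then have "AE x in lborel. \<phi> x = - \<bar>\<phi> x\<bar>" by eventually_elim simp
    then show ?thesis ..
  next
    case False
    have "\<exists>x. (AE y in lborel. 0 \<le> \<phi> x * \<phi> y) \<and> 0 < \<phi> x"
    proof (rule ccontr)
      assume n: "\<not> ?thesis"
      have "AE x in lborel. \<phi> x \<le> 0" using ae by (rule AE_mp) (use n in \<open>auto intro!: AE_I2 simp: not_less\<close>)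
      then show False using False by simp
    qed
    then obtain x where x: "AE y in lborel. 0 \<le> \<phi> x * \<phi> y" "0 < \<phi> x" by blast
    from x(1) have "AE y in lborel. \<phi> y = \<bar>\<phi> y\<bar>"
      by eventually_elim (use x(2) in \<open>auto simp: zero_le_mult_iff\<close>)
    then show ?thesis by blast
  qed
qed

text \<open>
  The pointwise inequality for \<open>p\<close>-means, integrated. The terms with one point outside the domain cancel,
  because the \<open>p\<close>-th power of the \<open>p\<close>-mean is affine in \<open>t\<close>.
\<close>

lemma hidden_convexity_energy:
  assumes a: "a \<in> \<D>" "\<And>x. 0 \<le> a x" and b: "b \<in> \<D>" "\<And>x. 0 \<le> b x" and t: "0 \<le> t" "t \<le> 1"
  defines "w \<equiv> \<lambda>x. pmean p t (a x) (b x)"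
  shows "J w w \<le> (1 - t) * J a a + t * J b b"
    and "\<lbrakk>0 < t; t < 1; J w w = (1 - t) * J a a + t * J b b\<rbrakk> \<Longrightarrow> AE (x, y) in lborel2. a x * b y = b x * a y"
proof -
  have w: "w \<in> \<D>" unfolding w_def by (rule W0_pmean[OF a(1) b(1) a(2) b(2) t])
  let ?F = "\<lambda>x y. ((1 - t) * \<bar>a x - a y\<bar> powr p + t * \<bar>b x - b y\<bar> powr p) - \<bar>w x - w y\<bar> powr p"
  have zero: "AE z in lborel2. case z of (x, y) \<Rightarrow> (x \<notin> \<Omega> \<longrightarrow> a x = 0 \<and> b x = 0) \<and> (y \<notin> \<Omega> \<longrightarrow> a y = 0 \<and> b y = 0)"
    using AE_zero_outside[OF a(1)] AE_zero_outside[OF b(1)] by eventually_elim auto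
  have wp: "w x powr p = (1 - t) * a x powr p + t * b x powr p" for x
    using a(2)[of x] b(2)[of x] t p0 by (simp add: w_def pmean_powr)
  have F: "AE z in lborel2. compatible ?F (\<lambda>_. 0) z"
    using zero
  proof eventually_elim
    fix z :: "'a \<times> 'a"
    obtain x y where z: "z = (x, y)" by (cases z)
    assume "case z of (x, y) \<Rightarrow> (x \<notin> \<Omega> \<longrightarrow> a x = 0 \<and> b x = 0) \<and> (y \<notin> \<Omega> \<longrightarrow> a y = 0 \<and> b y = 0)"
    then have o: "x \<notin> \<Omega> \<Longrightarrow> a x = 0 \<and> b x = 0 \<and> w x = 0" "y \<notin> \<Omega> \<Longrightarrow> a y = 0 \<and> b y = 0 \<and> w y = 0"
      using p0 by (auto simp: z w_def pmean_0_0)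
    have nn: "0 \<le> a x" "0 \<le> b x" "0 \<le> a y" "0 \<le> b y" "0 \<le> w x" "0 \<le> w y" using a b by (auto simp: w_def)
    have "0 \<le> ?F x y"
      using hidden_convexity(1)[OF p1 t nn(1-4)] by (simp add: w_def)
    then show "compatible ?F (\<lambda>_. 0) z"
      using o wp[of x] wp[of y] nn by (simp add: z compatible_def)
  qed
  let ?E = "\<lambda>u z. case z of (x, y) \<Rightarrow> \<bar>u x - u y\<bar> powr p * K (x - y)"
  have eq: "(\<lambda>(x, y). ?F x y * K (x - y)) = (\<lambda>z. ((1 - t) * ?E a z + t * ?E b z) - ?E w z)"
    by (auto simp: fun_eq_iff left_diff_distrib distrib_right mult.assoc)
  note ia = integrable_mult_right[OF integrable_energy_K[OF a(1)], of "1 - t"]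
    and ib = integrable_mult_right[OF integrable_energy_K[OF b(1)], of t] and iw = integrable_energy_K[OF w]
  have int: "integrable lborel2 (\<lambda>(x, y). ?F x y * K (x - y))"
    unfolding eq by (intro Bochner_Integration.integrable_diff Bochner_Integration.integrable_add ia ib iw)
  have val: "(LINT (x, y)|lborel2. ?F x y * K (x - y)) = (1 - t) * J a a + t * J b b - J w w"
    unfolding eq J_self[OF a(1)] J_self[OF b(1)] J_self[OF w]
    by (subst Bochner_Integration.integral_diff[OF Bochner_Integration.integrable_add[OF ia ib] iw],
        subst Bochner_Integration.integral_add[OF ia ib]) (simp only: integral_mult_right_zero)
  note pos = positivity[OF F _ _ int]
  show "J w w \<le> (1 - t) * J a a + t * J b b" using pos(3) by (simp add: val)
  assume t': "0 < t" "t < 1" and e: "J w w = (1 - t) * J a a + t * J b b"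
  have "AE (x, y) in lborel2. x \<in> \<Omega> \<longrightarrow> y \<in> \<Omega> \<longrightarrow> x \<noteq> y \<longrightarrow> ?F x y = 0"
    by (rule pos(2)) (simp_all add: val e)
  then show "AE (x, y) in lborel2. a x * b y = b x * a y"
    using zero
  proof eventually_elim
    fix z :: "'a \<times> 'a"
    obtain x y where z: "z = (x, y)" by (cases z)
    assume F0: "case z of (x, y) \<Rightarrow> x \<in> \<Omega> \<longrightarrow> y \<in> \<Omega> \<longrightarrow> x \<noteq> y \<longrightarrow> ?F x y = 0"
      and o: "case z of (x, y) \<Rightarrow> (x \<notin> \<Omega> \<longrightarrow> a x = 0 \<and> b x = 0) \<and> (y \<notin> \<Omega> \<longrightarrow> a y = 0 \<and> b y = 0)"
    have "a x * b y = b x * a y"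
    proof (cases "x \<in> \<Omega> \<and> y \<in> \<Omega> \<and> x \<noteq> y")
      case True
      then have "?F x y = 0" using F0 z by simp
      then have "\<bar>pmean p t (a x) (b x) - pmean p t (a y) (b y)\<bar> powr p = (1 - t) * \<bar>a x - a y\<bar> powr p + t * \<bar>b x - b y\<bar> powr p"
        by (simp add: w_def)
      then show ?thesis by (rule hidden_convexity(2)[OF p1 t a(2) b(2) a(2) b(2) t'])
    next
      case False
      then show ?thesis using o z by (auto simp: mult.commute)
    qed
    then show "case z of (x, y) \<Rightarrow> a x * b y = b x * a y" by (simp add: z)
  qed
qed

lemma mass_pmean:
  assumes a: "a \<in> \<D>" and b: "b \<in> \<D>" and t: "0 \<le> t" "t \<le> 1"
  shows "mass (\<lambda>x. pmean p t (a x) (b x)) = (1 - t) * mass a + t * mass b"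
proof -
  have "mass (\<lambda>x. pmean p t (a x) (b x)) = (LINT x|lborel. (1 - t) * \<bar>a x\<bar> powr p + t * \<bar>b x\<bar> powr p)"
    unfolding mass_def using t p0 by (simp add: pmean_powr)
  then show ?thesis using W0_memD(2)[OF a] W0_memD(2)[OF b] by (simp add: mass_def)
qed

text \<open>
  The \<open>p\<close>-mean of two extremal functions has unit mass and, by hidden convexity, is extremal again; the
  equality case makes the two functions proportional, and they have the same mass.
\<close>

lemma extremal_nonneg_unique:
  assumes a: "extremal s p \<Omega> a" "\<And>x. 0 \<le> a x" and b: "extremal s p \<Omega> b" "\<And>x. 0 \<le> b x"
  shows "AE x in lborel. a x = b x"
proof -
  have aD: "a \<in> \<D>" "mass a = 1" "J a a = lambda1 s p \<Omega>" and bD: "b \<in> \<D>" "mass b = 1" "J b b = lambda1 s p \<Omega>"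
    using a b by (auto simp: extremal_iff)
  let ?w = "\<lambda>x. pmean p (1/2) (a x) (b x)"
  have w: "?w \<in> \<D>" by (rule W0_pmean[OF aD(1) bD(1) a(2) b(2)]) auto
  have "mass ?w = 1" using mass_pmean[OF aD(1) bD(1), of "1/2"] aD bD by simp
  then have "lambda1 s p \<Omega> \<le> J ?w ?w" using lambda1_le[OF w] by simp
  moreover have "J ?w ?w \<le> (1 - 1/2) * J a a + 1/2 * J b b"
    by (rule hidden_convexity_energy(1)[OF aD(1) a(2) bD(1) b(2)]) auto
  ultimately have "J ?w ?w = (1 - 1/2) * J a a + 1/2 * J b b" using aD(3) bD(3) by simp
  then have "AE (x, y) in lborel2. a x * b y = b x * a y"
    by (intro hidden_convexity_energy(2)[OF aD(1) a(2) bD(1) b(2), of "1/2"]) auto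
  then have "AE z in lborel2. a (fst z) * b (snd z) = b (fst z) * a (snd z)" by eventually_elim auto
  then have ae: "AE x in lborel. AE y in lborel. a x * b y = b x * a y"
    using lborel_pair.AE_pair[of "\<lambda>z. a (fst z) * b (snd z) = b (fst z) * a (snd z)"] by simp
  have "\<exists>x. (AE y in lborel. a x * b y = b x * a y) \<and> a x \<noteq> 0"
  proof (rule ccontr)
    assume n: "\<not> ?thesis"
    have "AE x in lborel. a x = 0" using ae by (rule AE_mp) (use n in \<open>auto intro!: AE_I2\<close>)
    then show False using mass_eq_0_iff[OF aD(1)] aD(2) by simp
  qed
  then obtain x where x: "AE y in lborel. a x * b y = b x * a y" "a x \<noteq> 0" by blast
  define c where "c = b x / a x"
  have "0 \<le> c" using a(2)[of x] b(2)[of x] by (simp add: c_def)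
  have bc: "AE y in lborel. b y = c * a y"
    using x(1) by eventually_elim (use x(2) in \<open>simp add: c_def field_simps\<close>)
  have "mass b = mass (\<lambda>y. c * a y)" unfolding mass_def
    by (intro integral_cong_AE) (use bc W0_memD(1)[OF aD(1)] W0_memD(1)[OF bD(1)] in \<open>auto elim!: AE_mp\<close>)
  then have "c powr p = 1 powr p" using aD(2) bD(2) \<open>0 \<le> c\<close> by (simp add: mass_scaled)
  then have "c = 1" using powr_left_injective[OF p0 \<open>0 \<le> c\<close>, of 1] by simp
  show ?thesis using bc by eventually_elim (simp add: \<open>c = 1\<close>)
qed

text \<open>
  After normalisation an eigenfunction for the first eigenvalue is extremal, and two extremal functions
  agree up to sign.
\<close>

theorem lambda1_simple:
  assumes "extremal s p \<Omega> \<phi>" "eigenfunction s p \<Omega> (lambda1 s p \<Omega>) v"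
  shows "\<exists>c. c \<noteq> 0 \<and> (AE x in lborel. \<phi> x = c * v x)"
proof -
  note v = eigenfunction_energy[OF assms(2)]
  define c where "c = mass v powr (- (1 / p))"
  note n = normalize[OF v(1,2), folded c_def]
  have ext: "extremal s p \<Omega> (\<lambda>x. c * v x)"
    using n(1,2) v(2) by (simp add: extremal_def v(4))
  have ae: "AE x in lborel. \<bar>\<phi> x\<bar> = \<bar>c * v x\<bar>"
    by (rule extremal_nonneg_unique[OF extremal_abs(1)[OF assms(1)] _ extremal_abs(1)[OF ext]]) auto
  from extremal_abs(2)[OF assms(1)] extremal_abs(2)[OF ext]
  have "(AE x in lborel. \<phi> x = c * v x) \<or> (AE x in lborel. \<phi> x = - c * v x)"
  proof (elim disjE)
    assume "AE x in lborel. \<phi> x = \<bar>\<phi> x\<bar>" "AE x in lborel. c * v x = \<bar>c * v x\<bar>"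
    then have "AE x in lborel. \<phi> x = c * v x" using ae by eventually_elim simp
    then show ?thesis ..
  next
    assume "AE x in lborel. \<phi> x = \<bar>\<phi> x\<bar>" "AE x in lborel. c * v x = - \<bar>c * v x\<bar>"
    then have "AE x in lborel. \<phi> x = - c * v x" using ae by eventually_elim linarith
    then show ?thesis ..
  next
    assume "AE x in lborel. \<phi> x = - \<bar>\<phi> x\<bar>" "AE x in lborel. c * v x = \<bar>c * v x\<bar>"
    then have "AE x in lborel. \<phi> x = - c * v x" using ae by eventually_elim linarith
    then show ?thesis ..
  next
    assume "AE x in lborel. \<phi> x = - \<bar>\<phi> x\<bar>" "AE x in lborel. c * v x = - \<bar>c * v x\<bar>"
    then have "AE x in lborel. \<phi> x = c * v x" using ae by eventually_elim linarith
    then show ?thesis ..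
  qed
  then show ?thesis using n(3) by (metis less_irrefl neg_equal_0_iff_equal)
qed

text \<open>
  Convexity of the energy in the form of its tangent inequality. For functions
  vanishing outside the domain the integrand has the shape required by the positivity lemma, with \<open>g\<close> the tangent defect of \<open>|t|\<^sup>p\<close> from \<open>u(x)\<close> to \<open>w(x)\<close>.
\<close>

lemma J_tangent:
  assumes u: "u \<in> \<D>" and w: "w \<in> \<D>"
  shows "p * (J u w - J u u) \<le> J w w - J u u"
proof -
  let ?F = "\<lambda>x y. \<bar>w x - w y\<bar> powr p - (\<bar>u x - u y\<bar> powr p + p * (spow p (u x - u y) * (w x - w y) - \<bar>u x - u y\<bar> powr p))"
  let ?g = "\<lambda>x. \<bar>w x\<bar> powr p - (\<bar>u x\<bar> powr p + p * (spow p (u x) * w x - \<bar>u x\<bar> powr p))"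
  note [measurable] = W0_memD(1)[OF u] W0_memD(1)[OF w]
  have tan: "0 \<le> \<bar>B\<bar> powr p - (\<bar>A\<bar> powr p + p * (spow p A * B - \<bar>A\<bar> powr p))" for A B :: real
  proof -
    have "spow p A * B - \<bar>A\<bar> powr p = spow p A * (B - A)" by (simp add: right_diff_distrib spow_times_self)
    then show ?thesis using powr_tangent[OF p1, of A B] by (simp add: mult.assoc)
  qed
  have F: "AE z in lborel2. compatible ?F ?g z"
    using AE_zero_outside[OF u] AE_zero_outside[OF w]
  proof eventually_elim
    fix z :: "'a \<times> 'a"
    obtain x y where z: "z = (x, y)" by (cases z)
    assume "case z of (x, y) \<Rightarrow> (x \<notin> \<Omega> \<longrightarrow> u x = 0) \<and> (y \<notin> \<Omega> \<longrightarrow> u y = 0)"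
      "case z of (x, y) \<Rightarrow> (x \<notin> \<Omega> \<longrightarrow> w x = 0) \<and> (y \<notin> \<Omega> \<longrightarrow> w y = 0)"
    then show "compatible ?F ?g z"
      using tan[of "w x - w y" "u x - u y"] by (simp add: z compatible_def spow_minus)
  qed
  have ig: "integrable lborel ?g"
    using W0_memD(2)[OF u] W0_memD(2)[OF w] integrable_spow_mult[OF u w]
    by (intro Bochner_Integration.integrable_diff Bochner_Integration.integrable_add integrable_mult_right)
  let ?E = "\<lambda>u z. case z of (x, y) \<Rightarrow> \<bar>u x - u y\<bar> powr p * K (x - y)"
  let ?G = "\<lambda>z. case z of (x, y) \<Rightarrow> spow p (u x - u y) * (w x - w y) * K (x - y)"
  have eq: "(\<lambda>(x, y). ?F x y * K (x - y)) = (\<lambda>z. ?E w z - (?E u z + p * (?G z - ?E u z)))"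
    by (auto simp: fun_eq_iff algebra_simps)
  note iu = integrable_energy_K[OF u] and iw = integrable_energy_K[OF w] and iG = integrable_form_K[OF u w]
  note i1 = Bochner_Integration.integrable_diff[OF iG iu]
  note i2 = integrable_mult_right[OF i1, of p]
  note i3 = Bochner_Integration.integrable_add[OF iu i2]
  have int: "integrable lborel2 (\<lambda>(x, y). ?F x y * K (x - y))"
    unfolding eq by (rule Bochner_Integration.integrable_diff[OF iw i3])
  have val: "(LINT (x, y)|lborel2. ?F x y * K (x - y)) = J w w - (J u u + p * (J u w - J u u))"
    unfolding eq J_self[OF u] J_self[OF w] J_eq[OF u w]
    by (subst Bochner_Integration.integral_diff[OF iw i3], subst Bochner_Integration.integral_add[OF iu i2],
        subst integral_mult_right_zero, subst Bochner_Integration.integral_diff[OF iG iu]) simp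
  have "0 \<le> 2 * \<kappa> * (LINT x|lborel. indicator \<Omega> x * ?g x)"
    using \<kappa>_pos tan by (intro mult_nonneg_nonneg integral_nonneg_AE) auto
  also have "\<dots> \<le> (LINT (x, y)|lborel2. ?F x y * K (x - y))"
    by (rule positivity(3)[OF F tan ig int])
  finally show ?thesis unfolding val by simp
qed

text \<open>
  Join \<open>u\<close> to a nonnegative extremal function \<open>b\<close>, scaled to the mass \<open>m\<close> of \<open>u\<close>, by the curve \<open>\<gamma> t\<close> of
  \<open>p\<close>-means. Hidden convexity bounds \<open>J(\<gamma> t) - J(u)\<close> above by \<open>t m (\<lambda> - \<mu>)\<close>, where \<open>\<lambda>\<close> is the first
  eigenvalue; the tangent inequality and the equation for \<open>u\<close> bound it below by
  \<open>p \<mu> \<integral> u\<^sup>p\<^sup>-\<^sup>1 (\<gamma> t - u)\<close>. Divide by \<open>t\<close> and let \<open>t\<close> tend to \<open>0\<close>: since \<open>u\<close> is positive, the last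
  integral tends to \<open>(\<parallel>b\<parallel>\<^sup>p - \<parallel>u\<parallel>\<^sup>p) / p = 0\<close>. Therefore \<open>\<mu> \<le> \<lambda>\<close>.
\<close>

theorem positive_eigenfunction_eigenvalue:
  assumes eig: "eigenfunction s p \<Omega> \<mu> u" and pos: "AE x in lborel. x \<in> \<Omega> \<longrightarrow> 0 < u x"
  shows "\<mu> = lambda1 s p \<Omega>"
proof (rule antisym)
  let ?l = "lambda1 s p \<Omega>"
  note e = eigenfunction_energy[OF eig]
  define m where "m = mass u"
  have m: "0 < m" using e(2) mass_nonneg[of u] by (simp add: m_def)
  show ge: "?l \<le> \<mu>" using lambda1_le[OF e(1)] m by (simp add: e(4) m_def)
  define a where "a x = \<bar>u x\<bar>" for x
  have a: "a \<in> \<D>" "\<And>x. 0 \<le> a x" using W0_abs[OF e(1)] by (auto simp: a_def[abs_def])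
  have ua: "AE x in lborel. u x = a x"
    using pos W0_memD(3)[OF e(1)] by eventually_elim (auto simp: a_def)
  have ma: "mass a = m" using mass_abs[of u] by (simp add: a_def[abs_def] m_def)
  note [measurable] = W0_memD(1)[OF e(1)] W0_memD(1)[OF a(1)]
  have Ja: "J a v = \<mu> * (LINT x|lborel. spow p (a x) * v x)" if v: "v \<in> \<D>" for v
  proof -
    note [measurable] = W0_memD(1)[OF v]
    have "J a v = J u v" by (rule J_cong_AE[OF a(1) e(1) _ v v]) (use ua in \<open>auto elim!: AE_mp\<close>)
    also have "\<dots> = \<mu> * (LINT x|lborel. spow p (u x) * v x)" by (rule e(3)[OF v])
    also have "(LINT x|lborel. spow p (u x) * v x) = (LINT x|lborel. spow p (a x) * v x)"
    proof (rule integral_cong_AE)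
      show "AE x in lborel. spow p (u x) * v x = spow p (a x) * v x" using ua by eventually_elim simp
    qed measurable
    finally show ?thesis .
  qed
  have Jaa: "J a a = \<mu> * m" using Ja[OF a(1)] by (simp add: spow_times_self mass_def[symmetric] ma)
  obtain \<phi> where \<phi>: "extremal s p \<Omega> \<phi>" using extremal_exists by blast
  note \<phi>' = extremal_abs(1)[OF \<phi>, unfolded extremal_iff]
  define b where "b x = m powr (1 / p) * \<bar>\<phi> x\<bar>" for x
  have mp: "(m powr (1 / p)) powr p = m" using m p0 by (simp add: powr_powr)
  have b: "b \<in> \<D>" "\<And>x. 0 \<le> b x" using W0_scaled[of "\<lambda>x. \<bar>\<phi> x\<bar>"] \<phi>' by (auto simp: b_def[abs_def])
  have mb: "mass b = m" using \<phi>' by (simp add: b_def[abs_def] mass_scaled mp)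
  have Jb: "J b b = ?l * m" using J_scaled[of "\<lambda>x. \<bar>\<phi> x\<bar>" "m powr (1 / p)"] \<phi>' by (simp add: b_def[abs_def] mp)
  note [measurable] = W0_memD(1)[OF b(1)]
  define t where "t n = inverse (real (Suc n))" for n
  have "t = (\<lambda>n. inverse (real (Suc n)))" by (simp add: t_def fun_eq_iff)
  then have "t \<longlonglongrightarrow> 0" using LIMSEQ_inverse_real_of_nat by (simp only:)
  then have t: "0 < t n" "t n \<le> 1" "t \<longlonglongrightarrow> 0" for n
    by (simp_all add: t_def inverse_le_1_iff)
  let ?\<gamma> = "\<lambda>n x. pmean p (t n) (a x) (b x)"
  let ?q = "\<lambda>n x. spow p (a x) * ((?\<gamma> n x - a x) / t n)"
  have iab: "integrable lborel (\<lambda>x. a x powr p + b x powr p)"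
    using W0_memD(2)[OF a(1)] W0_memD(2)[OF b(1)] a(2) b(2) by auto
  have lim: "(\<lambda>n. LINT x|lborel. ?q n x) \<longlonglongrightarrow> (LINT x|lborel. (b x powr p - a x powr p) / p)"
  proof (rule integral_dominated_convergence[OF _ _ iab])
    show "AE x in lborel. (\<lambda>n. ?q n x) \<longlonglongrightarrow> (b x powr p - a x powr p) / p"
      using pos ua W0_memD(3)[OF a(1)] W0_memD(3)[OF b(1)]
    proof eventually_elim
      fix x assume x: "x \<in> \<Omega> \<longrightarrow> 0 < u x" "u x = a x" "x \<notin> \<Omega> \<longrightarrow> a x = 0" "x \<notin> \<Omega> \<longrightarrow> b x = 0"
      show "(\<lambda>n. ?q n x) \<longlonglongrightarrow> (b x powr p - a x powr p) / p"
      proof (cases "x \<in> \<Omega>")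
        case True
        then show ?thesis using x b(2) by (intro pmean_quotient_tendsto[OF p1 _ _ t(1,3)]) auto
      next
        case False
        then show ?thesis using x by simp
      qed
    qed
    show "AE x in lborel. norm (?q n x) \<le> a x powr p + b x powr p" for n
      unfolding real_norm_def by (intro AE_I2 pmean_quotient_bound[OF p1 a(2) b(2) t(1,2)])
  qed measurable
  have L0: "(LINT x|lborel. (b x powr p - a x powr p) / p) = (mass b - mass a) / p"
    using W0_memD(2)[OF a(1)] W0_memD(2)[OF b(1)] a(2) b(2) by (simp add: mass_def)
  have lim0: "(\<lambda>n. LINT x|lborel. ?q n x) \<longlonglongrightarrow> 0" using lim by (simp only: L0 ma mb diff_self div_0)
  have "p * \<mu> * (LINT x|lborel. ?q n x) \<le> m * (?l - \<mu>)" for n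
  proof -
    have \<gamma>: "?\<gamma> n \<in> \<D>" using t(1,2)[of n] by (intro W0_pmean a b) auto
    have "p * (J a (?\<gamma> n) - J a a) \<le> J (?\<gamma> n) (?\<gamma> n) - J a a"
      by (rule J_tangent[OF a(1) \<gamma>])
    also have "\<dots> \<le> ((1 - t n) * J a a + t n * J b b) - J a a"
      using t(1,2)[of n] by (intro diff_right_mono hidden_convexity_energy(1) a b) auto
    also have "\<dots> = t n * (m * (?l - \<mu>))" by (simp add: Jaa Jb algebra_simps)
    finally have 1: "p * (J a (?\<gamma> n) - J a a) \<le> t n * (m * (?l - \<mu>))" .
    have "t n * (LINT x|lborel. ?q n x) = (LINT x|lborel. t n * ?q n x)" by simp
    also have "\<dots> = (LINT x|lborel. spow p (a x) * ?\<gamma> n x - spow p (a x) * a x)"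
      using t(1)[of n] by (intro Bochner_Integration.integral_cong) (auto simp: right_diff_distrib diff_divide_distrib)
    also have "\<dots> = (LINT x|lborel. spow p (a x) * ?\<gamma> n x) - (LINT x|lborel. spow p (a x) * a x)"
      by (rule Bochner_Integration.integral_diff[OF integrable_spow_mult[OF a(1) \<gamma>] integrable_spow_mult[OF a(1) a(1)]])
    finally have tQ: "t n * (LINT x|lborel. ?q n x) = (LINT x|lborel. spow p (a x) * ?\<gamma> n x) - (LINT x|lborel. spow p (a x) * a x)" .
    have "t n * (p * \<mu> * (LINT x|lborel. ?q n x)) = p * (\<mu> * (t n * (LINT x|lborel. ?q n x)))"
      by (simp only: mult_ac)
    also have "\<dots> = p * (J a (?\<gamma> n) - J a a)"
      unfolding tQ Ja[OF \<gamma>] Ja[OF a(1)] by (simp only: right_diff_distrib)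
    also note 1
    finally have "t n * (p * \<mu> * (LINT x|lborel. ?q n x)) \<le> t n * (m * (?l - \<mu>))" .
    then show ?thesis by (rule mult_left_le_imp_le[OF _ t(1)])
  qed
  then have "p * \<mu> * 0 \<le> m * (?l - \<mu>)"
    by (intro LIMSEQ_le_const2[OF tendsto_mult[OF tendsto_const lim0]]) auto
  then have "0 \<le> m * (?l - \<mu>)" by simp
  then show "\<mu> \<le> ?l" using m by (simp add: zero_le_mult_iff)
qed

end

section \<open>The first eigenvalue\<close>

theorem theorem5p4:
  fixes \<Omega> :: "'a::euclidean_space set" and s p :: real
  assumes "1 < p" and "0 < s" and "s < 1"
    and "open \<Omega>" and "bounded \<Omega>" and "\<Omega> \<noteq> {}" and "lipschitz_boundary \<Omega>"
  shows "bdd_below ((\<lambda>u. J_log s p u u) ` normalized_W0 s p \<Omega>) \<and>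
    (\<exists>\<phi>. extremal s p \<Omega> \<phi>) \<and>
    (\<forall>\<phi>. extremal s p \<Omega> \<phi> \<longrightarrow> eigenfunction s p \<Omega> (lambda1 s p \<Omega>) \<phi>) \<and>
    (diameter \<Omega> < exp (- 1 / (s * p)) \<and> B_const DIM('a) s p \<ge> 0 \<longrightarrow>
      (lambda1 s p \<Omega> > 0 \<and>
       (\<exists>\<phi>. extremal s p \<Omega> \<phi> \<and> eigenfunction s p \<Omega> (lambda1 s p \<Omega>) \<phi> \<and>
            (AE x in lborel. x \<in> \<Omega> \<longrightarrow> \<phi> x \<ge> 0))) \<and>
      (\<forall>\<phi> v. extremal s p \<Omega> \<phi> \<and> eigenfunction s p \<Omega> (lambda1 s p \<Omega>) v \<longrightarrow>
            (\<exists>c. c \<noteq> 0 \<and> (AE x in lborel. \<phi> x = c * v x))) \<and>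
      (\<forall>\<mu> u. eigenfunction s p \<Omega> \<mu> u \<and> (AE x in lborel. x \<in> \<Omega> \<longrightarrow> u x > 0) \<longrightarrow>
            \<mu> = lambda1 s p \<Omega>))"
proof -
  interpret log_problem \<Omega> s p "B_const DIM('a) s p" "C_const DIM('a) s p"
    using assms by unfold_locales auto
  have small: "0 < lambda1 s p \<Omega> \<and>
       (\<exists>\<phi>. extremal s p \<Omega> \<phi> \<and> eigenfunction s p \<Omega> (lambda1 s p \<Omega>) \<phi> \<and>
            (AE x in lborel. x \<in> \<Omega> \<longrightarrow> \<phi> x \<ge> 0)) \<and>
      (\<forall>\<phi> v. extremal s p \<Omega> \<phi> \<and> eigenfunction s p \<Omega> (lambda1 s p \<Omega>) v \<longrightarrow>
            (\<exists>c. c \<noteq> 0 \<and> (AE x in lborel. \<phi> x = c * v x))) \<and>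
      (\<forall>\<mu> u. eigenfunction s p \<Omega> \<mu> u \<and> (AE x in lborel. x \<in> \<Omega> \<longrightarrow> u x > 0) \<longrightarrow>
            \<mu> = lambda1 s p \<Omega>)"
    if "diameter \<Omega> < exp (- 1 / (s * p))" "B_const DIM('a) s p \<ge> 0"
  proof -
    interpret small_log_problem \<Omega> s p "B_const DIM('a) s p" "C_const DIM('a) s p"
      using that by unfold_locales
    obtain \<phi> where "extremal s p \<Omega> \<phi>" using extremal_exists by blast
    then have "extremal s p \<Omega> (\<lambda>x. \<bar>\<phi> x\<bar>)" by (rule extremal_abs(1))
    then have "\<exists>\<phi>. extremal s p \<Omega> \<phi> \<and> eigenfunction s p \<Omega> (lambda1 s p \<Omega>) \<phi> \<and>
        (AE x in lborel. x \<in> \<Omega> \<longrightarrow> \<phi> x \<ge> 0)"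
      using extremal_imp_eigenfunction by (intro exI[of _ "\<lambda>x. \<bar>\<phi> x\<bar>"]) auto
    then show ?thesis
      using lambda1_pos lambda1_simple positive_eigenfunction_eigenvalue by blast
  qed
  show ?thesis
    using bdd_below_J extremal_exists extremal_imp_eigenfunction small by auto
qed

end
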